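(* The operator $(T,\mathcal D_0)$ on $\mathcal H$ has a unique self-adjoint extension.
   Context: Fix real $\alpha,\beta>-1$ with $\beta\ge\alpha$, and $\kappa\in\mathbb R_{\ge 0}\cup i\mathbb R_{>0}$. Let $w^{(\alpha,\beta)}(x)=2^{-\alpha-\beta-1}\frac{\Gamma(\alpha+\beta+2)}{\Gamma(\alpha+1)\Gamma(\beta+1)}(1-x)^\alpha(1+x)^\beta$ and $\mathcal H=L^2((-1,1),w^{(\alpha,\beta)}(x)dx)$ with inner product $\langle f,g\rangle=\int_{-1}^1f\overline g\,w^{(\alpha,\beta)}dx$. Let \[T=(1-x^2)^2\frac{d^2}{dx^2}+(1-x^2)[\beta-\alpha-(\alpha+\beta+4)x]\frac{d}{dx}+\tfrac14[\kappa^2-(\alpha+\beta+3)^2](1-x^2)\] with (dense) domain $\mathcal D_0$ = the $f\in\mathcal H$ that are continuously differentiable on $(-1,1)$ with compact support in $(-1,1)$, with $f'$ absolutely continuous and $Tf\in\mathcal H$. *)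

theory Defs
  imports "HOL-Analysis.Analysis"
begin

section \<open>The complex Hilbert space of square-integrable functions\<close>

definition L2_fun :: "'a measure \<Rightarrow> ('a \<Rightarrow> complex) set" where
  "L2_fun M = {f. f \<in> borel_measurable M \<and> integrable M (\<lambda>x. (cmod (f x))\<^sup>2)}"

definition L2_class :: "'a measure \<Rightarrow> ('a \<Rightarrow> complex) \<Rightarrow> ('a \<Rightarrow> complex) set" where
  "L2_class M f = {g \<in> L2_fun M. AE x in M. g x = f x}"

definition L2 :: "'a measure \<Rightarrow> ('a \<Rightarrow> complex) set set" where
  "L2 M = L2_class M ` L2_fun M"

definition L2_rep :: "('a \<Rightarrow> complex) set \<Rightarrow> 'a \<Rightarrow> complex" where
  "L2_rep F = (SOME f. f \<in> F)"

text \<open>The operations on classes are defined through arbitrarily chosen representatives; the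
  lemmas below show that they do not depend on the choice.\<close>

definition L2_add ::
    "'a measure \<Rightarrow> ('a \<Rightarrow> complex) set \<Rightarrow> ('a \<Rightarrow> complex) set \<Rightarrow> ('a \<Rightarrow> complex) set" where
  "L2_add M F G = L2_class M (\<lambda>x. L2_rep F x + L2_rep G x)"

definition L2_scale ::
    "'a measure \<Rightarrow> complex \<Rightarrow> ('a \<Rightarrow> complex) set \<Rightarrow> ('a \<Rightarrow> complex) set" where
  "L2_scale M c F = L2_class M (\<lambda>x. c * L2_rep F x)"

definition L2_inner ::
    "'a measure \<Rightarrow> ('a \<Rightarrow> complex) set \<Rightarrow> ('a \<Rightarrow> complex) set \<Rightarrow> complex" where
  "L2_inner M F G = (LINT x|M. L2_rep F x * cnj (L2_rep G x))"

definition L2_norm :: "'a measure \<Rightarrow> ('a \<Rightarrow> complex) set \<Rightarrow> real" where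
  "L2_norm M F = sqrt (Re (L2_inner M F F))"

definition L2_dist ::
    "'a measure \<Rightarrow> ('a \<Rightarrow> complex) set \<Rightarrow> ('a \<Rightarrow> complex) set \<Rightarrow> real" where
  "L2_dist M F G = L2_norm M (L2_add M F (L2_scale M (-1) G))"

lemma L2_class_eqI:
  assumes "AE x in M. f x = g x"
  shows "L2_class M f = L2_class M g"
proof -
  have "(AE x in M. h x = f x) \<longleftrightarrow> (AE x in M. h x = g x)" for h
  proof
    show "AE x in M. h x = g x" if "AE x in M. h x = f x" using that assms by eventually_elim simp
    show "AE x in M. h x = f x" if "AE x in M. h x = g x" using that assms by eventually_elim simp
  qed
  then show ?thesis by (simp add: L2_class_def)
qed

lemma L2_rep_class:
  assumes "f \<in> L2_fun M"
  shows "L2_rep (L2_class M f) \<in> L2_fun M" "AE x in M. L2_rep (L2_class M f) x = f x"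
proof -
  have "f \<in> L2_class M f" using assms by (simp add: L2_class_def)
  then have "L2_rep (L2_class M f) \<in> L2_class M f" unfolding L2_rep_def by (rule someI[where P = "\<lambda>h. h \<in> L2_class M f"])
  then show "L2_rep (L2_class M f) \<in> L2_fun M" "AE x in M. L2_rep (L2_class M f) x = f x"
    by (auto simp: L2_class_def)
qed

lemma L2_add_class:
  assumes "f \<in> L2_fun M" "g \<in> L2_fun M"
  shows "L2_add M (L2_class M f) (L2_class M g) = L2_class M (\<lambda>x. f x + g x)"
  unfolding L2_add_def
proof (rule L2_class_eqI)
  show "AE x in M. L2_rep (L2_class M f) x + L2_rep (L2_class M g) x = f x + g x"
    using L2_rep_class(2)[OF assms(1)] L2_rep_class(2)[OF assms(2)] by eventually_elim simp
qed

lemma L2_scale_class: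
  assumes "f \<in> L2_fun M"
  shows "L2_scale M c (L2_class M f) = L2_class M (\<lambda>x. c * f x)"
  unfolding L2_scale_def
proof (rule L2_class_eqI)
  show "AE x in M. c * L2_rep (L2_class M f) x = c * f x"
    using L2_rep_class(2)[OF assms] by eventually_elim simp
qed

lemma L2_inner_class:
  assumes "f \<in> L2_fun M" "g \<in> L2_fun M"
  shows "L2_inner M (L2_class M f) (L2_class M g) = (LINT x|M. f x * cnj (g x))"
  unfolding L2_inner_def
proof (rule integral_cong_AE)
  have [measurable]: "f \<in> borel_measurable M" "g \<in> borel_measurable M"
    "L2_rep (L2_class M f) \<in> borel_measurable M" "L2_rep (L2_class M g) \<in> borel_measurable M"
    using assms L2_rep_class(1)[OF assms(1)] L2_rep_class(1)[OF assms(2)]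
    by (auto simp: L2_fun_def)
  show "(\<lambda>x. L2_rep (L2_class M f) x * cnj (L2_rep (L2_class M g) x)) \<in> borel_measurable M"
    "(\<lambda>x. f x * cnj (g x)) \<in> borel_measurable M"
    by (measurable, intro borel_measurable_continuous_on[of cnj] continuous_intros, measurable)+
  show "AE x in M. L2_rep (L2_class M f) x * cnj (L2_rep (L2_class M g) x) = f x * cnj (g x)"
    using L2_rep_class(2)[OF assms(1)] L2_rep_class(2)[OF assms(2)] by eventually_elim simp
qed


section \<open>Unbounded operators, identified with their graphs\<close>

type_synonym 'a L2_graph = "(('a \<Rightarrow> complex) set \<times> ('a \<Rightarrow> complex) set) set"

definition linear_operator :: "'a measure \<Rightarrow> 'a L2_graph \<Rightarrow> bool" where
  "linear_operator M A \<longleftrightarrow>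
     A \<subseteq> L2 M \<times> L2 M \<and> single_valued A \<and>
     (L2_class M (\<lambda>x. 0), L2_class M (\<lambda>x. 0)) \<in> A \<and>
     (\<forall>(f, g) \<in> A. \<forall>(f', g') \<in> A. (L2_add M f f', L2_add M g g') \<in> A) \<and>
     (\<forall>c. \<forall>(f, g) \<in> A. (L2_scale M c f, L2_scale M c g) \<in> A)"

definition densely_defined :: "'a measure \<Rightarrow> 'a L2_graph \<Rightarrow> bool" where
  "densely_defined M A \<longleftrightarrow> (\<forall>u \<in> L2 M. \<forall>e>0. \<exists>f \<in> Domain A. L2_dist M u f < e)"

definition adjoint_graph :: "'a measure \<Rightarrow> 'a L2_graph \<Rightarrow> 'a L2_graph" where
  "adjoint_graph M A =
     {(u, v) \<in> L2 M \<times> L2 M. \<forall>(f, g) \<in> A. L2_inner M g u = L2_inner M f v}"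

definition self_adjoint_operator :: "'a measure \<Rightarrow> 'a L2_graph \<Rightarrow> bool" where
  "self_adjoint_operator M A \<longleftrightarrow>
     linear_operator M A \<and> densely_defined M A \<and> adjoint_graph M A = A"


section \<open>The operator \<open>T\<close>\<close>

definition abs_continuous_on :: "real set \<Rightarrow> (real \<Rightarrow> 'b::real_normed_vector) \<Rightarrow> bool" where
  "abs_continuous_on S f \<longleftrightarrow>
     (\<forall>e>0. \<exists>d>0. \<forall>P. finite P \<and> (\<forall>(a, b) \<in> P. a < b \<and> {a..b} \<subseteq> S) \<and>
        pairwise (\<lambda>(a, b) (a', b'). {a<..<b} \<inter> {a'<..<b'} = {}) P \<and>
        (\<Sum>(a, b) \<in> P. b - a) < d \<longrightarrow> (\<Sum>(a, b) \<in> P. norm (f b - f a)) < e)"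

definition jacobi_weight :: "real \<Rightarrow> real \<Rightarrow> real \<Rightarrow> real" where
  "jacobi_weight \<alpha> \<beta> x =
     2 powr (-\<alpha> - \<beta> - 1) * (Gamma (\<alpha> + \<beta> + 2) / (Gamma (\<alpha> + 1) * Gamma (\<beta> + 1)))
       * (1 - x) powr \<alpha> * (1 + x) powr \<beta>"

definition jacobi_measure :: "real \<Rightarrow> real \<Rightarrow> real measure" where
  "jacobi_measure \<alpha> \<beta> =
     density (restrict_space lborel {-1<..<1}) (\<lambda>x. ennreal (jacobi_weight \<alpha> \<beta> x))"

definition T_expr ::
    "real \<Rightarrow> real \<Rightarrow> complex \<Rightarrow> (real \<Rightarrow> complex) \<Rightarrow> (real \<Rightarrow> complex) \<Rightarrow> (real \<Rightarrow> complex)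
       \<Rightarrow> real \<Rightarrow> complex" where
  "T_expr \<alpha> \<beta> \<kappa> f f' f'' x =
     of_real ((1 - x\<^sup>2)\<^sup>2) * f'' x
     + of_real ((1 - x\<^sup>2) * (\<beta> - \<alpha> - (\<alpha> + \<beta> + 4) * x)) * f' x
     + 1 / 4 * (\<kappa>\<^sup>2 - of_real ((\<alpha> + \<beta> + 3)\<^sup>2)) * of_real (1 - x\<^sup>2) * f x"

text \<open>The graph of \<open>(T, \<D>\<^sub>0)\<close>. An absolutely continuous \<open>f'\<close> is differentiable
  only almost everywhere, so \<open>f''\<close> is any function that agrees almost everywhere with the
  derivative of \<open>f'\<close>; the class of \<open>T f\<close> does not depend on its choice.
  The values of \<open>f\<close> outside \<open>(-1, 1)\<close>, which is the space of the measure, play no role.\<close>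

definition T_graph :: "real \<Rightarrow> real \<Rightarrow> complex \<Rightarrow> real L2_graph" where
  "T_graph \<alpha> \<beta> \<kappa> =
     {(L2_class (jacobi_measure \<alpha> \<beta>) f,
       L2_class (jacobi_measure \<alpha> \<beta>) (T_expr \<alpha> \<beta> \<kappa> f f' f'')) | f f' f''.
        f \<in> L2_fun (jacobi_measure \<alpha> \<beta>) \<and>
        (\<forall>x \<in> {-1<..<1}. (f has_vector_derivative f' x) (at x)) \<and>
        continuous_on {-1<..<1} f' \<and>
        (\<exists>K. compact K \<and> K \<subseteq> {-1<..<1} \<and> (\<forall>x \<in> {-1<..<1} - K. f x = 0)) \<and>
        abs_continuous_on {-1<..<1} f' \<and>
        (AE x in lborel. x \<in> {-1<..<1} \<longrightarrow> (f' has_vector_derivative f'' x) (at x)) \<and>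
        T_expr \<alpha> \<beta> \<kappa> f f' f'' \<in> L2_fun (jacobi_measure \<alpha> \<beta>)}"

end

theory Submission
  imports Defs "HOL-Real_Asymp.Real_Asymp"
begin

text \<open>
  With \<open>p = (1 - x\<^sup>2)\<^sup>2 w\<close> one has \<open>T f = (p f')' / w + q f\<close> with a bounded real \<open>q\<close>, that is, up to
  \<open>q\<close>, a weighted Laplacian for the complete metric \<open>dx / (1 - x\<^sup>2)\<close>. Restrict \<open>T\<close> to \<open>T\<^sub>0\<close> on \<open>C\<^sup>2\<close>
  functions with compact support. An adjoint pair \<open>(u, v)\<close> of \<open>T\<^sub>0\<close> has, by the du Bois-Reymond
  argument, a \<open>C\<^sup>1\<close> representative \<open>u\<close> with \<open>(p u')' = w (v - q u)\<close> in the weak sense. There are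
  cutoffs \<open>\<chi>\<^sub>n\<close> tending to \<open>1\<close> with \<open>p \<chi>\<^sub>n'\<^sup>2 = O(w / n\<^sup>2)\<close>; testing with \<open>\<chi>\<^sub>n\<^sup>2 u\<close> bounds the energies
  \<open>\<integral> \<chi>\<^sub>n\<^sup>2 p |u'|\<^sup>2\<close> uniformly in \<open>n\<close>, and this makes the boundary terms in Green's formula for two
  adjoint pairs vanish in the limit. So the adjoint of \<open>T\<^sub>0\<close> is symmetric, hence self-adjoint,
  and it is the only self-adjoint extension of \<open>T\<^sub>0\<close>. It also extends \<open>T\<close>.
\<close>

section \<open>Square-integrable functions\<close>

text \<open>The obstacle is that an adjoint pair is known only through square integrability, which
  says nothing about \<open>u\<close> or \<open>p u'\<close> at the end points. Asymptotics of
  solutions are never studied, so no case distinction in \<alpha> and \<beta> arises; completeness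
  takes their place, because it provides cutoffs with gradient O(1/n). Using the square of the
  cutoff leaves one factor \<open>\<chi>\<^sub>n\<close> next to its derivative in the cross term
  \<open>2 \<chi>\<^sub>n \<chi>\<^sub>n' p U V'\<close>, so that Young's inequality can absorb this
  term into the energy of V. In Green's formula for two pairs the gradient terms
  \<open>p U' V'\<close> cancel and only cross terms survive; Young's inequality with parameter 1/n
  makes them O(1/n). T lies between \<open>T\<^sub>0\<close> and the adjoint of
  \<open>T\<^sub>0\<close>, so the absolute continuity of f' enters only in one integration by
  parts, which shows that T is contained in that adjoint. A real or purely imaginary \<kappa> has a
  real square; therefore q is real, and the formal symmetry of T rests on this.\<close>

lemma borel_measurable_cnj [measurable]: "cnj \<in> borel_measurable borel"
  by (intro borel_measurable_continuous_onI continuous_intros)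

lemma L2_funD [dest]:
  assumes "f \<in> L2_fun M"
  shows "f \<in> borel_measurable M" "integrable M (\<lambda>x. (cmod (f x))\<^sup>2)"
  using assms by (auto simp: L2_fun_def)

lemma cmod_add_square_le: "(cmod (a + b))\<^sup>2 \<le> 2 * (cmod a)\<^sup>2 + 2 * (cmod b)\<^sup>2"
proof -
  have "(cmod (a + b))\<^sup>2 \<le> (cmod a + cmod b)\<^sup>2"
    by (intro power_mono norm_triangle_ineq) auto
  also have "\<dots> \<le> 2 * (cmod a)\<^sup>2 + 2 * (cmod b)\<^sup>2"
    using sum_squares_bound[of "cmod a" "cmod b"] by (simp add: power2_sum)
  finally show ?thesis .
qed

lemma L2_fun_add:
  assumes "f \<in> L2_fun M" "g \<in> L2_fun M"
  shows "(\<lambda>x. f x + g x) \<in> L2_fun M"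
proof -
  note [measurable] = L2_funD(1)[OF assms(1)] L2_funD(1)[OF assms(2)]
  have "integrable M (\<lambda>x. (cmod (f x + g x))\<^sup>2)"
  proof (rule Bochner_Integration.integrable_bound)
    show "integrable M (\<lambda>x. 2 * (cmod (f x))\<^sup>2 + 2 * (cmod (g x))\<^sup>2)"
      using L2_funD(2)[OF assms(1)] L2_funD(2)[OF assms(2)] by simp
  qed (use cmod_add_square_le in auto)
  then show ?thesis by (auto simp: L2_fun_def)
qed

lemma L2_fun_scale:
  assumes "f \<in> L2_fun M"
  shows "(\<lambda>x. c * f x) \<in> L2_fun M"
  using assms by (auto simp: L2_fun_def norm_mult power_mult_distrib)

lemma L2_fun_zero: "(\<lambda>x. 0) \<in> L2_fun M"
  by (auto simp: L2_fun_def)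

lemma L2_fun_diff:
  assumes "f \<in> L2_fun M" "g \<in> L2_fun M"
  shows "(\<lambda>x. f x - g x) \<in> L2_fun M"
  using L2_fun_add[OF assms(1) L2_fun_scale[OF assms(2), of "-1"]] by simp

lemma L2_fun_cnj:
  assumes "f \<in> L2_fun M"
  shows "(\<lambda>x. cnj (f x)) \<in> L2_fun M"
proof -
  note [measurable] = L2_funD(1)[OF assms]
  show ?thesis using L2_funD(2)[OF assms] by (auto simp: L2_fun_def)
qed

lemma L2_fun_bound:
  assumes "f \<in> L2_fun M" "h \<in> borel_measurable M" "AE x in M. cmod (h x) \<le> C * cmod (f x)"
  shows "h \<in> L2_fun M"
proof -
  note [measurable] = L2_funD(1)[OF assms(1)] assms(2)
  have "integrable M (\<lambda>x. (cmod (h x))\<^sup>2)"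
  proof (rule Bochner_Integration.integrable_bound)
    show "integrable M (\<lambda>x. C\<^sup>2 * (cmod (f x))\<^sup>2)" using L2_funD(2)[OF assms(1)] by simp
    show "AE x in M. norm ((cmod (h x))\<^sup>2) \<le> norm (C\<^sup>2 * (cmod (f x))\<^sup>2)"
      using assms(3)
    proof eventually_elim
      case (elim x)
      then have "(cmod (h x))\<^sup>2 \<le> (C * cmod (f x))\<^sup>2" by (intro power_mono) auto
      then show ?case by (simp add: power_mult_distrib)
    qed
  qed measurable
  then show ?thesis using assms(2) by (simp add: L2_fun_def)
qed

lemma L2_fun_mult_integrable:
  assumes "f \<in> L2_fun M" "g \<in> L2_fun M"
  shows "integrable M (\<lambda>x. f x * g x)"
proof -
  note [measurable] = L2_funD(1)[OF assms(1)] L2_funD(1)[OF assms(2)]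
  show ?thesis
  proof (rule Bochner_Integration.integrable_bound)
    show "integrable M (\<lambda>x. (cmod (f x))\<^sup>2 + (cmod (g x))\<^sup>2)"
      using L2_funD(2)[OF assms(1)] L2_funD(2)[OF assms(2)] by simp
    have "cmod a * cmod b \<le> (cmod a)\<^sup>2 + (cmod b)\<^sup>2" for a b
    proof -
      have "0 \<le> cmod a * cmod b" by simp
      then show ?thesis using sum_squares_bound[of "cmod a" "cmod b"] by linarith
    qed
    then show "AE x in M. norm (f x * g x) \<le> norm ((cmod (f x))\<^sup>2 + (cmod (g x))\<^sup>2)"
      by (auto simp: norm_mult)
  qed measurable
qed

lemma L2_fun_inner_integrable:
  assumes "f \<in> L2_fun M" "g \<in> L2_fun M"
  shows "integrable M (\<lambda>x. f x * cnj (g x))"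
  by (rule L2_fun_mult_integrable[OF assms(1) L2_fun_cnj[OF assms(2)]])

lemma L2_classI [intro]: "f \<in> L2_fun M \<Longrightarrow> L2_class M f \<in> L2 M"
  by (simp add: L2_def)

lemma L2E:
  assumes "F \<in> L2 M"
  obtains f where "f \<in> L2_fun M" "F = L2_class M f"
  using assms by (auto simp: L2_def)

lemma L2_dist_class:
  assumes "f \<in> L2_fun M" "g \<in> L2_fun M"
  shows "L2_dist M (L2_class M f) (L2_class M g) = sqrt (LINT x|M. (cmod (f x - g x))\<^sup>2)"
proof -
  have d: "(\<lambda>x. f x + - 1 * g x) \<in> L2_fun M" using L2_fun_diff[OF assms] by simp
  have "L2_dist M (L2_class M f) (L2_class M g)
      = sqrt (Re (LINT x|M. (f x - g x) * cnj (f x - g x)))"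
    using L2_inner_class[OF d d] L2_fun_scale[OF assms(2), of "-1"] assms(1)
    by (simp add: L2_dist_def L2_norm_def L2_scale_class[OF assms(2)] L2_add_class)
  also have "\<dots> = sqrt (LINT x|M. (cmod (f x - g x))\<^sup>2)"
    by (simp only: complex_norm_square[symmetric] integral_complex_of_real Re_complex_of_real)
  finally show ?thesis .
qed

text \<open>Pythagoras: if \<open>\<langle>f, d\<rangle> = 0\<close> then \<open>\<parallel>d\<parallel> \<le> \<parallel>d - f\<parallel>\<close>.\<close>

lemma AE_zero_if_orthogonal_dense:
  assumes d: "d \<in> L2_fun M" and S: "S \<subseteq> L2_fun M"
    and dense: "\<And>e. e > 0 \<Longrightarrow> \<exists>f\<in>S. (LINT x|M. (cmod (d x - f x))\<^sup>2) < e"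
    and orth: "\<And>f. f \<in> S \<Longrightarrow> (LINT x|M. f x * cnj (d x)) = 0"
  shows "AE x in M. d x = 0"
proof -
  have le: "(LINT x|M. (cmod (d x))\<^sup>2) \<le> (LINT x|M. (cmod (d x - f x))\<^sup>2)" if "f \<in> S" for f
  proof -
    have f: "f \<in> L2_fun M" using S that by auto
    note int = L2_funD(2)[OF d] L2_funD(2)[OF f] L2_fun_inner_integrable[OF f d]
    have eq: "(cmod (d x - f x))\<^sup>2
        = (cmod (d x))\<^sup>2 + (cmod (f x))\<^sup>2 - 2 * Re (f x * cnj (d x))" for x
      unfolding cmod_power2 by (simp add: power2_eq_square algebra_simps)
    have "(LINT x|M. (cmod (d x - f x))\<^sup>2)
        = (LINT x|M. (cmod (d x))\<^sup>2) + (LINT x|M. (cmod (f x))\<^sup>2)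
          - 2 * Re (LINT x|M. f x * cnj (d x))"
      unfolding eq using int
      by (subst Bochner_Integration.integral_diff integral_mult_right_zero
          Bochner_Integration.integral_add integral_Re; (simp del: times_complex.sel cnj.sel)?)+
    then show ?thesis using orth[OF that] by simp
  qed
  have "(LINT x|M. (cmod (d x))\<^sup>2) \<le> 0"
  proof (rule field_le_epsilon)
    fix e :: real assume "e > 0"
    from dense[OF this] le show "(LINT x|M. (cmod (d x))\<^sup>2) \<le> 0 + e" by fastforce
  qed
  moreover have "(LINT x|M. (cmod (d x))\<^sup>2) \<ge> 0" by simp
  ultimately have "(LINT x|M. (cmod (d x))\<^sup>2) = 0" by linarith
  then have "AE x in M. (cmod (d x))\<^sup>2 = 0"
    using integral_nonneg_eq_0_iff_AE[OF L2_funD(2)[OF d]] by simp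
  then show ?thesis by simp
qed

section \<open>A criterion for the uniqueness of self-adjoint extensions\<close>

lemma adjoint_graph_antimono: "A \<subseteq> B \<Longrightarrow> adjoint_graph M B \<subseteq> adjoint_graph M A"
  by (auto simp: adjoint_graph_def)

text \<open>Density makes the adjoint a function: the difference of two values at the same
  \<open>U\<close> is orthogonal to a dense domain, hence zero. The other clauses hold because the
  defining identities survive sums and multiples of pairs.\<close>

lemma linear_operator_adjoint_graph:
  assumes A: "A \<subseteq> L2 M \<times> L2 M" and dense: "densely_defined M A"
  shows "linear_operator M (adjoint_graph M A)"
  unfolding linear_operator_def
proof (intro conjI)
  show "adjoint_graph M A \<subseteq> L2 M \<times> L2 M" by (auto simp: adjoint_graph_def)
  show "single_valued (adjoint_graph M A)"
  proof (rule single_valuedI)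
    fix U V V' assume UV: "(U, V) \<in> adjoint_graph M A" "(U, V') \<in> adjoint_graph M A"
    then obtain v v' where v: "v \<in> L2_fun M" "V = L2_class M v"
      and v': "v' \<in> L2_fun M" "V' = L2_class M v'"
      by (auto simp: adjoint_graph_def elim!: L2E)
    define d where "d = (\<lambda>x. v x - v' x)"
    have d: "d \<in> L2_fun M" unfolding d_def by (rule L2_fun_diff[OF v(1) v'(1)])
    have "AE x in M. d x = 0"
    proof (rule AE_zero_if_orthogonal_dense[OF d, of "{f \<in> L2_fun M. L2_class M f \<in> Domain A}"])
      fix e :: real assume "e > 0"
      then obtain F where F: "F \<in> Domain A" "L2_dist M (L2_class M d) F < sqrt e"
        using dense d unfolding densely_defined_def by (metis L2_classI real_sqrt_gt_zero)
      then obtain f where f: "f \<in> L2_fun M" "F = L2_class M f"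
        using A by (auto elim!: L2E)
      with F show "\<exists>f\<in>{f \<in> L2_fun M. L2_class M f \<in> Domain A}. (LINT x|M. (cmod (d x - f x))\<^sup>2) < e"
        by (auto simp: L2_dist_class[OF d])
    next
      fix f assume "f \<in> {f \<in> L2_fun M. L2_class M f \<in> Domain A}"
      then obtain G where f: "f \<in> L2_fun M" and G: "(L2_class M f, G) \<in> A" by auto
      with UV have "L2_inner M (L2_class M f) V = L2_inner M (L2_class M f) V'"
        by (fastforce simp: adjoint_graph_def)
      then show "(LINT x|M. f x * cnj (d x)) = 0"
        unfolding d_def v v' using L2_fun_inner_integrable[OF f v(1)] L2_fun_inner_integrable[OF f v'(1)]
        by (simp add: L2_inner_class f v v' right_diff_distrib)
    qed auto
    then have "AE x in M. v x = v' x" unfolding d_def by simp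
    then show "V = V'" unfolding v v' by (rule L2_class_eqI)
  qed
  show "(L2_class M (\<lambda>x. 0), L2_class M (\<lambda>x. 0)) \<in> adjoint_graph M A"
  proof -
    have "L2_inner M G (L2_class M (\<lambda>x. 0)) = L2_inner M F (L2_class M (\<lambda>x. 0))"
      if "(F, G) \<in> A" for F G
    proof -
      have "F \<in> L2 M" "G \<in> L2 M" using that A by auto
      then show ?thesis by (auto simp: L2_fun_zero L2_inner_class elim!: L2E)
    qed
    then show ?thesis by (auto simp: adjoint_graph_def L2_fun_zero)
  qed
  show "\<forall>(f, g)\<in>adjoint_graph M A. \<forall>(f', g')\<in>adjoint_graph M A.
          (L2_add M f f', L2_add M g g') \<in> adjoint_graph M A"
  proof clarify
    fix U V U' V' assume UV: "(U, V) \<in> adjoint_graph M A" "(U', V') \<in> adjoint_graph M A"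
    then obtain u v u' v' where uv: "u \<in> L2_fun M" "v \<in> L2_fun M" "u' \<in> L2_fun M" "v' \<in> L2_fun M"
      "U = L2_class M u" "V = L2_class M v" "U' = L2_class M u'" "V' = L2_class M v'"
      by (auto simp: adjoint_graph_def elim!: L2E)
    have "L2_inner M G (L2_add M U U') = L2_inner M F (L2_add M V V')" if "(F, G) \<in> A" for F G
    proof -
      from that A obtain f g where fg: "f \<in> L2_fun M" "g \<in> L2_fun M" "F = L2_class M f" "G = L2_class M g"
        by (auto elim!: L2E dest!: subsetD)
      have "L2_inner M G U = L2_inner M F V" "L2_inner M G U' = L2_inner M F V'"
        using UV that by (auto simp: adjoint_graph_def)
      moreover note L2_fun_inner_integrable[OF fg(2) uv(1)] L2_fun_inner_integrable[OF fg(2) uv(3)]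
        L2_fun_inner_integrable[OF fg(1) uv(2)] L2_fun_inner_integrable[OF fg(1) uv(4)]
      ultimately show ?thesis using uv fg
        by (simp add: L2_add_class L2_inner_class L2_fun_add ring_distribs)
    qed
    then show "(L2_add M U U', L2_add M V V') \<in> adjoint_graph M A"
      using uv by (auto simp: adjoint_graph_def L2_add_class L2_fun_add)
  qed
  show "\<forall>c. \<forall>(f, g)\<in>adjoint_graph M A. (L2_scale M c f, L2_scale M c g) \<in> adjoint_graph M A"
  proof clarify
    fix c U V assume UV: "(U, V) \<in> adjoint_graph M A"
    then obtain u v where uv: "u \<in> L2_fun M" "v \<in> L2_fun M" "U = L2_class M u" "V = L2_class M v"
      by (auto simp: adjoint_graph_def elim!: L2E)
    have "L2_inner M G (L2_scale M c U) = L2_inner M F (L2_scale M c V)" if "(F, G) \<in> A" for F G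
    proof -
      from that A obtain f g where fg: "f \<in> L2_fun M" "g \<in> L2_fun M" "F = L2_class M f" "G = L2_class M g"
        by (auto elim!: L2E dest!: subsetD)
      have "L2_inner M G U = L2_inner M F V"
        using UV that by (auto simp: adjoint_graph_def)
      then show ?thesis using uv fg
        by (simp add: L2_scale_class L2_inner_class L2_fun_scale mult.left_commute[of _ "cnj c"])
    qed
    then show "(L2_scale M c U, L2_scale M c V) \<in> adjoint_graph M A"
      using uv by (auto simp: adjoint_graph_def L2_scale_class L2_fun_scale)
  qed
qed

text \<open>The symmetry of the adjoint of \<open>S\<close> makes this adjoint equal to the adjoint of itself,
  and it contains every self-adjoint extension of \<open>S\<close>.\<close>

theorem unique_self_adjoint_extension:
  assumes ST: "S \<subseteq> T" and T: "T \<subseteq> adjoint_graph M S" and dense: "densely_defined M S"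
    and sym: "\<And>u v u' v'. (u, v) \<in> adjoint_graph M S \<Longrightarrow> (u', v') \<in> adjoint_graph M S \<Longrightarrow>
      L2_inner M v u' = L2_inner M u v'"
  shows "\<exists>!A. self_adjoint_operator M A \<and> T \<subseteq> A"
proof -
  let ?B = "adjoint_graph M S"
  have S: "S \<subseteq> ?B" using ST T by blast
  have B: "adjoint_graph M ?B = ?B"
  proof
    show "adjoint_graph M ?B \<subseteq> ?B" by (rule adjoint_graph_antimono[OF S])
    have "?B \<subseteq> L2 M \<times> L2 M" by (auto simp: adjoint_graph_def)
    then show "?B \<subseteq> adjoint_graph M ?B"
      unfolding adjoint_graph_def[of M ?B] using sym by auto
  qed
  show ?thesis
  proof (rule ex1I[of _ ?B])
    have "densely_defined M ?B" using dense S unfolding densely_defined_def by blast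
    moreover have "S \<subseteq> L2 M \<times> L2 M" using S by (auto simp: adjoint_graph_def)
    ultimately show "self_adjoint_operator M ?B \<and> T \<subseteq> ?B"
      unfolding self_adjoint_operator_def using linear_operator_adjoint_graph[OF _ dense] B T by auto
  next
    fix A assume A: "self_adjoint_operator M A \<and> T \<subseteq> A"
    then have AA: "adjoint_graph M A = A" by (simp add: self_adjoint_operator_def)
    have "A \<subseteq> ?B" using adjoint_graph_antimono[of S A M] A ST AA by auto
    \<comment> \<open>Self-adjoint graphs are maximal: taking adjoints reverses the inclusion just
      shown, and both sides are their own adjoints.\<close>
    moreover have "?B \<subseteq> A" using adjoint_graph_antimono[OF \<open>A \<subseteq> ?B\<close>, of M] AA B by auto
    ultimately show "A = ?B" by auto
  qed
qed

section \<open>Compactly supported functions on the interval\<close>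

text \<open>A total function that vanishes near and beyond the end points is its own extension by
  zero, so integrals over the line can replace integrals over the interval. A negative radius is
  allowed and forces k = 0; \<open>CcE\<close> always supplies a positive one.\<close>

definition Cc :: "(real \<Rightarrow> complex) \<Rightarrow> bool" where
  "Cc k \<longleftrightarrow> continuous_on UNIV k \<and> (\<exists>r<1. \<forall>x. r < \<bar>x\<bar> \<longrightarrow> k x = 0)"

definition C1c :: "(real \<Rightarrow> complex) \<Rightarrow> (real \<Rightarrow> complex) \<Rightarrow> bool" where
  "C1c k k' \<longleftrightarrow> (\<forall>x. (k has_vector_derivative k' x) (at x)) \<and> Cc k \<and> Cc k'"

definition C2c :: "(real \<Rightarrow> complex) \<Rightarrow> (real \<Rightarrow> complex) \<Rightarrow> (real \<Rightarrow> complex) \<Rightarrow> bool" where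
  "C2c k k' k'' \<longleftrightarrow> C1c k k' \<and> C1c k' k''"

lemma C1cD:
  assumes "C1c k k'"
  shows "(k has_vector_derivative k' x) (at x)" "Cc k" "Cc k'"
  using assms by (auto simp: C1c_def)

lemma C2cD:
  assumes "C2c k k' k''"
  shows "C1c k k'" "C1c k' k''"
  using assms by (auto simp: C2c_def)

lemma CcE:
  assumes "Cc k"
  obtains r where "0 < r" "r < 1" "\<And>x. r < \<bar>x\<bar> \<Longrightarrow> k x = 0"
proof -
  from assms obtain r where "r < 1" "\<And>x. r < \<bar>x\<bar> \<Longrightarrow> k x = 0" by (auto simp: Cc_def)
  then show thesis by (intro that[of "max r (1/2)"]) auto
qed

lemma Cc_continuous: "Cc k \<Longrightarrow> continuous_on A k"
  by (auto simp: Cc_def intro: continuous_on_subset)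

lemma Cc_zero_outside: "Cc k \<Longrightarrow> x \<notin> {-1<..<1} \<Longrightarrow> k x = 0"
  by (erule CcE) (auto simp: abs_if)

lemma Cc_measurable: "Cc k \<Longrightarrow> k \<in> borel_measurable borel"
  by (intro borel_measurable_continuous_onI Cc_continuous)

lemma Cc_integrable:
  assumes "Cc k"
  shows "integrable lborel k"
proof -
  have "set_integrable lborel {-1..1} k"
    by (intro borel_integrable_atLeastAtMost' Cc_continuous assms)
  moreover have "(\<lambda>x. indicator {-1..1} x *\<^sub>R k x) = k"
    using Cc_zero_outside[OF assms] by (force simp: indicator_def)
  ultimately show ?thesis by (simp add: set_integrable_def)
qed

lemma Cc_bounded:
  assumes "Cc k"
  obtains B where "B > 0" "\<And>x. cmod (k x) \<le> B"
proof -
  have "compact (k ` {-1..1})" by (intro compact_continuous_image Cc_continuous assms) auto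
  then obtain B where B: "B > 0" "\<And>x. x \<in> {-1..1} \<Longrightarrow> cmod (k x) \<le> B"
    using compact_imp_bounded bounded_pos by (metis (no_types, lifting) imageI)
  have "cmod (k x) \<le> B" for x
    using B Cc_zero_outside[OF assms, of x] by (cases "x \<in> {-1..1}") auto
  with B(1) show thesis by (rule that)
qed

lemma Cc_add:
  assumes "Cc k" "Cc l"
  shows "Cc (\<lambda>x. k x + l x)"
proof -
  obtain r s where "r < 1" "s < 1" "\<And>x. r < \<bar>x\<bar> \<Longrightarrow> k x = 0" "\<And>x. s < \<bar>x\<bar> \<Longrightarrow> l x = 0"
    using assms by (metis CcE)
  then have "max r s < 1 \<and> (\<forall>x. max r s < \<bar>x\<bar> \<longrightarrow> k x + l x = 0)" by simp
  then show ?thesis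
    using assms Cc_continuous[OF assms(1)] Cc_continuous[OF assms(2)] 
    unfolding Cc_def by (blast intro: continuous_intros)
qed

text \<open>Continuity is local, and two open sets cover the line: the interval, and the region
  beyond r, where k vanishes.\<close>

lemma CcI:
  assumes cont: "continuous_on {-1<..<1} k" and r: "r < 1" "\<And>x. r < \<bar>x\<bar> \<Longrightarrow> k x = 0"
  shows "Cc k"
proof -
  have "continuous_on ({-1<..<1} \<union> ({..<-r} \<union> {r<..})) k"
  proof (rule continuous_on_open_Un[OF _ _ cont])
    have "continuous_on ({..<-r} \<union> {r<..}) (\<lambda>x. 0 :: complex)" by simp
    then show "continuous_on ({..<-r} \<union> {r<..}) k"
      by (rule continuous_on_eq) (use r in \<open>auto simp: abs_if\<close>)
  qed (auto intro!: open_Un)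
  moreover have "{-1<..<1} \<union> ({..<-r} \<union> {r<..}) = UNIV" using r by auto
  ultimately show ?thesis using r by (auto simp: Cc_def intro!: exI[of _ r])
qed

lemma C1cI:
  assumes deriv: "\<And>x. x \<in> {-1<..<1} \<Longrightarrow> (k has_vector_derivative k' x) (at x)"
    and cont: "continuous_on {-1<..<1} k'"
    and r: "r < 1" "\<And>x. r < \<bar>x\<bar> \<Longrightarrow> k x = 0" "\<And>x. r < \<bar>x\<bar> \<Longrightarrow> k' x = 0"
  shows "C1c k k'"
  unfolding C1c_def
proof (intro conjI allI)
  show "Cc k"
    by (rule CcI[OF _ r(1,2)])
      (intro continuous_at_imp_continuous_on ballI has_vector_derivative_continuous, erule deriv)
  show "Cc k'" by (rule CcI[OF cont r(1,3)])
  fix x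
  show "(k has_vector_derivative k' x) (at x)"
  proof (cases "x \<in> {-1<..<1}")
    case False
    have "((\<lambda>x. 0) has_vector_derivative 0) (at x)" by simp
    then have "(k has_vector_derivative 0) (at x)"
    proof (rule has_vector_derivative_transform_within_open)
      show "open ({..<-r} \<union> {r<..})" by (auto intro!: open_Un)
    qed (use False r in \<open>auto simp: abs_if\<close>)
    moreover have "r < \<bar>x\<bar>" using False r(1) by auto
    ultimately show ?thesis using r(3) by simp
  qed (rule deriv)
qed

text \<open>The factor \<open>h\<close> may blow up at the end points or be arbitrary outside the
  interval, as 1/p, 1/w and weak solutions may; the support of \<open>k\<close> hides this.\<close>

lemma Cc_mult:
  assumes k: "Cc k" and h: "continuous_on {-1<..<1} h"
  shows "Cc (\<lambda>x. k x * h x)"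
proof -
  obtain r where "r < 1" "\<And>x. r < \<bar>x\<bar> \<Longrightarrow> k x = 0" using k by (metis CcE)
  then show ?thesis
    by (intro CcI[OF continuous_on_mult[OF Cc_continuous[OF k] h], of r]) auto
qed

lemma Cc_of_real_mult:
  assumes "Cc k" "continuous_on {-1<..<1} h"
  shows "Cc (\<lambda>x. k x * of_real (h x))"
  by (intro Cc_mult assms continuous_intros)

lemma Cc_scale: "Cc k \<Longrightarrow> Cc (\<lambda>x. c * k x)"
  using Cc_mult[of k "\<lambda>_. c"] by (simp add: mult.commute)

lemma C1c_mult:
  assumes k: "C1c k k'" and h: "\<And>x. x \<in> {-1<..<1} \<Longrightarrow> (h has_vector_derivative h' x) (at x)"
    and h': "continuous_on {-1<..<1} h'"
  shows "C1c (\<lambda>x. k x * h x) (\<lambda>x. k' x * h x + k x * h' x)"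
proof -
  obtain r where r: "r < 1" "\<And>x. r < \<bar>x\<bar> \<Longrightarrow> k x = 0" using C1cD(2)[OF k] by (metis CcE)
  obtain r' where r': "r' < 1" "\<And>x. r' < \<bar>x\<bar> \<Longrightarrow> k' x = 0" using C1cD(3)[OF k] by (metis CcE)
  have cont: "continuous_on {-1<..<1} h"
    using h by (intro continuous_at_imp_continuous_on ballI has_vector_derivative_continuous) auto
  show ?thesis
  proof (rule C1cI[of _ _ "max r r'"])
    fix x :: real assume "x \<in> {-1<..<1}"
    from has_vector_derivative_mult[OF C1cD(1)[OF k] h[OF this]]
    show "((\<lambda>x. k x * h x) has_vector_derivative k' x * h x + k x * h' x) (at x)"
      by (simp add: add.commute)
  next
    show "continuous_on {-1<..<1} (\<lambda>x. k' x * h x + k x * h' x)"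
      by (intro continuous_on_add continuous_on_mult cont h' Cc_continuous[OF C1cD(2)[OF k]]
          Cc_continuous[OF C1cD(3)[OF k]])
  qed (use r r' in auto)
qed

lemma C1c_integral_zero:
  assumes "C1c k k'"
  shows "(LINT x|lborel. k' x) = 0"
proof -
  have "((\<lambda>x. k' x) has_integral (k 1 - k (-1))) {-1..1}"
    by (intro fundamental_theorem_of_calculus)
      (auto intro: has_vector_derivative_at_within C1cD(1)[OF assms])
  moreover have "k 1 = 0" "k (-1) = 0" using Cc_zero_outside[OF C1cD(2)[OF assms]] by auto
  ultimately have "(k' has_integral 0) {-1..1}" by simp
  then have "((\<lambda>x. if x \<in> {-1..1} then k' x else 0) has_integral 0) UNIV"
    by (subst has_integral_restrict_UNIV)
  moreover have "(\<lambda>x. if x \<in> {-1..1} then k' x else 0) = k'"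
    using Cc_zero_outside[OF C1cD(3)[OF assms]] by force
  ultimately have "(k' has_integral 0) UNIV" by simp
  then show ?thesis
    using has_integral_integral_lborel[OF Cc_integrable[OF C1cD(3)[OF assms]]] has_integral_unique
    by blast
qed

lemma C1c_integral_by_parts:
  assumes k: "C1c k k'" and h: "\<And>x. x \<in> {-1<..<1} \<Longrightarrow> (h has_vector_derivative h' x) (at x)"
    and h': "continuous_on {-1<..<1} h'"
  shows "(LINT x|lborel. k' x * h x) = - (LINT x|lborel. k x * h' x)"
proof -
  have cont: "continuous_on {-1<..<1} h"
    using h by (intro continuous_at_imp_continuous_on ballI has_vector_derivative_continuous) auto
  have "(LINT x|lborel. k' x * h x) + (LINT x|lborel. k x * h' x)
      = (LINT x|lborel. k' x * h x + k x * h' x)"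
    by (intro Bochner_Integration.integral_add[symmetric] Cc_integrable Cc_mult C1cD[OF k] cont h')
  also have "\<dots> = 0" by (intro C1c_integral_zero[OF C1c_mult] assms)
  finally show ?thesis by (simp add: eq_neg_iff_add_eq_0)
qed

text \<open>The indefinite integral of \<open>k\<close> is constant to the right of the support, and
  the zero mean makes this constant 0.\<close>

lemma Cc_antiderivative:
  assumes k: "Cc k" and 0: "(LINT x|lborel. k x) = 0"
  obtains K where "C1c K k"
proof -
  obtain r where r: "0 < r" "r < 1" "\<And>x. r < \<bar>x\<bar> \<Longrightarrow> k x = 0" using k by (metis CcE)
  \<comment> \<open>The base point -2 lies to the left of the support. For x < -2 the range of
    integration is empty and \<open>K x = 0\<close>, as it should be.\<close>
  define K where "K x = integral {-2..x} k" for x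
  have int: "k integrable_on {a..b}" for a b
    by (intro integrable_continuous_real Cc_continuous k)
  have zero: "K x = 0" if "r < \<bar>x\<bar>" for x
  proof (cases "x < 0")
    case True
    then have "K x = integral {-2..x} (\<lambda>_. 0)"
      unfolding K_def using that r by (intro integral_cong) auto
    then show ?thesis by simp
  next
    case False
    have "(k has_integral integral {-2..x} k) {-2..x}" using int by (rule integrable_integral)
    then have "(k has_integral integral {-2..x} k) UNIV"
      by (rule has_integral_on_superset) (use that False r in auto)
    then show ?thesis
      unfolding K_def using has_integral_integral_lborel[OF Cc_integrable[OF k]] 0 has_integral_unique
      by metis
  qed
  have deriv: "(K has_vector_derivative k x) (at x)" for x
  proof (cases "x > -2")
    case True
    have "(K has_vector_derivative k x) (at x within {-2..x+1})"
      unfolding K_def by (intro integral_has_vector_derivative Cc_continuous k) (use True in auto)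
    then show ?thesis using at_within_interior[of x "{-2..x+1}"] True by simp
  next
    case False
    have "((\<lambda>x. 0) has_vector_derivative 0) (at x)" by simp
    then have "(K has_vector_derivative 0) (at x)"
      by (rule has_vector_derivative_transform_within_open[of _ _ _ "{..<-1}"])
        (use False r zero in auto)
    then show ?thesis using r(3)[of x] False r by simp
  qed
  moreover have "Cc K"
    unfolding Cc_def using deriv r zero
    by (auto intro!: continuous_at_imp_continuous_on has_vector_derivative_continuous exI[of _ r])
  ultimately show thesis using k by (intro that[of K]) (auto simp: C1c_def)
qed

lemma antiderivative_on_interval:
  fixes f :: "real \<Rightarrow> complex"
  assumes "continuous_on {-1<..<1} f"
  shows "\<exists>F. \<forall>x\<in>{-1<..<1}. (F has_vector_derivative f x) (at x)"
proof -
  have "\<exists>F. \<forall>x. ereal (-1) < ereal x \<longrightarrow> ereal x < ereal 1 \<longrightarrow> (F has_vector_derivative f x) (at x)"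
    by (rule einterval_antiderivative)
      (use assms in \<open>auto simp: continuous_on_eq_continuous_at\<close>)
  then show ?thesis by (simp add: Ball_def imp_conjL)
qed

section \<open>Indefinite integrals\<close>

lemma continuous_on_indefinite_integral:
  fixes g :: "real \<Rightarrow> complex"
  assumes g: "integrable lborel g"
  shows "continuous_on UNIV (\<lambda>t. LINT x|lborel. indicator {..<t} x * g x)"
proof (rule continuous_at_imp_continuous_on, intro ballI)
  note [measurable] = borel_measurable_integrable[OF g]
  fix t :: real
  show "isCont (\<lambda>t. LINT x|lborel. indicator {..<t} x * g x) t"
    unfolding isCont_def
  proof (rule tendsto_at_iff_sequentially[THEN iffD2], intro allI impI)
    fix X :: "nat \<Rightarrow> real" assume "X \<longlonglongrightarrow> t"
    have "(\<lambda>n. LINT x|lborel. indicator {..<X n} x * g x) \<longlonglongrightarrow> (LINT x|lborel. indicator {..<t} x * g x)"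
    proof (rule integral_dominated_convergence)
      \<comment> \<open>At x = t the indicators need not converge, but a single point is a null
        set.\<close>
      show "AE x in lborel. (\<lambda>n. indicator {..<X n} x * g x) \<longlonglongrightarrow> indicator {..<t} x * g x"
        using AE_lborel_singleton[of t]
      proof eventually_elim
        case (elim x)
        have "\<forall>\<^sub>F n in sequentially. indicator {..<X n} x = (indicator {..<t} x :: complex)"
        proof (cases "x < t")
          case True
          then show ?thesis
            by (intro eventually_mono[OF order_tendstoD(1)[OF \<open>X \<longlonglongrightarrow> t\<close>, of x]]) auto
        next
          case False
          then have "t < x" using elim by simp
          then show ?thesis
            by (intro eventually_mono[OF order_tendstoD(2)[OF \<open>X \<longlonglongrightarrow> t\<close>, of x]]) auto
        qed
        then show ?case
          by (intro tendsto_mult tendsto_const) (auto intro: tendsto_eventually)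
      qed
      show "integrable lborel (\<lambda>x. norm (g x))" using g by simp
    qed (auto simp: indicator_def)
    then show "((\<lambda>t. LINT x|lborel. indicator {..<t} x * g x) \<circ> X)
        \<longlonglongrightarrow> (LINT x|lborel. indicator {..<t} x * g x)" by (simp add: o_def)
  qed
qed

text \<open>The indefinite integral of a merely integrable \<open>g\<close> need not be
  differentiable everywhere, so the product rule gives way to Fubini: \<open>k x\<close> is minus
  the integral of \<open>k'\<close> over the half-line beyond x, and the two integrations are
  exchanged.\<close>

lemma C1c_integral_by_parts_indefinite:
  assumes k: "C1c k k'" and g: "integrable lborel g"
  shows "(LINT x|lborel. k x * g x)
    = - (LINT t|lborel. k' t * (LINT x|lborel. indicator {..<t} x * g x))"
proof -
  note [measurable] = borel_measurable_integrable[OF g] Cc_measurable[OF C1cD(3)[OF k]]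
  have k': "integrable lborel k'" by (rule Cc_integrable[OF C1cD(3)[OF k]])
  have k_eq: "k x = - (LINT t|lborel. indicator {x<..} t * k' t)" for x
  proof -
    \<comment> \<open>The bound \<bar>x\<bar> + 1 exceeds x and is at least 1, so both k and k'
      vanish from there on.\<close>
    have k'0: "k' y = 0" if "\<not> y \<le> \<bar>x\<bar> + 1" for y
      using that by (intro Cc_zero_outside[OF C1cD(3)[OF k]]) auto
    have "((\<lambda>t. k' t) has_integral (k (\<bar>x\<bar>+1) - k x)) {x..\<bar>x\<bar>+1}"
      by (intro fundamental_theorem_of_calculus)
        (auto intro: has_vector_derivative_at_within C1cD(1)[OF k])
    moreover have "k (\<bar>x\<bar>+1) = 0" using Cc_zero_outside[OF C1cD(2)[OF k]] by auto
    ultimately have "((\<lambda>t. if t \<in> {x..\<bar>x\<bar>+1} then k' t else 0) has_integral - k x) UNIV"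
      by (subst has_integral_restrict_UNIV) simp
    then have "((\<lambda>t. indicator {x<..} t * k' t) has_integral - k x) UNIV"
      by (rule has_integral_spike[of "{x}", rotated 2])
        (use k'0 in \<open>auto simp: indicator_def\<close>)
    moreover have "integrable lborel (\<lambda>t. indicator {x<..} t * k' t)"
      by (rule Bochner_Integration.integrable_bound[OF k']) (auto simp: indicator_def)
    then have "((\<lambda>t. indicator {x<..} t * k' t) has_integral (LINT t|lborel. indicator {x<..} t * k' t)) UNIV"
      by (rule has_integral_integral_lborel)
    ultimately have "- k x = (LINT t|lborel. indicator {x<..} t * k' t)" by (rule has_integral_unique)
    then show ?thesis by (metis minus_minus)
  qed
  have prod: "integrable (lborel \<Otimes>\<^sub>M lborel) (\<lambda>(x, t). g x * (indicator {x<..} t * k' t))"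
  proof (rule Bochner_Integration.integrable_bound)
    show "integrable (lborel \<Otimes>\<^sub>M lborel) (\<lambda>(x, t). g x * k' t)"
    proof (rule lborel_pair.Fubini_integrable)
      show "integrable lborel (\<lambda>x. LINT t|lborel. norm (case (x, t) of (x, t) \<Rightarrow> g x * k' t))"
        using g by (simp add: norm_mult)
    qed (use k' in auto)
    have [measurable]: "Measurable.pred (borel \<Otimes>\<^sub>M borel) (\<lambda>p :: real \<times> real. snd p \<in> {fst p<..})"
      by simp
    show "(\<lambda>(x, t). g x * (indicator {x<..} t * k' t)) \<in> borel_measurable (lborel \<Otimes>\<^sub>M lborel)"
      unfolding indicator_def by measurable
  qed (auto simp: indicator_def)
  have "(LINT x|lborel. k x * g x) = - (LINT x|lborel. LINT t|lborel. g x * (indicator {x<..} t * k' t))"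
    by (subst k_eq) (simp add: mult.commute)
  also have "(LINT x|lborel. LINT t|lborel. g x * (indicator {x<..} t * k' t))
      = (LINT t|lborel. LINT x|lborel. g x * (indicator {x<..} t * k' t))"
    by (rule lborel_pair.Fubini_integral[OF prod, symmetric])
  also have "\<dots> = (LINT t|lborel. k' t * (LINT x|lborel. indicator {..<t} x * g x))"
  proof (intro Bochner_Integration.integral_cong refl)
    fix t
    have "(LINT x|lborel. g x * (indicator {x<..} t * k' t)) = (LINT x|lborel. k' t * (indicator {..<t} x * g x))"
      by (intro Bochner_Integration.integral_cong refl) (auto simp: indicator_def)
    then show "(LINT x|lborel. g x * (indicator {x<..} t * k' t)) = k' t * (LINT x|lborel. indicator {..<t} x * g x)"
      by simp
  qed
  finally show ?thesis .
qed

section \<open>Absolutely continuous functions\<close>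

text \<open>In the Riemann sums, the tags outside the exceptional null set \<open>N\<close> are handled as in the
  classical fundamental theorem. The gauge keeps the intervals tagged in \<open>N\<close> inside an open set of
  small measure, so that their contribution to \<open>f b - f a\<close> is small by absolute continuity.\<close>

lemma abs_continuous_on_has_integral:
  fixes f f' :: "real \<Rightarrow> 'b::banach"
  assumes ac: "abs_continuous_on S f" and sub: "{a..b} \<subseteq> S" and ab: "a \<le> b"
    and N: "negligible N"
    and deriv: "\<And>x. x \<in> {a..b} - N \<Longrightarrow> (f has_vector_derivative f' x) (at x within {a..b})"
  shows "(f' has_integral (f b - f a)) {a..b}"
proof -
  define h where "h x = (if x \<in> N then 0 else f' x)" for x
  have "(h has_integral (f b - f a)) {a..b}"
    unfolding has_integral_real
  proof (intro allI impI)
    fix e :: real assume e: "e > 0"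
    \<comment> \<open>Half of e goes to the tags outside \<open>N\<close>, whose error is at most e1
      (b - a), and half to the tags in \<open>N\<close>. The + 1 covers the case a = b.\<close>
    define e1 where "e1 = e / (2 * (b - a + 1))"
    have e1: "e1 > 0" "e1 * (b - a) < e / 2"
      using e ab by (auto simp: e1_def field_simps)
    obtain \<delta> where \<delta>: "\<delta> > 0" and small: "\<And>P. finite P \<Longrightarrow> (\<forall>(a, b) \<in> P. a < b \<and> {a..b} \<subseteq> S) \<Longrightarrow>
        pairwise (\<lambda>(a, b) (a', b'). {a<..<b} \<inter> {a'<..<b'} = {}) P \<Longrightarrow>
        (\<Sum>(a, b) \<in> P. b - a) < \<delta> \<Longrightarrow> (\<Sum>(a, b) \<in> P. norm (f b - f a)) < e / 2"
      using ac[unfolded abs_continuous_on_def, rule_format, of "e / 2"] e by auto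
    obtain T where T: "open T" "N \<subseteq> T" "T - N \<in> lmeasurable" "emeasure lebesgue (T - N) < ennreal \<delta>"
      using sets_lebesgue_outer_open[OF negligible_imp_sets[OF N] \<delta>] by blast
    have TN: "T = (T - N) \<union> N" using T(2) by auto
    have Tm: "T \<in> lmeasurable"
      using T(3) negligible_imp_measurable[OF N] by (subst TN) (rule fmeasurable.Un)
    have "measure lebesgue T = measure lebesgue (T - N)"
      using N Tm by (intro measure_Diff_null_set[symmetric]) (auto simp: negligible_iff_null_sets)
    also have "\<dots> < \<delta>"
      using T(3,4) \<delta> by (simp add: emeasure_eq_measure2 ennreal_less_iff)
    finally have T\<delta>: "measure lebesgue T < \<delta>" .
    have "\<exists>d>0. \<forall>y\<in>{a..b}. norm (y - x) < d \<longrightarrow> norm (f y - f x - (y - x) *\<^sub>R f' x) \<le> e1 * norm (y - x)"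
      if "x \<in> {a..b} - N" for x
      using deriv[OF that] e1(1) unfolding has_vector_derivative_def has_derivative_within_alt by blast
    then obtain d where d: "\<And>x. x \<in> {a..b} - N \<Longrightarrow> d x > 0"
      "\<And>x y. x \<in> {a..b} - N \<Longrightarrow> y \<in> {a..b} \<Longrightarrow> norm (y - x) < d x \<Longrightarrow>
         norm (f y - f x - (y - x) *\<^sub>R f' x) \<le> e1 * norm (y - x)"
      by metis
    define \<gamma> where "\<gamma> x = (if x \<in> N then T else if x \<in> {a..b} then ball x (d x) else ball x 1)" for x
    have "gauge \<gamma>"
      unfolding gauge_def \<gamma>_def using T d(1) by auto
    moreover have "norm ((\<Sum>(x, K)\<in>p. measure lborel K *\<^sub>R h x) - (f b - f a)) < e"
      if p: "p tagged_division_of {a..b}" "\<gamma> fine p" for p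
    proof -
      have fin: "finite p" by (rule tagged_division_of_finite[OF p(1)])
      have K: "\<exists>u v. u \<le> v \<and> K = {u..v} \<and> x \<in> {u..v} \<and> {u..v} \<subseteq> {a..b} \<and> {u..v} \<subseteq> \<gamma> x"
        if "(x, K) \<in> p" for x K
      proof -
        obtain u v where "K = cbox u v" using tagged_division_ofD(4)[OF p(1) \<open>(x, K) \<in> p\<close>] by blast
        moreover have "x \<in> K" "K \<subseteq> {a..b}" using tagged_division_ofD(2,3)[OF p(1)] that by auto
        moreover have "K \<subseteq> \<gamma> x" using p(2) that by (auto simp: fine_def)
        ultimately show ?thesis by (intro exI[of _ u] exI[of _ v]) auto
      qed
      define D where "D = (\<lambda>(x :: real, K). measure lborel K *\<^sub>R h x - (f (Sup K) - f (Inf K)))"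
      define p1 where "p1 = {(x, K) \<in> p. x \<notin> N}"
      define p2 where "p2 = {(x, K) \<in> p. x \<in> N}"
      have p12: "p = p1 \<union> p2" "p1 \<inter> p2 = {}" "finite p1" "finite p2"
        using fin by (auto simp: p1_def p2_def intro: finite_subset[OF _ fin])
      have "(\<Sum>(x, K)\<in>p. measure lborel K *\<^sub>R h x) - (f b - f a) = sum D p"
        unfolding additive_tagged_division_1[OF ab p(1), of f, symmetric] D_def
        by (simp add: sum_subtractf split_def)
      also have "\<dots> = sum D p1 + sum D p2"
        using p12 by (simp add: sum.union_disjoint)
      finally have split: "(\<Sum>(x, K)\<in>p. measure lborel K *\<^sub>R h x) - (f b - f a) = sum D p1 + sum D p2" .
      have "norm (sum D p1) \<le> (\<Sum>(x, K)\<in>p1. e1 * measure lborel K)"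
      proof (rule sum_norm_le, clarify)
        fix x K assume xK: "(x, K) \<in> p1"
        then have "(x, K) \<in> p" by (simp add: p1_def)
        from K[OF this] obtain u v
          where uv: "u \<le> v" "K = {u..v}" "x \<in> {u..v}" "{u..v} \<subseteq> {a..b}" "{u..v} \<subseteq> \<gamma> x" by blast
        have x: "x \<in> {a..b} - N" using xK uv by (auto simp: p1_def)
        then have "{u..v} \<subseteq> ball x (d x)" using uv(5) by (auto simp: \<gamma>_def)
        then have "u \<in> ball x (d x)" "v \<in> ball x (d x)" using uv(1) by auto
        then have *: "norm (f v - f x - (v - x) *\<^sub>R f' x) \<le> e1 * (v - x)"
            "norm (f u - f x - (u - x) *\<^sub>R f' x) \<le> e1 * (x - u)"
          using d(2)[OF x, of v] d(2)[OF x, of u] uv by (auto simp: dist_real_def abs_of_nonneg abs_of_nonpos)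
        \<comment> \<open>Straddle estimate: the tag lies between u and v, so the errors at the two
          ends add up to e1 (v - u).\<close>
        have "D (x, K) = (f u - f x - (u - x) *\<^sub>R f' x) - (f v - f x - (v - x) *\<^sub>R f' x)"
          using uv(1) x by (simp add: D_def uv(2) h_def algebra_simps)
        also have "norm \<dots> \<le> e1 * (x - u) + e1 * (v - x)"
          using * norm_triangle_ineq4 by (smt (verit))
        also have "\<dots> = e1 * measure lborel K" using uv(1) by (simp add: uv(2) algebra_simps)
        finally show "norm (D (x, K)) \<le> e1 * measure lborel K" .
      qed
      also have "\<dots> \<le> (\<Sum>(x, K)\<in>p. e1 * measure lborel K)"
        using e1 fin by (intro sum_mono2) (auto simp: p1_def)
      also have "\<dots> = e1 * (b - a)"
        using additive_content_tagged_division[of p a b] p(1) ab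
        by (simp add: split_def flip: sum_distrib_left)
      finally have n1: "norm (sum D p1) < e / 2" using e1(2) by linarith
      \<comment> \<open>Absolute continuity speaks of intervals with a < b only, so degenerate
        pieces are dropped; their contribution is zero.\<close>
      define q where "q = {(x, K) \<in> p2. Inf K < Sup K}"
      define ends where "ends = (\<lambda>(x :: real, K :: real set). (Inf K, Sup K))"
      have q: "finite q" "q \<subseteq> p2" "q \<subseteq> p" using p12 by (auto simp: q_def intro: finite_subset[OF _ p12(4)])
      have int: "{Inf K<..<Sup K} = interior K" if "(x, K) \<in> p" for x K
        using K[OF that] by auto
      have disj: "{Inf K<..<Sup K} \<inter> {Inf K'<..<Sup K'} = {}"
        if "(x, K) \<in> q" "(x', K') \<in> q" "(x, K) \<noteq> (x', K')" for x x' K K'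
      proof -
        have "(x, K) \<in> p" "(x', K') \<in> p" using that q by auto
        then show ?thesis using tagged_division_ofD(5)[OF p(1) _ _ that(3)] int by simp
      qed
      \<comment> \<open>Nondegenerate pieces with disjoint interiors have different end points, so
        no term is lost when the sum is taken over the set of end point pairs.\<close>
      have inj: "inj_on ends q"
      proof (rule inj_onI, clarify)
        fix x K x' K' assume xK: "(x, K) \<in> q" "(x', K') \<in> q" "ends (x, K) = ends (x', K')"
        then have "{Inf K<..<Sup K} \<noteq> {}" "{Inf K<..<Sup K} = {Inf K'<..<Sup K'}"
          by (auto simp: q_def ends_def)
        then show "x = x' \<and> K = K'" using disj[OF xK(1,2)] by blast
      qed
      have "(\<Sum>(a, b)\<in>ends ` q. norm (f b - f a)) < e / 2"
      proof (rule small)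
        show "finite (ends ` q)" using q by simp
        show "\<forall>(a, b)\<in>ends ` q. a < b \<and> {a..b} \<subseteq> S"
        proof clarify
          fix u v x K assume "(u, v) = ends (x, K)" "(x, K) \<in> q"
          moreover from this have "(x, K) \<in> p" using q by auto
          from K[OF this] obtain u' v' where "u' \<le> v'" "K = {u'..v'}" "{u'..v'} \<subseteq> {a..b}" by blast
          ultimately show "u < v \<and> {u..v} \<subseteq> S" using sub by (auto simp: ends_def q_def)
        qed
        show disj': "pairwise (\<lambda>(a, b) (a', b'). {a<..<b} \<inter> {a'<..<b'} = {}) (ends ` q)"
          unfolding pairwise_def using disj by (fastforce simp: ends_def)
        have "(\<Sum>(a, b)\<in>ends ` q. b - a) = (\<Sum>z\<in>ends ` q. measure lebesgue {fst z<..<snd z})"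
          by (intro sum.cong refl) (auto simp: ends_def q_def)
        also have "\<dots> = measure lebesgue (\<Union>z\<in>ends ` q. {fst z<..<snd z})"
        proof (rule measure_negligible_finite_Union_image[symmetric])
          show "pairwise (\<lambda>x y. negligible ({fst x<..<snd x} \<inter> {fst y<..<snd y})) (ends ` q)"
            using disj' by (auto simp: pairwise_def split_def)
        qed (use q in auto)
        also have "\<dots> \<le> measure lebesgue T"
        proof (rule measure_mono_fmeasurable[OF _ _ Tm])
          show "(\<Union>z\<in>ends ` q. {fst z<..<snd z}) \<subseteq> T"
          proof
            fix y assume "y \<in> (\<Union>z\<in>ends ` q. {fst z<..<snd z})"
            then obtain z where z: "z \<in> q" "y \<in> {fst (ends z)<..<snd (ends z)}" by blast
            obtain x K where "z = (x, K)" by fastforce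
            with z have xK: "(x, K) \<in> q" and y: "y \<in> {fst (ends (x, K))<..<snd (ends (x, K))}" by auto
            have x: "x \<in> N" "(x, K) \<in> p" using xK q by (auto simp: q_def p2_def)
            have "y \<in> interior K" using y int[OF x(2)] by (simp add: ends_def)
            moreover have "K \<subseteq> \<gamma> x" using K[OF x(2)] by blast
            ultimately have "y \<in> \<gamma> x" by (meson interior_subset subsetD)
            then show "y \<in> T" using x(1) by (simp add: \<gamma>_def)
          qed
        qed (use q in auto)
        finally show "(\<Sum>(a, b)\<in>ends ` q. b - a) < \<delta>" using T\<delta> by linarith
      qed
      moreover have "(\<Sum>(a, b)\<in>ends ` q. norm (f b - f a)) = (\<Sum>z\<in>q. norm (D z))"
      proof -
        have "(\<Sum>(a, b)\<in>ends ` q. norm (f b - f a)) = (\<Sum>z\<in>q. norm (f (snd (ends z)) - f (fst (ends z))))"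
          by (simp add: sum.reindex[OF inj] split_def)
        also have "\<dots> = (\<Sum>z\<in>q. norm (D z))"
          by (intro sum.cong refl)
            (auto simp: ends_def D_def q_def p2_def h_def norm_minus_commute)
        finally show ?thesis .
      qed
      moreover have "sum D p2 = sum D q"
      proof (rule sum.mono_neutral_right[OF p12(4) q(2)], clarify)
        fix x K assume xK: "(x, K) \<in> p2" "(x, K) \<notin> q"
        then have "(x, K) \<in> p" by (simp add: p2_def)
        from K[OF this] obtain u v where "u \<le> v" "K = {u..v}" by blast
        with xK show "D (x, K) = 0" by (auto simp: q_def D_def p2_def h_def)
      qed
      ultimately have n2: "norm (sum D p2) < e / 2"
        using norm_sum[of D q] by simp
      show ?thesis unfolding split
        using n1 n2 norm_triangle_ineq[of "sum D p1" "sum D p2"] by linarith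
    qed
    ultimately show "\<exists>\<gamma>. gauge \<gamma> \<and> (\<forall>p. p tagged_division_of {a..b} \<and> \<gamma> fine p \<longrightarrow>
        norm ((\<Sum>(x, K)\<in>p. measure lborel K *\<^sub>R h x) - (f b - f a)) < e)" by (intro exI[of _ \<gamma>]) simp
  qed
  then show ?thesis
    by (rule has_integral_spike[OF N, rotated]) (auto simp: h_def)
qed

text \<open>A bounded derivative makes \<open>k\<close> Lipschitz. This places the smooth test
  functions inside the domain of T.\<close>

lemma C1c_abs_continuous_on:
  assumes "C1c k k'"
  shows "abs_continuous_on S k"
proof -
  obtain B where B: "B > 0" "\<And>x. cmod (k' x) \<le> B" using Cc_bounded[OF C1cD(3)[OF assms]] by metis
  have lip: "cmod (k b - k a) \<le> B * (b - a)" if "a \<le> b" for a b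
  proof -
    have "(k' has_integral (k b - k a)) {a..b}"
      using that by (intro fundamental_theorem_of_calculus)
        (auto intro: has_vector_derivative_at_within C1cD(1)[OF assms])
    from has_integral_bound_real[OF _ finite.emptyI this, of B] B that show ?thesis by simp
  qed
  show ?thesis
    unfolding abs_continuous_on_def
  proof (intro allI impI)
    fix e :: real assume e: "e > 0"
    show "\<exists>d>0. \<forall>P. finite P \<and> (\<forall>(a, b) \<in> P. a < b \<and> {a..b} \<subseteq> S) \<and>
        pairwise (\<lambda>(a, b) (a', b'). {a<..<b} \<inter> {a'<..<b'} = {}) P \<and>
        (\<Sum>(a, b) \<in> P. b - a) < d \<longrightarrow> (\<Sum>(a, b) \<in> P. norm (k b - k a)) < e"
    proof (intro exI[of _ "e / B"] conjI allI impI)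
      fix P assume P: "finite P \<and> (\<forall>(a, b) \<in> P. a < b \<and> {a..b} \<subseteq> S) \<and>
        pairwise (\<lambda>(a, b) (a', b'). {a<..<b} \<inter> {a'<..<b'} = {}) P \<and> (\<Sum>(a, b) \<in> P. b - a) < e / B"
      have "(\<Sum>(a, b) \<in> P. norm (k b - k a)) \<le> (\<Sum>(a, b) \<in> P. B * (b - a))"
        by (intro sum_mono) (use P lip in auto)
      also have "\<dots> = B * (\<Sum>(a, b) \<in> P. b - a)" by (simp add: sum_distrib_left split_def)
      also have "\<dots> < e" using P B(1) by (simp add: field_simps)
      finally show "(\<Sum>(a, b) \<in> P. norm (k b - k a)) < e" .
    qed (use e B in auto)
  qed
qed

section \<open>Smooth bump functions\<close>

text \<open>At the kink the difference quotient is dominated by the next lower power. Truncated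
  powers give just the smoothness required: the cube yields \<open>C\<^sup>2\<close> bumps, the
  square \<open>C\<^sup>1\<close> cutoffs.\<close>

lemma has_real_derivative_pos_part_power:
  "((\<lambda>t::real. max 0 t ^ Suc (Suc n)) has_real_derivative real (Suc (Suc n)) * max 0 t ^ Suc n) (at t)"
proof -
  consider "t < 0" | "t > 0" | "t = 0" by linarith
  then show ?thesis
  proof cases
    case 1
    have "((\<lambda>t. 0) has_real_derivative 0) (at t)" by simp
    then have "((\<lambda>t::real. max 0 t ^ Suc (Suc n)) has_real_derivative 0) (at t)"
      by (rule has_field_derivative_transform_within_open[of _ _ _ "{..<0}"]) (use 1 in auto)
    then show ?thesis using 1 by simp
  next
    case 2
    have "((\<lambda>t. t ^ Suc (Suc n)) has_real_derivative real (Suc (Suc n)) * t ^ Suc n) (at t)"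
      by (rule derivative_eq_intros refl)+ simp
    then have "((\<lambda>t::real. max 0 t ^ Suc (Suc n)) has_real_derivative real (Suc (Suc n)) * t ^ Suc n) (at t)"
      by (rule has_field_derivative_transform_within_open[of _ _ _ "{0<..}"]) (use 2 in auto)
    then show ?thesis using 2 by simp
  next
    case 3
    have "((\<lambda>h::real. max 0 h ^ Suc n) \<longlongrightarrow> 0 ^ Suc n) (at 0)"
      by (intro tendsto_power) (auto intro!: tendsto_eq_intros)
    then have lim: "((\<lambda>h::real. max 0 h ^ Suc n) \<longlongrightarrow> 0) (at 0)" by simp
    have "((\<lambda>h::real. max 0 h ^ Suc (Suc n) / h) \<longlongrightarrow> 0) (at 0)"
      by (rule tendsto_0_le[OF lim, of _ 1]) (auto simp: eventually_at_filter max_def abs_mult)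
    then show ?thesis using 3 by (simp add: has_field_derivative_iff)
  qed
qed

lemma C1c_add:
  assumes "C1c k k'" "C1c l l'"
  shows "C1c (\<lambda>x. k x + l x) (\<lambda>x. k' x + l' x)"
  unfolding C1c_def
  by (auto intro!: has_vector_derivative_add Cc_add C1cD[OF assms(1)] C1cD[OF assms(2)])

lemma C1c_scale:
  assumes "C1c k k'"
  shows "C1c (\<lambda>x. c * k x) (\<lambda>x. c * k' x)"
  unfolding C1c_def
  by (auto intro!: has_vector_derivative_mult_right Cc_scale C1cD[OF assms])

lemma C2c_add:
  assumes "C2c k k' k''" "C2c l l' l''"
  shows "C2c (\<lambda>x. k x + l x) (\<lambda>x. k' x + l' x) (\<lambda>x. k'' x + l'' x)"
  using assms by (auto simp: C2c_def intro!: C1c_add)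

lemma C2c_scale:
  assumes "C2c k k' k''"
  shows "C2c (\<lambda>x. c * k x) (\<lambda>x. c * k' x) (\<lambda>x. c * k'' x)"
  using assms by (auto simp: C2c_def intro!: C1c_scale)

lemma C2c_zero: "C2c (\<lambda>_. 0) (\<lambda>_. 0) (\<lambda>_. 0)"
  by (auto simp: C2c_def C1c_def Cc_def intro!: exI[of _ 0])

lemma C2c_mult:
  assumes k: "C2c k k' k''" and h: "\<And>x. x \<in> {-1<..<1} \<Longrightarrow> (h has_vector_derivative h' x) (at x)"
    and h': "\<And>x. x \<in> {-1<..<1} \<Longrightarrow> (h' has_vector_derivative h'' x) (at x)"
    and h'': "continuous_on {-1<..<1} h''"
  shows "\<exists>l' l''. C2c (\<lambda>x. k x * h x) l' l''"
proof -
  have "continuous_on {-1<..<1} h'"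
    using h' by (intro continuous_at_imp_continuous_on ballI has_vector_derivative_continuous) auto
  from C1c_mult[OF C2cD(1)[OF k] h this] C1c_add[OF C1c_mult[OF C2cD(2)[OF k] h this]
      C1c_mult[OF C2cD(1)[OF k] h' h'']]
  show ?thesis unfolding C2c_def by blast
qed

text \<open>The bump is the cube of the positive part of (x - a)(b - x), the smallest integer power
  with two continuous derivatives. The real derivatives are recorded separately because
  \<open>C2c_saturated_bump\<close> composes \<open>s\<close> with a rational function.\<close>

lemma C2c_bump:
  assumes "-1 < a" "a < b" "b < 1"
  obtains s s' s'' :: "real \<Rightarrow> real"
  where "C2c (\<lambda>x. of_real (s x)) (\<lambda>x. of_real (s' x)) (\<lambda>x. of_real (s'' x))"
    "\<And>x. (s has_real_derivative s' x) (at x)" "\<And>x. (s' has_real_derivative s'' x) (at x)"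
    "continuous_on UNIV s''"
    "\<And>x. 0 \<le> s x" "\<And>x. 0 < s x \<longleftrightarrow> x \<in> {a<..<b}"
proof -
  define g where "g x = (x - a) * (b - x)" for x
  define g' where "g' x = a + b - 2 * x" for x
  define s where "s x = max 0 (g x) ^ 3" for x
  define s' where "s' x = 3 * max 0 (g x) ^ 2 * g' x" for x
  define s'' where "s'' x = 3 * max 0 (g x) ^ 2 * (-2) + 3 * (2 * max 0 (g x) * g' x) * g' x" for x
  have g: "(g has_real_derivative g' x) (at x)" "(g' has_real_derivative -2) (at x)" for x
    unfolding g_def g'_def by (auto intro!: derivative_eq_intros simp: algebra_simps)
  have pow: "((\<lambda>t::real. max 0 t ^ 3) has_real_derivative 3 * max 0 t ^ 2) (at t)"
     "((\<lambda>t::real. max 0 t ^ 2) has_real_derivative 2 * max 0 t) (at t)" for t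
    using has_real_derivative_pos_part_power[of 1 t] has_real_derivative_pos_part_power[of 0 t]
    by (simp_all add: numeral_eq_Suc)
  have s: "(s has_real_derivative s' x) (at x)" for x
    unfolding s_def s'_def by (rule DERIV_chain2[OF pow(1) g(1)])
  have "((\<lambda>x. max 0 (g x) ^ 2) has_real_derivative 2 * max 0 (g x) * g' x) (at x)" for x
    by (rule DERIV_chain2[OF pow(2) g(1)])
  then have s': "(s' has_real_derivative s'' x) (at x)" for x
    unfolding s'_def s''_def by (intro DERIV_mult' DERIV_cmult g)
  have g_pos: "0 < g x \<longleftrightarrow> x \<in> {a<..<b}" for x
    using assms by (auto simp: g_def zero_less_mult_iff)
  have cont: "continuous_on UNIV s''"
    unfolding s''_def g_def g'_def by (intro continuous_intros)
  have "max 0 (g x) = 0" if "max \<bar>a\<bar> \<bar>b\<bar> < \<bar>x\<bar>" for x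
  proof -
    have "\<not> (a < x \<and> x < b)" using that by linarith
    then have "\<not> 0 < g x" by (simp add: g_pos)
    then show ?thesis by simp
  qed
  moreover have "max \<bar>a\<bar> \<bar>b\<bar> < 1" using assms by linarith
  ultimately have *: "\<exists>r<1. \<forall>x. r < \<bar>x\<bar> \<longrightarrow> s x = 0 \<and> s' x = 0 \<and> s'' x = 0"
    unfolding s_def s'_def s''_def by (intro exI[of _ "max \<bar>a\<bar> \<bar>b\<bar>"]) simp
  have "continuous_on UNIV s" "continuous_on UNIV s'"
    using s s' by (auto intro!: DERIV_continuous_on intro: DERIV_subset)
  with * have "C2c (\<lambda>x. of_real (s x)) (\<lambda>x. of_real (s' x)) (\<lambda>x. of_real (s'' x))"
    unfolding C2c_def C1c_def Cc_def using s s' cont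
    by (auto intro!: has_vector_derivative_of_real continuous_intros)
  moreover have "0 < s x \<longleftrightarrow> x \<in> {a<..<b}" for x
    unfolding g_pos[symmetric] s_def by (simp add: max_def)
  moreover have "0 \<le> s x" for x by (simp add: s_def)
  ultimately show thesis using s s' cont by (intro that) auto
qed

lemma C2c_nonneg_bump:
  assumes "-1 < a" "a < b" "b < 1"
  shows "\<exists>s s' s'' :: real \<Rightarrow> real.
    C2c (\<lambda>x. of_real (s x)) (\<lambda>x. of_real (s' x)) (\<lambda>x. of_real (s'' x)) \<and>
    (\<forall>x. 0 \<le> s x) \<and> (\<forall>x. 0 < s x \<longleftrightarrow> x \<in> {a<..<b})"
  by (rule C2c_bump[OF assms]) blast

text \<open>As c grows, c s / (1 + c s) stays in [0, 1) and tends to the indicator of the set where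
  s > 0, which is how indicators of intervals are approximated. Writing it as \<open>s * r\<close>
  with \<open>r = c / (1 + c s)\<close> lets \<open>s\<close> supply the compact support, while r' =
  - s' \<open>r\<^sup>2\<close> keeps the derivatives short.\<close>

lemma C2c_saturated_bump:
  assumes s: "C2c (\<lambda>x. of_real (s x)) (\<lambda>x. of_real (s' x)) (\<lambda>x. of_real (s'' x))"
    and ds: "\<And>x. (s has_real_derivative s' x) (at x)" "\<And>x. (s' has_real_derivative s'' x) (at x)"
    and cont: "continuous_on UNIV s''" and nonneg: "\<And>x. 0 \<le> s x" and c: "c \<ge> 0"
  shows "\<exists>k' k''. C2c (\<lambda>x. of_real (c * s x / (1 + c * s x))) k' k''"
proof -
  define r where "r x = c / (1 + c * s x)" for x
  define r' where "r' x = - s' x * (r x)\<^sup>2" for x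
  define r'' where "r'' x = - s'' x * (r x)\<^sup>2 - 2 * s' x * r x * r' x" for x
  have pos: "1 + c * s x > 0" for x using c nonneg[of x] by (simp add: add_pos_nonneg)
  have r: "(r has_real_derivative r' x) (at x)" for x
    unfolding r_def r'_def using pos[of x]
    by (auto intro!: derivative_eq_intros ds simp: power2_eq_square field_simps)
  have r': "(r' has_real_derivative r'' x) (at x)" for x
    unfolding r'_def[abs_def] r''_def
    by (auto intro!: derivative_eq_intros ds r simp: power2_eq_square r'_def)
  have cs: "continuous_on UNIV s" "continuous_on UNIV s'"
    using ds by (auto intro!: DERIV_continuous_on intro: DERIV_subset)
  have pos': "1 + c * s x \<noteq> 0" for x using pos[of x] by simp
  have cr: "continuous_on {-1<..<1} r''"
    unfolding r''_def r'_def r_def using cs cont pos'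
    by (auto intro!: continuous_intros intro: continuous_on_subset)
  have "\<exists>k' k''. C2c (\<lambda>x. of_real (s x) * of_real (r x)) k' k''"
    by (rule C2c_mult[OF s, of _ "\<lambda>x. of_real (r' x)" "\<lambda>x. of_real (r'' x)"])
      (auto intro!: has_vector_derivative_of_real r r' cr continuous_intros)
  then show ?thesis by (simp add: r_def mult.commute flip: of_real_mult)
qed

section \<open>Density of the smooth compactly supported functions\<close>

definition C2c_approximable :: "real measure \<Rightarrow> (real \<Rightarrow> complex) \<Rightarrow> bool" where
  "C2c_approximable M f \<longleftrightarrow> f \<in> L2_fun M \<and>
     (\<forall>e>0. \<exists>k k' k''. C2c k k' k'' \<and> (LINT x|M. (cmod (f x - k x))\<^sup>2) < e)"

lemma C2c_approximableE:
  assumes "C2c_approximable M f" "e > 0"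
  obtains k k' k'' where "C2c k k' k''" "(LINT x|M. (cmod (f x - k x))\<^sup>2) < e"
  using assms by (auto simp: C2c_approximable_def)

text \<open>Finiteness makes bounded measurable functions square integrable and allows constant
  majorants in dominated convergence.\<close>

locale finite_interval_measure = finite_measure M for M :: "real measure" +
  assumes space_M: "space M = {-1<..<1}"
    and sets_M: "sets M = sets (restrict_space borel {-1<..<1})"
begin

lemma borel_imp_measurable_M: "f \<in> borel_measurable borel \<Longrightarrow> f \<in> borel_measurable M"
  by (simp add: measurable_cong_sets[OF sets_M refl] measurable_restrict_space1)

lemma L2_fun_bounded:
  assumes "f \<in> borel_measurable M" "\<And>x. x \<in> space M \<Longrightarrow> cmod (f x) \<le> B"
  shows "f \<in> L2_fun M"
proof -
  note [measurable] = assms(1)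
  have "integrable M (\<lambda>x. (cmod (f x))\<^sup>2)"
  proof (rule integrable_const_bound[of _ "B\<^sup>2"])
    show "AE x in M. norm ((cmod (f x))\<^sup>2) \<le> B\<^sup>2"
      using assms(2) by (auto intro!: power_mono)
  qed measurable
  then show ?thesis using assms(1) by (simp add: L2_fun_def)
qed

lemma Cc_L2_fun: "Cc k \<Longrightarrow> k \<in> L2_fun M"
  by (metis Cc_bounded L2_fun_bounded borel_imp_measurable_M Cc_measurable)

lemma C2c_L2_fun: "C2c k k' k'' \<Longrightarrow> k \<in> L2_fun M"
  by (rule Cc_L2_fun[OF C1cD(2)[OF C2cD(1)]])

lemma C2c_approximable_C2c:
  assumes "C2c k k' k''"
  shows "C2c_approximable M k"
  unfolding C2c_approximable_def
proof (intro conjI allI impI C2c_L2_fun[OF assms])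
  fix e :: real assume "e > 0"
  then have "C2c k k' k'' \<and> (LINT x|M. (cmod (k x - k x))\<^sup>2) < e" using assms by simp
  then show "\<exists>l l' l''. C2c l l' l'' \<and> (LINT x|M. (cmod (k x - l x))\<^sup>2) < e" by blast
qed

lemma L2_dist_square_triangle:
  assumes "f \<in> L2_fun M" "g \<in> L2_fun M" "h \<in> L2_fun M"
  shows "(LINT x|M. (cmod (f x - h x))\<^sup>2)
    \<le> 2 * (LINT x|M. (cmod (f x - g x))\<^sup>2) + 2 * (LINT x|M. (cmod (g x - h x))\<^sup>2)"
proof -
  have int: "integrable M (\<lambda>x. (cmod (f x - h x))\<^sup>2)" "integrable M (\<lambda>x. (cmod (f x - g x))\<^sup>2)"
    "integrable M (\<lambda>x. (cmod (g x - h x))\<^sup>2)"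
    using L2_funD(2)[OF L2_fun_diff[OF assms(1,3)]] L2_funD(2)[OF L2_fun_diff[OF assms(1,2)]]
      L2_funD(2)[OF L2_fun_diff[OF assms(2,3)]] by auto
  have "(LINT x|M. (cmod (f x - h x))\<^sup>2) \<le> (LINT x|M. 2 * (cmod (f x - g x))\<^sup>2 + 2 * (cmod (g x - h x))\<^sup>2)"
  proof (rule integral_mono)
    show "(cmod (f x - h x))\<^sup>2 \<le> 2 * (cmod (f x - g x))\<^sup>2 + 2 * (cmod (g x - h x))\<^sup>2" for x
      using cmod_add_square_le[of "f x - g x" "g x - h x"] by simp
  qed (use int in auto)
  then show ?thesis using int by simp
qed

section \<open>Closure of the approximable functions under linear combinations and dominated
  limits\<close>

lemma C2c_approximable_add:
  assumes "C2c_approximable M f" "C2c_approximable M g"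
  shows "C2c_approximable M (\<lambda>x. f x + g x)"
  unfolding C2c_approximable_def
proof (intro conjI allI impI)
  have f: "f \<in> L2_fun M" and g: "g \<in> L2_fun M" using assms by (auto simp: C2c_approximable_def)
  show "(\<lambda>x. f x + g x) \<in> L2_fun M" by (rule L2_fun_add[OF f g])
  fix e :: real assume "e > 0"
  then have e': "e / 4 > 0" by simp
  obtain k k' k'' where k: "C2c k k' k''" "(LINT x|M. (cmod (f x - k x))\<^sup>2) < e / 4"
    by (rule C2c_approximableE[OF assms(1) e'])
  obtain l l' l'' where l: "C2c l l' l''" "(LINT x|M. (cmod (g x - l x))\<^sup>2) < e / 4"
    by (rule C2c_approximableE[OF assms(2) e'])
  have "(LINT x|M. (cmod ((f x + g x) - (k x + l x)))\<^sup>2)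
    \<le> 2 * (LINT x|M. (cmod ((f x + g x) - (k x + g x)))\<^sup>2) + 2 * (LINT x|M. (cmod ((k x + g x) - (k x + l x)))\<^sup>2)"
    by (intro L2_dist_square_triangle L2_fun_add f g C2c_L2_fun[OF k(1)] C2c_L2_fun[OF l(1)])
  also have "\<dots> < e" using k(2) l(2) by simp
  finally show "\<exists>k k' k''. C2c k k' k'' \<and> (LINT x|M. (cmod (f x + g x - k x))\<^sup>2) < e"
    using C2c_add[OF k(1) l(1)] by blast
qed

lemma C2c_approximable_scale:
  assumes "C2c_approximable M f"
  shows "C2c_approximable M (\<lambda>x. c * f x)"
  unfolding C2c_approximable_def
proof (intro conjI allI impI)
  have f: "f \<in> L2_fun M" using assms by (auto simp: C2c_approximable_def)
  show "(\<lambda>x. c * f x) \<in> L2_fun M" by (rule L2_fun_scale[OF f])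
  fix e :: real assume e: "e > 0"
  have c: "(cmod c)\<^sup>2 + 1 > 0" by (simp add: add_nonneg_pos)
  then have e': "e / ((cmod c)\<^sup>2 + 1) > 0" using e by simp
  obtain k k' k'' where k: "C2c k k' k''" "(LINT x|M. (cmod (f x - k x))\<^sup>2) < e / ((cmod c)\<^sup>2 + 1)"
    by (rule C2c_approximableE[OF assms e'])
  have "(LINT x|M. (cmod (c * f x - c * k x))\<^sup>2) = (cmod c)\<^sup>2 * (LINT x|M. (cmod (f x - k x))\<^sup>2)"
    by (simp add: norm_mult power_mult_distrib flip: right_diff_distrib)
  also have "\<dots> \<le> ((cmod c)\<^sup>2 + 1) * (LINT x|M. (cmod (f x - k x))\<^sup>2)"
    by (intro mult_right_mono) auto
  also have "\<dots> < e" using k(2) c by (simp add: field_simps)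
  finally show "\<exists>k k' k''. C2c k k' k'' \<and> (LINT x|M. (cmod (c * f x - k x))\<^sup>2) < e"
    using C2c_scale[OF k(1)] by blast
qed

lemma C2c_approximable_limit:
  assumes approx: "\<And>n. C2c_approximable M (f n)" and g: "g \<in> L2_fun M"
    and lim: "AE x in M. (\<lambda>n. f n x) \<longlonglongrightarrow> g x"
    and bound: "integrable M h" "\<And>n. AE x in M. (cmod (f n x - g x))\<^sup>2 \<le> h x"
  shows "C2c_approximable M g"
  unfolding C2c_approximable_def
proof (intro conjI allI impI g)
  fix e :: real assume e: "e > 0"
  have f: "f n \<in> L2_fun M" for n using approx by (auto simp: C2c_approximable_def)
  note [measurable] = L2_funD(1)[OF f] L2_funD(1)[OF g]
  have "(\<lambda>n. LINT x|M. (cmod (f n x - g x))\<^sup>2) \<longlonglongrightarrow> (LINT x|M. 0)"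
  proof (rule integral_dominated_convergence[OF _ _ bound(1)])
    show "AE x in M. (\<lambda>n. (cmod (f n x - g x))\<^sup>2) \<longlonglongrightarrow> 0"
      using lim
    proof eventually_elim
      case (elim x)
      then have "(\<lambda>n. (cmod (f n x - g x))\<^sup>2) \<longlonglongrightarrow> (cmod (g x - g x))\<^sup>2"
        by (intro tendsto_intros)
      then show ?case by simp
    qed
  qed (use bound(2) in auto)
  then have "\<forall>\<^sub>F n in sequentially. (LINT x|M. (cmod (f n x - g x))\<^sup>2) < e / 4"
    using e by (intro order_tendstoD(2)) auto
  then obtain n where n: "(LINT x|M. (cmod (f n x - g x))\<^sup>2) < e / 4"
    by (auto simp: eventually_sequentially)
  have e': "e / 4 > 0" using e by simp
  obtain k k' k'' where k: "C2c k k' k''" "(LINT x|M. (cmod (f n x - k x))\<^sup>2) < e / 4"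
    by (rule C2c_approximableE[OF approx e'])
  have "(LINT x|M. (cmod (g x - k x))\<^sup>2)
    \<le> 2 * (LINT x|M. (cmod (g x - f n x))\<^sup>2) + 2 * (LINT x|M. (cmod (f n x - k x))\<^sup>2)"
    by (rule L2_dist_square_triangle[OF g f C2c_L2_fun[OF k(1)]])
  then have "(LINT x|M. (cmod (g x - k x))\<^sup>2) < e" using k(2) n by (simp add: norm_minus_commute)
  then show "\<exists>k k' k''. C2c k k' k'' \<and> (LINT x|M. (cmod (g x - k x))\<^sup>2) < e" using k(1) by blast
qed

lemma C2c_approximable_cong:
  assumes "C2c_approximable M f" "\<And>x. x \<in> space M \<Longrightarrow> f x = g x"
  shows "C2c_approximable M g"
proof (rule C2c_approximable_limit[of "\<lambda>_. f" g "\<lambda>_. 0"])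
  have "f \<in> L2_fun M" using assms(1) by (auto simp: C2c_approximable_def)
  then show "g \<in> L2_fun M"
    using assms(2) unfolding L2_fun_def
    by (auto simp: cong: measurable_cong Bochner_Integration.integrable_cong)
  have "\<forall>x\<in>space M. (\<lambda>n. f x) \<longlonglongrightarrow> g x" using assms(2) by simp
  then show "AE x in M. (\<lambda>n. f x) \<longlonglongrightarrow> g x" by simp
qed (use assms in auto)

lemma L2_fun_indicator: "A \<in> sets borel \<Longrightarrow> indicator A \<in> L2_fun M"
  by (rule L2_fun_bounded[of _ 1]) (auto intro: borel_imp_measurable_M simp: indicator_def)

lemma C2c_approximable_indicator_limit:
  assumes "\<And>n::nat. C2c_approximable M (f n)" "A \<in> sets borel"
    and "\<And>n x. cmod (f n x) \<le> 1" "\<And>x. x \<in> {-1<..<1} \<Longrightarrow> (\<lambda>n. f n x) \<longlonglongrightarrow> indicator A x"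
  shows "C2c_approximable M (indicator A)"
proof (rule C2c_approximable_limit[OF assms(1) L2_fun_indicator[OF assms(2)]])
  show "AE x in M. (\<lambda>n. f n x) \<longlonglongrightarrow> indicator A x"
    using assms(4) by (intro AE_I2) (simp add: space_M)
  show "integrable M (\<lambda>_. 4)" by simp
  fix n
  have "cmod (f n x - indicator A x) \<le> 2" for x
    using norm_triangle_ineq4[of "f n x" "indicator A x"] assms(3)[of n x]
    by (auto simp: indicator_def split: if_splits)
  then have "(cmod (f n x - indicator A x))\<^sup>2 \<le> 2\<^sup>2" for x by (intro power_mono) auto
  then show "AE x in M. (cmod (f n x - indicator A x))\<^sup>2 \<le> 4" by simp
qed

lemma C2c_approximable_interval_inside:
  assumes "-1 < a" "a < b" "b < 1"
  shows "C2c_approximable M (indicator {a<..<b})"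
proof -
  obtain s s' s'' :: "real \<Rightarrow> real"
    where s: "C2c (\<lambda>x. of_real (s x)) (\<lambda>x. of_real (s' x)) (\<lambda>x. of_real (s'' x))"
    "\<And>x. (s has_real_derivative s' x) (at x)" "\<And>x. (s' has_real_derivative s'' x) (at x)"
    "continuous_on UNIV s''"
    "\<And>x. 0 \<le> s x" and pos: "\<And>x. 0 < s x \<longleftrightarrow> x \<in> {a<..<b}" using C2c_bump[OF assms] by metis
  define f where "f n x = complex_of_real (real n * s x / (1 + real n * s x))" for n x
  show ?thesis
  proof (rule C2c_approximable_indicator_limit)
    show "C2c_approximable M (f n)" for n
      using C2c_saturated_bump[OF s, of "real n"] C2c_approximable_C2c unfolding f_def by fastforce
    show "cmod (f n x) \<le> 1" for n x
      unfolding f_def norm_of_real using s(5)[of x]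
      by (simp add: add_pos_nonneg abs_of_nonneg divide_le_eq)
    fix x :: real
    have "(\<lambda>n. real n * s x / (1 + real n * s x)) \<longlonglongrightarrow> indicator {a<..<b} x"
    proof (cases "x \<in> {a<..<b}")
      case True
      then have "s x > 0" using pos by simp
      then have "(\<lambda>n. real n * s x / (1 + real n * s x)) \<longlonglongrightarrow> 1" by real_asymp
      with True show ?thesis by simp
    next
      case False
      then have "\<not> 0 < s x" using pos by blast
      then have "s x = 0" using s(5)[of x] by simp
      with False show ?thesis by simp
    qed
    then have "(\<lambda>n. f n x) \<longlonglongrightarrow> of_real (indicator {a<..<b} x)"
      unfolding f_def by (rule tendsto_of_real)
    moreover have "complex_of_real (indicator {a<..<b} x) = indicator {a<..<b} x"
      by (simp add: indicator_def)
    ultimately show "(\<lambda>n. f n x) \<longlonglongrightarrow> indicator {a<..<b} x" by simp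
  qed auto
qed

lemma C2c_approximable_interval: "C2c_approximable M (indicator {a<..<b})"
proof (rule C2c_approximable_indicator_limit)
  \<comment> \<open>The bumps need end points strictly inside (-1, 1), so the interval is shrunk to
    fit and recovered in the limit; for small n it may be empty.\<close>
  define a' where "a' n = max a (-1 + 1 / (real n + 2))" for n
  define b' where "b' n = min b (1 - 1 / (real n + 2))" for n
  show "C2c_approximable M (indicator {a' n<..<b' n})" for n
  proof (cases "a' n < b' n")
    case True
    have "0 < 1 / (real n + 2)" by simp
    then have "-1 < a' n" "b' n < 1" unfolding a'_def b'_def by linarith+
    with True show ?thesis by (intro C2c_approximable_interval_inside)
  next
    case False
    then have "{a' n<..<b' n} = {}" by simp
    moreover have "indicator {} = (\<lambda>x :: real. 0 :: complex)" by (auto simp: indicator_def)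
    ultimately show ?thesis using C2c_approximable_C2c[OF C2c_zero] by simp
  qed
  fix x :: real assume x: "x \<in> {-1<..<1}"
  have lim: "(\<lambda>n. -1 + 1 / (real n + 2)) \<longlonglongrightarrow> -1" "(\<lambda>n. 1 - 1 / (real n + 2)) \<longlonglongrightarrow> 1" by real_asymp+
  have "\<forall>\<^sub>F n in sequentially. -1 + 1 / (real n + 2) < x" "\<forall>\<^sub>F n in sequentially. x < 1 - 1 / (real n + 2)"
    using order_tendstoD(2)[OF lim(1), of x] order_tendstoD(1)[OF lim(2), of x] x by auto
  then have "\<forall>\<^sub>F n in sequentially. indicator {a<..<b} x = (indicator {a' n<..<b' n} x :: complex)"
    by eventually_elim (auto simp: a'_def b'_def indicator_def)
  then show "(\<lambda>n. indicator {a' n<..<b' n} x :: complex) \<longlonglongrightarrow> indicator {a<..<b} x"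
    by (intro tendsto_eventually) (auto elim: eventually_mono)
qed (auto simp: indicator_def)

lemma C2c_approximable_sum:
  "finite I \<Longrightarrow> (\<And>i. i \<in> I \<Longrightarrow> C2c_approximable M (f i)) \<Longrightarrow> C2c_approximable M (\<lambda>x. \<Sum>i\<in>I. f i x)"
  by (induction I rule: finite_induct)
    (auto intro!: C2c_approximable_add intro: C2c_approximable_C2c[OF C2c_zero])

text \<open>Dynkin's argument: open intervals are closed under intersection and generate the Borel
  sets, and the sets with approximable indicator are stable under complements and countable disjoint
  unions.\<close>

lemma C2c_approximable_indicator:
  assumes "A \<in> sets borel"
  shows "C2c_approximable M (indicator A)"
proof -
  let ?G = "range (\<lambda>(a, b). {a<..<b::real})"
  have sets: "sets borel = sigma_sets UNIV ?G"
    by (subst borel_eq_box) (simp add: box_real split_def)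
  have "Int_stable ?G"
    by (auto simp: Int_stable_def split_def image_iff) 
  moreover have "?G \<subseteq> Pow UNIV" by simp
  moreover have "A \<in> sigma_sets UNIV ?G" using assms sets by simp
  ultimately show ?thesis
  proof (induction rule: sigma_sets_induct_disjoint)
    case (basic A)
    then show ?case using C2c_approximable_interval by auto
  next
    case empty
    show ?case using C2c_approximable_C2c[OF C2c_zero] by simp
  next
    case (compl A)
    \<comment> \<open>The constant 1 has no compact support in the interval; on the space of M it is
      the indicator of (-1, 1), which is approximable.\<close>
    have "C2c_approximable M (\<lambda>x. indicator {-1<..<1} x + (-1) * indicator A x)"
      by (intro C2c_approximable_add C2c_approximable_scale compl C2c_approximable_interval)
    then show ?case
      by (rule C2c_approximable_cong) (auto simp: space_M indicator_def)
  next
    case (union A)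
    show ?case
    proof (rule C2c_approximable_indicator_limit)
      have "(\<lambda>x. \<Sum>i<n. indicator (A i) x) = (indicator (\<Union>i<n. A i) :: real \<Rightarrow> complex)" for n
        using union(1) by (intro ext indicator_UN_disjoint[symmetric])
          (auto simp: disjoint_family_on_def)
      then show "C2c_approximable M (indicator (\<Union>i<n. A i))" for n
        using C2c_approximable_sum[of "{..<n}" "\<lambda>i. indicator (A i)"] union(3) by simp
      have "A i \<in> sets borel" for i using union(2) unfolding sets by blast
      then show "\<Union> (range A) \<in> sets borel" by (intro sets.countable_UN) auto
      show "cmod (indicator (\<Union>i<n. A i) x) \<le> 1" for n x by (auto simp: indicator_def)
      fix x
      show "(\<lambda>n. indicator (\<Union>i<n. A i) x :: complex) \<longlonglongrightarrow> indicator (\<Union> (range A)) x"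
        by (rule LIMSEQ_indicator_UN)
    qed
  qed
qed

text \<open>Simple functions are combinations of indicators, and every \<open>f\<close> is a limit
  of simple functions dominated by 2 \<bar>f\<bar>.\<close>

theorem C2c_dense:
  assumes f: "f \<in> L2_fun M"
  shows "C2c_approximable M f"
proof -
  obtain F where F: "\<And>i. simple_function M (F i)" "\<And>x. x \<in> space M \<Longrightarrow> (\<lambda>i. F i x) \<longlonglongrightarrow> f x"
    "\<And>i x. x \<in> space M \<Longrightarrow> dist (F i x) 0 \<le> 2 * dist (f x) 0"
    using borel_measurable_implies_sequence_metric[OF L2_funD(1)[OF f], of 0] by blast
  show ?thesis
  proof (rule C2c_approximable_limit[OF _ f])
    fix i
    have fin: "finite (F i ` space M)" using F(1) by (simp add: simple_function_def)
    have "\<exists>A\<in>sets borel. F i -` {y} \<inter> space M = A \<inter> {-1<..<1}" for y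
    proof -
      have "F i -` {y} \<inter> space M \<in> sets (restrict_space borel {-1<..<1})"
        using simple_functionD(2)[OF F(1)] sets_M by auto
      then obtain B where "B \<in> sets borel" "F i -` {y} \<inter> space M = {-1<..<1} \<inter> B"
        unfolding sets_restrict_space by blast
      then show ?thesis by (metis Int_commute)
    qed
    then obtain A where A: "\<And>y. A y \<in> sets borel" "\<And>y. F i -` {y} \<inter> space M = A y \<inter> {-1<..<1}"
      by metis
    have "C2c_approximable M (\<lambda>x. \<Sum>y\<in>F i ` space M. y * indicator (A y) x)"
      using A(1) by (intro C2c_approximable_sum[OF fin] C2c_approximable_scale C2c_approximable_indicator)
    then show "C2c_approximable M (F i)"
    proof (rule C2c_approximable_cong)
      fix x assume x: "x \<in> space M"
      have "indicator (A y) x = (if y = F i x then 1 else 0 :: complex)" for y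
      proof -
        have "x \<in> F i -` {y} \<inter> space M \<longleftrightarrow> x \<in> A y \<inter> {-1<..<1}" by (simp only: A(2))
        then have "F i x = y \<longleftrightarrow> x \<in> A y" using x by (simp add: space_M)
        then show ?thesis by (auto simp: indicator_def)
      qed
      then have "(\<Sum>y\<in>F i ` space M. y * indicator (A y) x) = (\<Sum>y\<in>F i ` space M. if y = F i x then y else 0)"
        by (intro sum.cong refl) simp
      also have "\<dots> = F i x" using fin x by (simp add: sum.delta')
      finally show "(\<Sum>y\<in>F i ` space M. y * indicator (A y) x) = F i x" .
    qed
  next
    show "AE x in M. (\<lambda>n. F n x) \<longlonglongrightarrow> f x" using F(2) by simp
    \<comment> \<open>The simple functions are at most 2 \<bar>f\<bar> in modulus, so their distance
      to f is at most 3 \<bar>f\<bar>; hence the factor 9.\<close>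
    show "integrable M (\<lambda>x. 9 * (cmod (f x))\<^sup>2)" using L2_funD(2)[OF f] by simp
    fix n
    have "(cmod (F n x - f x))\<^sup>2 \<le> 9 * (cmod (f x))\<^sup>2" if "x \<in> space M" for x
    proof -
      have "cmod (F n x - f x) \<le> 3 * cmod (f x)"
        using norm_triangle_ineq4[of "F n x" "f x"] F(3)[OF that, of n] by simp
      then have "(cmod (F n x - f x))\<^sup>2 \<le> (3 * cmod (f x))\<^sup>2" by (intro power_mono) auto
      then show ?thesis by (simp add: power_mult_distrib)
    qed
    then show "AE x in M. (cmod (F n x - f x))\<^sup>2 \<le> 9 * (cmod (f x))\<^sup>2" by simp
  qed
qed

text \<open>The fundamental lemma of the calculus of variations, read as orthogonality to a dense
  set.\<close>

lemma AE_zero_if_orthogonal_C2c: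
  assumes d: "d \<in> L2_fun M"
    and orth: "\<And>k k' k''. C2c k k' k'' \<Longrightarrow> (LINT x|M. k x * cnj (d x)) = 0"
  shows "AE x in M. d x = 0"
proof (rule AE_zero_if_orthogonal_dense[OF d, of "{k. \<exists>k' k''. C2c k k' k''}"])
  show "{k. \<exists>k' k''. C2c k k' k''} \<subseteq> L2_fun M" using C2c_L2_fun by auto
  show "\<exists>f\<in>{k. \<exists>k' k''. C2c k k' k''}. (LINT x|M. (cmod (d x - f x))\<^sup>2) < e" if "e > 0" for e
    using C2c_dense[OF d] that by (auto simp: C2c_approximable_def)
qed (use orth in auto)

end

section \<open>Weak solutions of a Sturm--Liouville equation\<close>

text \<open>The setting for f \<mapsto> (p f')' / w + q f. Completeness is encoded by
  \<open>p_le\<close>: the length element sqrt (w / p) dx is at least dx / (1 - x^2), whose integral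
  diverges at both ends.\<close>

locale sturm_liouville =
  fixes w p p' q :: "real \<Rightarrow> real" and Q :: real
  assumes w_pos: "\<And>x. x \<in> {-1<..<1} \<Longrightarrow> 0 < w x"
    and w_cont: "continuous_on {-1<..<1} w"
    and w_integrable: "set_integrable lborel {-1<..<1} w"
    and p_pos: "\<And>x. x \<in> {-1<..<1} \<Longrightarrow> 0 < p x"
    and p_deriv: "\<And>x. x \<in> {-1<..<1} \<Longrightarrow> (p has_real_derivative p' x) (at x)"
    and p'_cont: "continuous_on {-1<..<1} p'"
    and p_le: "\<And>x. x \<in> {-1<..<1} \<Longrightarrow> p x \<le> (1 - x\<^sup>2)\<^sup>2 * w x"
    and q_cont: "continuous_on {-1<..<1} q"
    and q_bound: "\<And>x. x \<in> {-1<..<1} \<Longrightarrow> \<bar>q x\<bar> \<le> Q"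
begin

definition M :: "real measure" where
  "M = density (restrict_space lborel {-1<..<1}) (\<lambda>x. ennreal (w x))"

text \<open>This is (p f')' / w + q f with the derivative of the product expanded, so that
  \<open>f'\<close> and \<open>f''\<close> are data and \<open>f''\<close> may be given only almost
  everywhere.\<close>

definition L :: "(real \<Rightarrow> complex) \<Rightarrow> (real \<Rightarrow> complex) \<Rightarrow> (real \<Rightarrow> complex) \<Rightarrow> real \<Rightarrow> complex" where
  "L f f' f'' x = f'' x * of_real (p x / w x) + f' x * of_real (p' x / w x) + f x * of_real (q x)"

section \<open>Integration against the weight, and multiplication by the coefficients\<close>

lemma space_M': "space M = {-1<..<1}"
  by (simp add: M_def space_restrict_space)

lemma sets_M': "sets M = sets (restrict_space borel {-1<..<1})"
  by (simp add: M_def cong: sets_restrict_space_cong)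

lemma w_measurable: "w \<in> borel_measurable (restrict_space lborel {-1<..<1})"
  using borel_measurable_continuous_on_restrict[OF w_cont]
  by (simp cong: measurable_cong_sets sets_restrict_space_cong)

lemma integrable_M:
  fixes f :: "real \<Rightarrow> 'b::{banach, second_countable_topology}"
  assumes "f \<in> borel_measurable M"
  shows "integrable M f \<longleftrightarrow> integrable lborel (\<lambda>x. indicator {-1<..<1} x *\<^sub>R (w x *\<^sub>R f x))"
proof -
  have f: "f \<in> borel_measurable (restrict_space lborel {-1<..<1})"
    using assms by (simp add: M_def)
  have "integrable M f \<longleftrightarrow> integrable (restrict_space lborel {-1<..<1}) (\<lambda>x. w x *\<^sub>R f x)"
    unfolding M_def
    by (rule integrable_density[OF f w_measurable])
      (auto intro!: AE_I2 less_imp_le[OF w_pos] simp: space_restrict_space)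
  also have "\<dots> \<longleftrightarrow> integrable lborel (\<lambda>x. indicator {-1<..<1} x *\<^sub>R (w x *\<^sub>R f x))"
    by (rule integrable_restrict_space) simp
  finally show ?thesis .
qed

lemma integral_M:
  fixes f :: "real \<Rightarrow> 'b::{banach, second_countable_topology}"
  assumes "f \<in> borel_measurable M"
  shows "(LINT x|M. f x) = (LINT x|lborel. indicator {-1<..<1} x *\<^sub>R (w x *\<^sub>R f x))"
proof -
  have f: "f \<in> borel_measurable (restrict_space lborel {-1<..<1})"
    using assms by (simp add: M_def)
  have "(LINT x|M. f x) = (LINT x|restrict_space lborel {-1<..<1}. w x *\<^sub>R f x)"
    unfolding M_def
    by (rule integral_density[OF f w_measurable])
      (auto intro!: AE_I2 less_imp_le[OF w_pos] simp: space_restrict_space)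
  also have "\<dots> = (LINT x|lborel. indicator {-1<..<1} x *\<^sub>R (w x *\<^sub>R f x))"
    by (rule integral_restrict_space) simp
  finally show ?thesis .
qed

sublocale finite_interval_measure M
proof (intro finite_interval_measure.intro finite_interval_measure_axioms.intro finite_measureI)
  have "integrable lborel (\<lambda>x. indicator {-1<..<1} x *\<^sub>R (w x *\<^sub>R indicator {-1<..<1} x :: real))"
    using w_integrable unfolding set_integrable_def
    by (rule Bochner_Integration.integrable_cong[THEN iffD1, rotated 2]) (auto simp: indicator_def)
  moreover have "{-1<..<1} \<in> sets M" using sets.top[of M] by (simp add: space_M')
  ultimately have "integrable M (indicator {-1<..<1} :: real \<Rightarrow> real)"
    by (subst integrable_M) auto
  then show "emeasure M (space M) \<noteq> \<infinity>"
    by (auto simp: space_M' integrable_indicator_iff)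
qed (fact space_M' sets_M')+

lemma continuous_measurable_M:
  "continuous_on {-1<..<1} f \<Longrightarrow> f \<in> borel_measurable M"
  by (simp add: measurable_cong_sets[OF sets_M refl] borel_measurable_continuous_on_restrict)

lemma p_cont: "continuous_on {-1<..<1} p"
  using p_deriv by (intro continuous_at_imp_continuous_on ballI DERIV_isCont) auto

lemma w_nz: "x \<in> {-1<..<1} \<Longrightarrow> w x \<noteq> 0" and p_nz: "x \<in> {-1<..<1} \<Longrightarrow> p x \<noteq> 0"
  using w_pos p_pos by (force+)

lemma p_vector_derivative:
  "x \<in> {-1<..<1} \<Longrightarrow> ((\<lambda>x. complex_of_real (p x)) has_vector_derivative of_real (p' x)) (at x)"
  by (intro has_vector_derivative_of_real p_deriv)

lemma Cc_L:
  assumes "Cc f" "Cc f'" "Cc f''"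
  shows "Cc (L f f' f'')"
  unfolding L_def[abs_def]
  by (intro Cc_add Cc_of_real_mult assms continuous_intros w_cont p_cont p'_cont q_cont ballI w_nz)

lemma C2c_L_L2_fun: "C2c f f' f'' \<Longrightarrow> L f f' f'' \<in> L2_fun M"
  by (intro Cc_L2_fun Cc_L C1cD(2,3)[OF C2cD(1)] C1cD(3)[OF C2cD(2)])

lemma C1c_mult_p:
  assumes "C1c k k'"
  shows "C1c (\<lambda>x. k x * of_real (p x)) (\<lambda>x. k' x * of_real (p x) + k x * of_real (p' x))"
  by (intro C1c_mult assms p_vector_derivative continuous_intros p'_cont)

lemma Cc_div_w: "Cc k \<Longrightarrow> Cc (\<lambda>x. k x / of_real (w x))"
  unfolding divide_inverse of_real_inverse[symmetric]
  by (intro Cc_of_real_mult continuous_intros w_cont ballI w_nz)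

lemma integral_M_div_w:
  assumes k: "Cc k" and f: "f \<in> borel_measurable M"
  shows "(LINT x|M. k x / of_real (w x) * f x) = (LINT x|lborel. k x * f x)"
proof -
  note [measurable] = f borel_imp_measurable_M[OF Cc_measurable[OF Cc_div_w[OF k]]]
  have "(LINT x|M. k x / of_real (w x) * f x)
      = (LINT x|lborel. indicator {-1<..<1} x *\<^sub>R (w x *\<^sub>R (k x / of_real (w x) * f x)))"
    by (rule integral_M) measurable
  also have "\<dots> = (LINT x|lborel. k x * f x)"
  proof (intro Bochner_Integration.integral_cong refl)
    fix x show "indicator {-1<..<1} x *\<^sub>R (w x *\<^sub>R (k x / of_real (w x) * f x)) = k x * f x"
      using w_nz[of x] Cc_zero_outside[OF k, of x]
      by (cases "x \<in> {-1<..<1}") (auto simp: scaleR_conv_of_real)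
  qed
  finally show ?thesis .
qed

text \<open>Adjoint pairs of \<open>T\<^sub>0\<close>, formulated for representatives instead of
  classes.\<close>

definition weak_solution :: "(real \<Rightarrow> complex) \<Rightarrow> (real \<Rightarrow> complex) \<Rightarrow> bool" where
  "weak_solution u v \<longleftrightarrow> u \<in> L2_fun M \<and> v \<in> L2_fun M \<and>
     (\<forall>k k' k''. C2c k k' k'' \<longrightarrow> (LINT x|M. L k k' k'' x * cnj (u x)) = (LINT x|M. k x * cnj (v x)))"

text \<open>The right-hand side of (p u')' = w (v - q u), extended by zero to the line.\<close>

definition source :: "(real \<Rightarrow> complex) \<Rightarrow> (real \<Rightarrow> complex) \<Rightarrow> real \<Rightarrow> complex" where
  "source u v x = indicator {-1<..<1} x *\<^sub>R (w x *\<^sub>R (v x - of_real (q x) * u x))"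

lemma q_mult_L2_fun:
  assumes "u \<in> L2_fun M"
  shows "(\<lambda>x. of_real (q x) * u x) \<in> L2_fun M"
proof (rule L2_fun_bound[OF assms])
  note [measurable] = L2_funD(1)[OF assms] continuous_measurable_M[OF q_cont]
  show "(\<lambda>x. of_real (q x) * u x) \<in> borel_measurable M" by measurable
  show "AE x in M. cmod (of_real (q x) * u x) \<le> Q * cmod (u x)"
    using q_bound by (auto intro!: AE_I2 mult_right_mono simp: space_M norm_mult)
qed

text \<open>The constant 1 is square integrable for a finite measure. Hence \<open>source\<close> is
  Lebesgue integrable and has a continuous indefinite integral.\<close>

lemma L2_fun_integrable: "f \<in> L2_fun M \<Longrightarrow> integrable M f"
  using L2_fun_mult_integrable[of f M "\<lambda>_. 1"] L2_fun_bounded[of "\<lambda>_. 1" 1] by simp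

lemma source_L2:
  assumes "u \<in> L2_fun M" "v \<in> L2_fun M"
  shows "(\<lambda>x. v x - of_real (q x) * u x) \<in> L2_fun M"
  by (intro L2_fun_diff q_mult_L2_fun assms)

lemma source_integrable:
  assumes "u \<in> L2_fun M" "v \<in> L2_fun M"
  shows "integrable lborel (source u v)"
  using L2_fun_integrable[OF source_L2[OF assms]] L2_funD(1)[OF source_L2[OF assms]]
  by (simp add: integrable_M source_def[abs_def])

lemma integral_source:
  assumes uv: "u \<in> L2_fun M" "v \<in> L2_fun M" and f: "f \<in> borel_measurable M"
  shows "(LINT x|M. f x * cnj (v x - of_real (q x) * u x)) = (LINT x|lborel. f x * cnj (source u v x))"
proof -
  note [measurable] = f L2_funD(1)[OF source_L2[OF uv]]
  have "(LINT x|M. f x * cnj (v x - of_real (q x) * u x))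
    = (LINT x|lborel. indicator {-1<..<1} x *\<^sub>R (w x *\<^sub>R (f x * cnj (v x - of_real (q x) * u x))))"
    by (rule integral_M) measurable
  also have "\<dots> = (LINT x|lborel. f x * cnj (source u v x))"
    by (intro Bochner_Integration.integral_cong refl)
      (auto simp: source_def indicator_def scaleR_conv_of_real)
  finally show ?thesis .
qed

lemma weak_solution_source:
  assumes uv: "weak_solution u v" and k: "C2c k k' k''"
  shows "(LINT x|M. (k'' x * of_real (p x) + k' x * of_real (p' x)) / of_real (w x) * cnj (u x))
    = (LINT x|lborel. k x * cnj (source u v x))"
proof -
  have u: "u \<in> L2_fun M" and v: "v \<in> L2_fun M" using uv by (auto simp: weak_solution_def)
  have kL2: "k \<in> L2_fun M" by (rule C2c_L2_fun[OF k])
  note int = L2_fun_inner_integrable[OF kL2 v] L2_fun_inner_integrable[OF kL2 q_mult_L2_fun[OF u]]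
    L2_fun_inner_integrable[OF C2c_L_L2_fun[OF k] u]
  have "(LINT x|M. (k'' x * of_real (p x) + k' x * of_real (p' x)) / of_real (w x) * cnj (u x))
     = (LINT x|M. L k k' k'' x * cnj (u x) - k x * cnj (of_real (q x) * u x))"
    by (intro Bochner_Integration.integral_cong refl)
      (auto simp: L_def add_divide_distrib algebra_simps)
  also have "\<dots> = (LINT x|M. k x * cnj (v x)) - (LINT x|M. k x * cnj (of_real (q x) * u x))"
    using uv k by (subst Bochner_Integration.integral_diff[OF int(3,2)]) (auto simp: weak_solution_def)
  also have "\<dots> = (LINT x|M. k x * cnj (v x - of_real (q x) * u x))"
    by (subst Bochner_Integration.integral_diff[OF int(1,2), symmetric]) (simp add: algebra_simps)
  also have "\<dots> = (LINT x|lborel. k x * cnj (source u v x))"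
    by (rule integral_source[OF u v L2_funD(1)[OF kL2]])
  finally show ?thesis .
qed

text \<open>The du Bois-Reymond argument for the operator \<open>\<phi> \<mapsto> (p \<phi>')'\<close>: a function \<open>k\<close> is in its range on
  \<open>C\<^sup>2\<close> functions of compact support as soon as \<open>k\<close> is orthogonal to \<open>1\<close> and to
  an antiderivative of \<open>1/p\<close>.\<close>

lemma range_of_principal_part:
  assumes k: "Cc k" and 0: "(LINT x|lborel. k x) = 0" "(LINT x|lborel. k x * P x) = 0"
    and P: "\<And>x. x \<in> {-1<..<1} \<Longrightarrow> (P has_vector_derivative of_real (1 / p x)) (at x)"
  shows "\<exists>f f' f''. C2c f f' f'' \<and> (\<forall>x. f'' x * of_real (p x) + f' x * of_real (p' x) = k x)"
proof -
  obtain K where K: "C1c K k" using Cc_antiderivative[OF k 0(1)] .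
  define f' where "f' x = K x * of_real (1 / p x)" for x
  define f'' where "f'' x = k x * of_real (1 / p x) + K x * of_real (- p' x / (p x)\<^sup>2)" for x
  have inv_cont: "continuous_on {-1<..<1} (\<lambda>x. complex_of_real (1 / p x))"
    by (intro continuous_intros p_cont ballI p_nz)
  have f': "C1c f' f''"
    unfolding f'_def[abs_def] f''_def[abs_def]
  proof (rule C1c_mult[OF K])
    fix x :: real assume x: "x \<in> {-1<..<1}"
    have "((\<lambda>x. 1 / p x) has_real_derivative - p' x / (p x)\<^sup>2) (at x)"
      using p_nz[OF x] by (auto intro!: derivative_eq_intros p_deriv[OF x] simp: power2_eq_square)
    then show "((\<lambda>x. complex_of_real (1 / p x)) has_vector_derivative of_real (- p' x / (p x)\<^sup>2)) (at x)"
      by (rule has_vector_derivative_of_real)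
  next
    show "continuous_on {-1<..<1} (\<lambda>x. complex_of_real (- p' x / (p x)\<^sup>2))"
      by (intro continuous_intros p_cont p'_cont ballI) (simp add: p_nz)
  qed
  have "(LINT x|lborel. f' x) = 0"
    using C1c_integral_by_parts[OF K P inv_cont] 0(2) by (simp add: f'_def)
  then obtain f where "C1c f f'" using Cc_antiderivative[OF C1cD(2)[OF f']] by metis
  with f' have "C2c f f' f''" by (simp add: C2c_def)
  moreover have "f'' x * of_real (p x) + f' x * of_real (p' x) = k x" for x
  proof (cases "x \<in> {-1<..<1}")
    case True
    then show ?thesis using p_nz[OF True] by (simp add: f'_def f''_def field_simps power2_eq_square)
  next
    case False
    then show ?thesis
      using Cc_zero_outside[OF k False] Cc_zero_outside[OF C1cD(2)[OF K] False] by (simp add: f'_def f''_def)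
  qed
  ultimately show ?thesis by blast
qed

lemma Cc_integral_pos:
  assumes k: "Cc (\<lambda>x. complex_of_real (f x))" and nonneg: "\<And>x. 0 \<le> f x"
    and pos: "\<And>x. x \<in> {a<..<b} \<Longrightarrow> 0 < f x" and ab: "a < b"
  shows "(LINT x|lborel. complex_of_real (f x)) \<noteq> 0"
proof
  assume "(LINT x|lborel. complex_of_real (f x)) = 0"
  then have 0: "(LINT x|lborel. f x) = 0" by simp
  have "integrable lborel (\<lambda>x. cmod (complex_of_real (f x)))"
    using Cc_integrable[OF k] by (rule integrable_norm)
  then have "integrable lborel f" using nonneg by (simp add: abs_of_nonneg)
  then have "AE x in lborel. f x = 0"
    using integral_nonneg_eq_0_iff_AE[of lborel f] nonneg 0 by simp
  then have "AE x in lborel. x \<notin> {a<..<b}"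
    by (rule eventually_mono) (use pos in fastforce)
  then have "emeasure lborel {a<..<b} = 0"
    by (intro null_setsD1 AE_iff_null_sets[THEN iffD2]) auto
  then show False using ab by simp
qed

text \<open>Integrating the source twice gives \<open>U0\<close> with (p U0')' equal to the source.
  The functional \<Lambda> compares u with \<open>U0\<close> and kills all k = (p f')', which by
  \<open>range_of_principal_part\<close> include all k with zero integral and zero pairing with
  \<open>P\<close>. A functional that vanishes on the common kernel of two functionals is a
  combination of them, so u differs from \<open>U0\<close> by a combination of 1 and P, the
  solutions of (p y')' = 0.\<close>

theorem weak_solution_regular:
  assumes uv: "weak_solution u v"
  obtains U U' where "AE x in M. u x = U x"
    "\<And>x. x \<in> {-1<..<1} \<Longrightarrow> (U has_vector_derivative U' x) (at x)"
    "continuous_on {-1<..<1} U'"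
    "\<And>k k'. C1c k k' \<Longrightarrow>
      (LINT x|lborel. k x * cnj (source u v x)) = - (LINT x|lborel. k' x * (of_real (p x) * cnj (U' x)))"
proof -
  have u: "u \<in> L2_fun M" and v: "v \<in> L2_fun M" using uv by (auto simp: weak_solution_def)
  note [measurable] = L2_funD(1)[OF u]
  define G where "G t = (LINT x|lborel. indicator {..<t} x * source u v x)" for t
  have cnj_G: "cnj (G t) = (LINT x|lborel. indicator {..<t} x * cnj (source u v x))" for t
  proof -
    have "cnj (G t) = (LINT x|lborel. cnj (indicator {..<t} x * source u v x))"
      unfolding G_def by (rule Bochner_Integration.integral_cnj[symmetric])
    also have "\<dots> = (LINT x|lborel. indicator {..<t} x * cnj (source u v x))"
      by (intro Bochner_Integration.integral_cong refl) (auto simp: indicator_def)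
    finally show ?thesis .
  qed
  have G_cont: "continuous_on A G" for A
    using continuous_on_indefinite_integral[OF source_integrable[OF u v]]
    unfolding G_def[abs_def] by (rule continuous_on_subset) simp
  have by_parts_G: "(LINT x|lborel. k x * cnj (source u v x)) = - (LINT x|lborel. k' x * cnj (G x))"
    if "C1c k k'" for k k'
    unfolding cnj_G using source_integrable[OF u v]
    by (intro C1c_integral_by_parts_indefinite[OF that]) simp
  have Gp_cont: "continuous_on {-1<..<1} (\<lambda>x. G x / of_real (p x))"
    by (intro continuous_intros G_cont p_cont) (simp add: p_nz)
  obtain U0 where "\<forall>x\<in>{-1<..<1}. (U0 has_vector_derivative G x / of_real (p x)) (at x)"
    using antiderivative_on_interval[OF Gp_cont] by blast
  note U0 = bspec[OF this]
  have inv_cont: "continuous_on {-1<..<1} (\<lambda>x. complex_of_real (1 / p x))"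
    by (intro continuous_intros p_cont ballI p_nz)
  obtain P where "\<forall>x\<in>{-1<..<1}. (P has_vector_derivative complex_of_real (1 / p x)) (at x)"
    using antiderivative_on_interval[OF inv_cont] by blast
  note P = bspec[OF this]
  have cont: "continuous_on {-1<..<1} U0" "continuous_on {-1<..<1} P"
    by (intro continuous_at_imp_continuous_on ballI has_vector_derivative_continuous, erule U0)
      (intro continuous_at_imp_continuous_on ballI has_vector_derivative_continuous, erule P)
  \<comment> \<open>Dividing by w turns the weighted integral into the Lebesgue pairing of k with
    \<open>cnj u\<close>, comparable with the second term.\<close>
  define \<Lambda> where "\<Lambda> k = (LINT x|M. k x / of_real (w x) * cnj (u x)) - (LINT x|lborel. k x * cnj (U0 x))"
    for k :: "real \<Rightarrow> complex"
  have int_u: "integrable M (\<lambda>x. k x / of_real (w x) * cnj (u x))" if "Cc k" for k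
    by (intro L2_fun_inner_integrable Cc_L2_fun Cc_div_w that u)
  have int_U0: "integrable lborel (\<lambda>x. k x * cnj (U0 x))" if "Cc k" for k
    by (intro Cc_integrable Cc_mult that continuous_intros cont)
  have int_P: "integrable lborel (\<lambda>x. k x * P x)" if "Cc k" for k
    by (intro Cc_integrable Cc_mult that cont)
  have \<Lambda>_add: "\<Lambda> (\<lambda>x. k x + l x) = \<Lambda> k + \<Lambda> l" if "Cc k" "Cc l" for k l
    using int_u[OF that(1)] int_u[OF that(2)] int_U0[OF that(1)] int_U0[OF that(2)]
    by (simp add: \<Lambda>_def add_divide_distrib ring_distribs)
  have \<Lambda>_scale: "\<Lambda> (\<lambda>x. c * k x) = c * \<Lambda> k" for c k
  proof -
    have "c * k x / of_real (w x) * cnj (u x) = c * (k x / of_real (w x) * cnj (u x))"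
      "c * k x * cnj (U0 x) = c * (k x * cnj (U0 x))" for x by simp_all
    then show ?thesis unfolding \<Lambda>_def by (simp only: integral_mult_right_zero right_diff_distrib)
  qed
  have \<Lambda>_range: "\<Lambda> k = 0"
    if k: "Cc k" "(LINT x|lborel. k x) = 0" "(LINT x|lborel. k x * P x) = 0" for k
  proof -
    obtain f f' f'' where f: "C2c f f' f''" "\<forall>x. f'' x * of_real (p x) + f' x * of_real (p' x) = k x"
      using range_of_principal_part[OF k P] by blast
    have "(LINT x|lborel. (f'' x * of_real (p x) + f' x * of_real (p' x)) * cnj (U0 x))
        = - (LINT x|lborel. (f' x * of_real (p x)) * cnj (G x / of_real (p x)))"
      by (intro C1c_integral_by_parts C1c_mult_p C2cD[OF f(1)] has_vector_derivative_cnj U0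
          continuous_intros Gp_cont)
    also have "(LINT x|lborel. (f' x * of_real (p x)) * cnj (G x / of_real (p x)))
        = (LINT x|lborel. f' x * cnj (G x))"
    proof (intro Bochner_Integration.integral_cong refl)
      fix x show "(f' x * of_real (p x)) * cnj (G x / of_real (p x)) = f' x * cnj (G x)"
        using p_nz[of x] Cc_zero_outside[OF C1cD(2)[OF C2cD(2)[OF f(1)]], of x]
        by (cases "x \<in> {-1<..<1}") auto
    qed
    also have "- \<dots> = (LINT x|lborel. f x * cnj (source u v x))"
      using by_parts_G[OF C2cD(1)[OF f(1)]] by simp
    also have "\<dots> = (LINT x|M. k x / of_real (w x) * cnj (u x))"
      using weak_solution_source[OF uv f(1)] by (simp add: f(2))
    finally show ?thesis by (simp add: \<Lambda>_def f(2))
  qed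
  obtain s s' s'' :: "real \<Rightarrow> real"
    where s: "C2c (\<lambda>x. of_real (s x)) (\<lambda>x. of_real (s' x)) (\<lambda>x. of_real (s'' x))"
      "\<And>x. 0 \<le> s x" "\<And>x. 0 < s x \<longleftrightarrow> x \<in> {-1/2<..<1/2}"
    using C2c_nonneg_bump[of "-1/2" "1/2"] by auto
  \<comment> \<open>These two test functions give a triangular system for the two functionals:
    \<open>k1\<close> has nonzero integral, while its derivative \<open>k2\<close> has integral zero
    and, after integration by parts, a nonzero pairing with P because 1/p is positive.\<close>
  define k1 where "k1 x = complex_of_real (s x)" for x
  define k2 where "k2 x = complex_of_real (s' x)" for x
  have k1: "Cc k1" and k2: "Cc k2" and k12: "C1c k1 k2"
    using C1cD[OF C2cD(1)[OF s(1)]] C2cD(1)[OF s(1)] by (simp_all add: k1_def[abs_def] k2_def[abs_def])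
  define m where "m = (LINT x|lborel. k1 x)"
  have m: "m \<noteq> 0"
    unfolding m_def k1_def using k1 s by (intro Cc_integral_pos[of _ "-1/2" "1/2"]) (auto simp: k1_def[abs_def])
  have k2_0: "(LINT x|lborel. k2 x) = 0" by (rule C1c_integral_zero[OF k12])
  define \<mu> where "\<mu> = (LINT x|lborel. k2 x * P x)"
  have \<mu>: "\<mu> \<noteq> 0"
  proof -
    have cont1p: "continuous_on {-1<..<1} (\<lambda>x. 1 / p x)"
      by (intro continuous_intros p_cont ballI p_nz)
    have "\<mu> = - (LINT x|lborel. k1 x * of_real (1 / p x))"
      unfolding \<mu>_def by (intro C1c_integral_by_parts[OF k12] P continuous_intros p_cont ballI p_nz)
    also have "(LINT x|lborel. k1 x * of_real (1 / p x)) = (LINT x|lborel. complex_of_real (s x * (1 / p x)))"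
      by (simp add: k1_def)
    finally have "\<mu> = - (LINT x|lborel. complex_of_real (s x * (1 / p x)))" .
    moreover have "(LINT x|lborel. complex_of_real (s x * (1 / p x))) \<noteq> 0"
    proof (rule Cc_integral_pos[of _ "-1/2" "1/2"])
      show "Cc (\<lambda>x. complex_of_real (s x * (1 / p x)))"
        using Cc_of_real_mult[OF k1 cont1p] by (simp add: k1_def)
      show "0 \<le> s x * (1 / p x)" for x
        using s(2)[of x] p_pos[of x] Cc_zero_outside[OF k1, of x]
        by (cases "x \<in> {-1<..<1}") (auto simp: k1_def less_imp_le)
      show "0 < s x * (1 / p x)" if "x \<in> {-1/2<..<1/2}" for x
        using s(3)[of x] p_pos[of x] that by simp
    qed simp
    ultimately show ?thesis by (simp only: neg_equal_0_iff_equal) simp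
  qed
  \<comment> \<open>The solution of the triangular system: \<Lambda> k2 = b \<mu>, and \<Lambda> k1
    is a m plus b times the pairing of k1 with P.\<close>
  define b where "b = \<Lambda> k2 / \<mu>"
  define a where "a = (\<Lambda> k1 - b * (LINT x|lborel. k1 x * P x)) / m"
  have \<Lambda>: "\<Lambda> k = a * (LINT x|lborel. k x) + b * (LINT x|lborel. k x * P x)" if k: "Cc k" for k
  proof -
    \<comment> \<open>These coefficients make both integrals of the corrected function
      \<open>?k\<close> vanish, so that \<open>\<Lambda>_range\<close> applies to it.\<close>
    define c1 where "c1 = (LINT x|lborel. k x) / m"
    define c2 where "c2 = ((LINT x|lborel. k x * P x) - c1 * (LINT x|lborel. k1 x * P x)) / \<mu>"
    let ?k = "\<lambda>x. k x + ((- c1) * k1 x + (- c2) * k2 x)"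
    have kCc: "Cc (\<lambda>x. (- c1) * k1 x + (- c2) * k2 x)" "Cc (\<lambda>x. (- c1) * k1 x)" "Cc (\<lambda>x. (- c2) * k2 x)"
      by (intro Cc_add Cc_scale k1 k2)+
    have i1: "(LINT x|lborel. ?k x) = (LINT x|lborel. k x) + ((- c1) * m + (- c2) * (LINT x|lborel. k2 x))"
      unfolding m_def
      using Cc_integrable[OF k] Cc_integrable[OF k1] Cc_integrable[OF k2] by simp
    have "?k x * P x = k x * P x + ((- c1) * (k1 x * P x) + (- c2) * (k2 x * P x))" for x
      by (simp add: algebra_simps)
    then have i2: "(LINT x|lborel. ?k x * P x) = (LINT x|lborel. k x * P x)
        + ((- c1) * (LINT x|lborel. k1 x * P x) + (- c2) * \<mu>)"
      unfolding \<mu>_def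
      using int_P[OF k] int_P[OF k1] int_P[OF k2] by simp
    have "\<Lambda> ?k = 0"
      by (intro \<Lambda>_range Cc_add k kCc) (use i1 i2 k2_0 m \<mu> in \<open>simp_all add: c1_def c2_def\<close>)
    then have "\<Lambda> k = c1 * \<Lambda> k1 + c2 * \<Lambda> k2"
      by (simp only: \<Lambda>_add[OF k kCc(1)] \<Lambda>_add[OF kCc(2,3)] \<Lambda>_scale) (simp add: algebra_simps)
    then show ?thesis
      using m \<mu> by (simp add: a_def b_def c1_def c2_def field_simps)
  qed
  \<comment> \<open>The conjugate appears because u enters \<Lambda> as
    \<open>cnj u\<close>.\<close>
  define U where "U x = U0 x + cnj (a + b * P x)" for x
  define U' where "U' x = G x / of_real (p x) + cnj (b * of_real (1 / p x))" for x
  have U: "(U has_vector_derivative U' x) (at x)" if "x \<in> {-1<..<1}" for x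
  proof -
    have "((\<lambda>x. a + b * P x) has_vector_derivative 0 + b * of_real (1 / p x)) (at x)"
      by (intro has_vector_derivative_add has_vector_derivative_const has_vector_derivative_mult_right P that)
    then show ?thesis
      unfolding U_def[abs_def] U'_def
      by (intro has_vector_derivative_add U0[OF that] has_vector_derivative_cnj) simp
  qed
  have U_cont: "continuous_on {-1<..<1} U"
    by (intro continuous_at_imp_continuous_on ballI has_vector_derivative_continuous) (erule U)
  note [measurable] = continuous_measurable_M[OF U_cont]
  have orth: "(LINT x|M. k x / of_real (w x) * cnj (u x - U x)) = 0" if k: "Cc k" for k
  proof -
    have "k x * cnj (U x) = k x * cnj (U0 x) + (a * k x + b * (k x * P x))" for x
      by (simp add: U_def algebra_simps)
    then have "(LINT x|lborel. k x * cnj (U x))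
        = (LINT x|lborel. k x * cnj (U0 x)) + (a * (LINT x|lborel. k x) + b * (LINT x|lborel. k x * P x))"
      using int_U0[OF k] int_P[OF k] Cc_integrable[OF k] by simp
    also have "\<dots> = (LINT x|M. k x / of_real (w x) * cnj (u x))"
      unfolding \<Lambda>[OF k, symmetric] \<Lambda>_def by simp
    finally have eq: "(LINT x|M. k x / of_real (w x) * cnj (U x)) = (LINT x|M. k x / of_real (w x) * cnj (u x))"
      by (subst integral_M_div_w[OF k]) auto
    have "Cc (\<lambda>x. k x / of_real (w x) * cnj (U x))"
      by (intro Cc_mult Cc_div_w k continuous_intros U_cont)
    then have "integrable M (\<lambda>x. k x / of_real (w x) * cnj (U x))"
      by (intro L2_fun_integrable Cc_L2_fun)
    with eq int_u[OF k] show ?thesis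
      by (simp only: complex_cnj_diff right_diff_distrib) simp
  qed
  have "AE x in M. u x = U x"
  proof -
    \<comment> \<open>Near the end points U is not yet known to be square integrable, so density is
      applied to u - U times a bump; the bumps exhaust the interval.\<close>
    define r where "r n = 1 - 1 / (real n + 2)" for n
    have r: "0 < r n" "r n < 1" for n by (simp_all add: r_def)
    have "\<exists>\<sigma> :: real \<Rightarrow> real. Cc (\<lambda>x. of_real (\<sigma> x)) \<and> (\<forall>x. 0 < \<sigma> x \<longleftrightarrow> x \<in> {- r n<..<r n})" for n
    proof -
      obtain s s' s'' :: "real \<Rightarrow> real"
        where "C2c (\<lambda>x. of_real (s x)) (\<lambda>x. of_real (s' x)) (\<lambda>x. of_real (s'' x))"
          "\<forall>x. 0 < s x \<longleftrightarrow> x \<in> {- r n<..<r n}"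
        using C2c_nonneg_bump[of "- r n" "r n"] r[of n] by auto
      then show ?thesis using C1cD(2)[OF C2cD(1)] by blast
    qed
    then obtain \<sigma> :: "nat \<Rightarrow> real \<Rightarrow> real" where \<sigma>: "\<And>n. Cc (\<lambda>x. of_real (\<sigma> n x))"
      "\<And>n x. 0 < \<sigma> n x \<longleftrightarrow> x \<in> {- r n<..<r n}" by metis
    have "AE x in M. of_real (\<sigma> n x) * (u x - U x) = 0" for n
    proof (rule AE_zero_if_orthogonal_C2c)
      obtain B where B: "B > 0" "\<And>x. cmod (complex_of_real (\<sigma> n x)) \<le> B"
        using Cc_bounded[OF \<sigma>(1)] by metis
      note [measurable] = borel_imp_measurable_M[OF Cc_measurable[OF \<sigma>(1)[of n]]]
      have "(\<lambda>x. of_real (\<sigma> n x) * u x) \<in> L2_fun M"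
        by (rule L2_fun_bound[OF u, of _ B]) (use B in \<open>auto intro!: AE_I2 mult_right_mono simp: norm_mult\<close>)
      moreover have "(\<lambda>x. of_real (\<sigma> n x) * U x) \<in> L2_fun M"
        by (intro Cc_L2_fun Cc_mult \<sigma> U_cont)
      ultimately show "(\<lambda>x. of_real (\<sigma> n x) * (u x - U x)) \<in> L2_fun M"
        unfolding right_diff_distrib by (rule L2_fun_diff)
      fix k k' k'' assume "C2c k k' k''"
      \<comment> \<open>The weight put into the test function cancels the division by w in
        \<open>orth\<close>.\<close>
      then have k: "Cc (\<lambda>x. k x * (of_real (\<sigma> n x) * of_real (w x)))"
        by (intro Cc_mult C1cD(2)[OF C2cD(1)] continuous_intros w_cont Cc_continuous \<sigma>(1))
      have "(LINT x|M. k x * cnj (of_real (\<sigma> n x) * (u x - U x)))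
        = (LINT x|M. k x * (of_real (\<sigma> n x) * of_real (w x)) / of_real (w x) * cnj (u x - U x))"
        by (intro Bochner_Integration.integral_cong refl) (auto simp: space_M w_nz)
      also have "\<dots> = 0" by (rule orth[OF k])
      finally show "(LINT x|M. k x * cnj (of_real (\<sigma> n x) * (u x - U x))) = 0" .
    qed
    then have "AE x in M. \<forall>n. of_real (\<sigma> n x) * (u x - U x) = 0" by (subst AE_all_countable) blast
    moreover have "AE x in M. x \<in> {-1<..<1}" by (intro AE_I2) (simp add: space_M)
    ultimately show ?thesis
    proof eventually_elim
      case (elim x)
      have "r \<longlonglongrightarrow> 1" unfolding r_def by real_asymp
      moreover have "\<bar>x\<bar> < 1" using elim by auto
      ultimately have "\<forall>\<^sub>F n in sequentially. \<bar>x\<bar> < r n" by (rule order_tendstoD(1))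
      then obtain n where "\<bar>x\<bar> < r n" by (auto simp: eventually_sequentially)
      then have "x \<in> {- r n<..<r n}" by auto
      then have "\<sigma> n x \<noteq> 0" using \<sigma>(2)[of n x] by force
      then show ?case using elim by auto
    qed
  qed
  moreover have "continuous_on {-1<..<1} U'"
    unfolding U'_def by (intro continuous_intros Gp_cont p_cont ballI p_nz)
  moreover have "(LINT x|lborel. k x * cnj (source u v x)) = - (LINT x|lborel. k' x * (of_real (p x) * cnj (U' x)))"
    if k: "C1c k k'" for k k'
  proof -
    \<comment> \<open>p U' differs from G by a constant, and k' has integral zero. This extends the
      weak equation from \<open>C\<^sup>2\<close> to \<open>C\<^sup>1\<close> test
      functions.\<close>
    have "(LINT x|lborel. k' x * (of_real (p x) * cnj (U' x))) = (LINT x|lborel. k' x * cnj (G x) + b * k' x)"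
    proof (intro Bochner_Integration.integral_cong refl)
      fix x show "k' x * (of_real (p x) * cnj (U' x)) = k' x * cnj (G x) + b * k' x"
        using p_nz[of x] Cc_zero_outside[OF C1cD(3)[OF k], of x]
        by (cases "x \<in> {-1<..<1}") (auto simp: U'_def field_simps)
    qed
    also have "\<dots> = (LINT x|lborel. k' x * cnj (G x)) + b * (LINT x|lborel. k' x)"
      using Cc_integrable[OF C1cD(3)[OF k]]
        Cc_integrable[OF Cc_mult[OF C1cD(3)[OF k] continuous_on_cnj[OF G_cont]]] by simp
    also have "\<dots> = (LINT x|lborel. k' x * cnj (G x))" using C1c_integral_zero[OF k] by simp
    finally show ?thesis using by_parts_G[OF k] by simp
  qed
  ultimately show thesis using U by (intro that) auto
qed

end

section \<open>Cutoff functions\<close>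

text \<open>The function \<open>- ln (1 - x\<^sup>2)\<close> tends to infinity at both end points while its derivative is
  bounded by a multiple of \<open>1 / (1 - x\<^sup>2)\<close>, that is, bounded in the metric for which \<open>T\<close> is
  a weighted Laplacian; this metric is complete.\<close>

definition cutoff :: "real \<Rightarrow> real \<Rightarrow> real" where
  "cutoff n x = (if \<bar>x\<bar> < 1 then (max 0 (1 + ln (1 - x\<^sup>2) / n))\<^sup>2 else 0)"

definition cutoff_deriv :: "real \<Rightarrow> real \<Rightarrow> real" where
  "cutoff_deriv n x =
    (if \<bar>x\<bar> < 1 then 2 * max 0 (1 + ln (1 - x\<^sup>2) / n) * (- 2 * x / (1 - x\<^sup>2) / n) else 0)"

lemma one_minus_square_pos: "x \<in> {-1<..<1} \<Longrightarrow> 0 < 1 - (x::real)\<^sup>2"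
  by (simp add: abs_square_less_1 abs_less_iff)

text \<open>Squaring the positive part removes the kink. The cutoff vanishes where ln (1 - x^2) <
  -n, that is, where x^2 > 1 - exp (-n), which is the origin of the radius.\<close>

lemma C1c_cutoff:
  assumes n: "n > 0"
  shows "C1c (\<lambda>x. of_real (cutoff n x)) (\<lambda>x. of_real (cutoff_deriv n x))"
proof (rule C1cI[of _ _ "sqrt (1 - exp (- n))"])
  fix x :: real assume x: "x \<in> {-1<..<1}"
  have pow: "((\<lambda>t::real. (max 0 t)\<^sup>2) has_real_derivative 2 * max 0 t) (at t)" for t
    using has_real_derivative_pos_part_power[of 0 t] by (simp add: numeral_eq_Suc)
  have "((\<lambda>x. 1 + ln (1 - x\<^sup>2) / n) has_real_derivative - 2 * x / (1 - x\<^sup>2) / n) (at x)"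
    using one_minus_square_pos[OF x] n by (auto intro!: derivative_eq_intros simp: field_simps)
  from DERIV_chain2[OF pow this]
  have "((\<lambda>x. (max 0 (1 + ln (1 - x\<^sup>2) / n))\<^sup>2) has_real_derivative
      2 * max 0 (1 + ln (1 - x\<^sup>2) / n) * (- 2 * x / (1 - x\<^sup>2) / n)) (at x)" .
  then have "(cutoff n has_real_derivative
      2 * max 0 (1 + ln (1 - x\<^sup>2) / n) * (- 2 * x / (1 - x\<^sup>2) / n)) (at x)"
    by (rule has_field_derivative_transform_within_open[of _ _ _ "{-1<..<1}"])
      (use x in \<open>auto simp: cutoff_def abs_less_iff\<close>)
  also have "2 * max 0 (1 + ln (1 - x\<^sup>2) / n) * (- 2 * x / (1 - x\<^sup>2) / n) = cutoff_deriv n x"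
    using x by (auto simp: cutoff_deriv_def abs_less_iff)
  finally show "((\<lambda>x. complex_of_real (cutoff n x)) has_vector_derivative of_real (cutoff_deriv n x)) (at x)"
    by (rule has_vector_derivative_of_real)
next
  have "continuous_on {-1<..<1} (\<lambda>x. 2 * max 0 (1 + ln (1 - x\<^sup>2) / n) * (- 2 * x / (1 - x\<^sup>2) / n))"
    using one_minus_square_pos n by (auto intro!: continuous_intros) (fastforce dest: one_minus_square_pos)+
  then have "continuous_on {-1<..<1} (cutoff_deriv n)"
    by (rule continuous_on_eq) (auto simp: cutoff_deriv_def abs_less_iff)
  then show "continuous_on {-1<..<1} (\<lambda>x. complex_of_real (cutoff_deriv n x))"
    by (intro continuous_intros)
next
  show "sqrt (1 - exp (- n)) < 1" by simp
  have zero: "max 0 (1 + ln (1 - x\<^sup>2) / n) = 0" if "sqrt (1 - exp (- n)) < \<bar>x\<bar>" "\<bar>x\<bar> < 1" for x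
  proof -
    have "1 - exp (- n) < x\<^sup>2"
      using that(1) n by (metis real_sqrt_abs real_sqrt_less_iff)
    then have "1 - x\<^sup>2 < exp (- n)" by simp
    moreover have "0 < 1 - x\<^sup>2" using that(2) by (simp add: abs_square_less_1)
    ultimately have "ln (1 - x\<^sup>2) < ln (exp (- n))" by (subst ln_less_cancel_iff) auto
    then have "1 + ln (1 - x\<^sup>2) / n < 0" using n by (simp add: field_simps)
    then show ?thesis by simp
  qed
  show "complex_of_real (cutoff n x) = 0" "complex_of_real (cutoff_deriv n x) = 0"
    if "sqrt (1 - exp (- n)) < \<bar>x\<bar>" for x
    using zero[OF that] by (simp_all add: cutoff_def cutoff_deriv_def)
qed

lemma cutoff_nonneg: "0 \<le> cutoff n x"
  by (simp add: cutoff_def)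

lemma cutoff_base_le_1:
  fixes n x :: real
  assumes "n > 0" "\<bar>x\<bar> < 1"
  shows "max 0 (1 + ln (1 - x\<^sup>2) / n) \<le> 1"
proof -
  have "0 < 1 - x\<^sup>2" using assms(2) by (simp add: abs_square_less_1)
  then have "ln (1 - x\<^sup>2) \<le> 0" by (subst ln_le_zero_iff) auto
  then show ?thesis using assms(1) by (simp add: divide_le_0_iff)
qed

lemma cutoff_le_1:
  assumes "n > 0"
  shows "cutoff n x \<le> 1"
  unfolding cutoff_def using cutoff_base_le_1[OF assms, of x] by (auto intro!: power_le_one)

text \<open>The squaring in the cutoff and the derivative -2x of 1 - x^2 each contribute a factor 2,
  so the derivative times 1 - x^2 is at most 4/n; hence 16.\<close>

lemma cutoff_deriv_square_le:
  assumes "n > 0" "x \<in> {-1<..<1}"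
  shows "(cutoff_deriv n x)\<^sup>2 * (1 - x\<^sup>2)\<^sup>2 \<le> 16 / n\<^sup>2"
proof -
  have x: "\<bar>x\<bar> < 1" using assms(2) by auto
  have pos: "0 < 1 - x\<^sup>2" by (rule one_minus_square_pos[OF assms(2)])
  define m where "m = max 0 (1 + ln (1 - x\<^sup>2) / n)"
  have m: "0 \<le> m" "m \<le> 1" using cutoff_base_le_1[OF assms(1) x] by (auto simp: m_def)
  have "cutoff_deriv n x = 2 * m * (- 2 * x / (1 - x\<^sup>2) / n)"
    using x by (simp add: cutoff_deriv_def m_def)
  then have "cutoff_deriv n x * (1 - x\<^sup>2) = - 4 * (m * x) / n"
    using pos assms(1) by (simp add: field_simps)
  then have "(cutoff_deriv n x)\<^sup>2 * (1 - x\<^sup>2)\<^sup>2 = (- 4 * (m * x) / n)\<^sup>2"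
    by (simp only: power_mult_distrib[symmetric])
  also have "\<dots> = 16 * (\<bar>m * x\<bar>)\<^sup>2 / n\<^sup>2" by (simp add: power_divide power_mult_distrib)
  also have "\<bar>m * x\<bar> \<le> 1 * 1" unfolding abs_mult using m x by (intro mult_mono) auto
  then have "16 * (\<bar>m * x\<bar>)\<^sup>2 / n\<^sup>2 \<le> 16 * 1 / n\<^sup>2"
    by (intro divide_right_mono mult_left_mono) (auto simp: abs_square_le_1)
  finally show ?thesis by simp
qed

lemma cutoff_tendsto_1:
  assumes "x \<in> {-1<..<1}"
  shows "(\<lambda>n. cutoff (real (Suc n)) x) \<longlonglongrightarrow> 1"
proof -
  have "(\<lambda>n. 1 + c / real (Suc n)) \<longlonglongrightarrow> 1" for c by real_asymp
  then have "(\<lambda>n. (max 0 (1 + ln (1 - x\<^sup>2) / real (Suc n)))\<^sup>2) \<longlonglongrightarrow> (max 0 1)\<^sup>2"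
    by (intro tendsto_power tendsto_max tendsto_const)
  then show ?thesis using assms by (simp add: cutoff_def abs_less_iff)
qed

section \<open>Symmetry of the adjoint\<close>

context sturm_liouville
begin

text \<open>The assumption \<open>p_le\<close>, and with it completeness, enters the argument
  here.\<close>

lemma cutoff_deriv_p_le:
  assumes "n > 0" "x \<in> {-1<..<1}"
  shows "(cutoff_deriv n x)\<^sup>2 * p x \<le> 16 / n\<^sup>2 * w x"
proof -
  have "(cutoff_deriv n x)\<^sup>2 * p x \<le> (cutoff_deriv n x)\<^sup>2 * ((1 - x\<^sup>2)\<^sup>2 * w x)"
    by (intro mult_left_mono p_le assms) auto
  also have "\<dots> = ((cutoff_deriv n x)\<^sup>2 * (1 - x\<^sup>2)\<^sup>2) * w x" by simp
  also have "\<dots> \<le> 16 / n\<^sup>2 * w x"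
    by (intro mult_right_mono cutoff_deriv_square_le assms less_imp_le[OF w_pos])
  finally show ?thesis .
qed

text \<open>The weak form of (p U')' = w f, with f standing for v - q u. It admits
  \<open>C\<^sup>1\<close> test functions, since cutoffs times another solution are no
  smoother.\<close>

definition regular_solution where
  "regular_solution f U U' \<longleftrightarrow> f \<in> L2_fun M \<and> U \<in> L2_fun M \<and>
     (\<forall>x\<in>{-1<..<1}. (U has_vector_derivative U' x) (at x)) \<and> continuous_on {-1<..<1} U' \<and>
     (\<forall>k k'. C1c k k' \<longrightarrow>
       (LINT x|M. k x * cnj (f x)) = - (LINT x|lborel. k' x * (of_real (p x) * cnj (U' x))))"

lemma weak_solution_regular_solution:
  assumes uv: "weak_solution u v"
  obtains U U' where "regular_solution (\<lambda>x. v x - of_real (q x) * u x) U U'" "AE x in M. u x = U x"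
proof (rule weak_solution_regular[OF uv])
  fix U U'
  assume U: "AE x in M. u x = U x" "\<And>x. x \<in> {-1<..<1} \<Longrightarrow> (U has_vector_derivative U' x) (at x)"
    "continuous_on {-1<..<1} U'"
    "\<And>k k'. C1c k k' \<Longrightarrow>
      (LINT x|lborel. k x * cnj (source u v x)) = - (LINT x|lborel. k' x * (of_real (p x) * cnj (U' x)))"
  have u: "u \<in> L2_fun M" and v: "v \<in> L2_fun M" using uv by (auto simp: weak_solution_def)
  have "continuous_on {-1<..<1} U"
    by (intro continuous_at_imp_continuous_on ballI has_vector_derivative_continuous) (erule U(2))
  then have "U \<in> borel_measurable M" by (rule continuous_measurable_M)
  moreover have "AE x in M. cmod (U x) \<le> 1 * cmod (u x)" using U(1) by eventually_elim simp
  ultimately have "U \<in> L2_fun M" by (rule L2_fun_bound[OF u])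
  moreover have "(LINT x|M. k x * cnj (v x - of_real (q x) * u x))
      = - (LINT x|lborel. k' x * (of_real (p x) * cnj (U' x)))" if k: "C1c k k'" for k k'
    using U(4)[OF k] integral_source[OF u v borel_imp_measurable_M[OF Cc_measurable[OF C1cD(2)[OF k]]]]
    by simp
  ultimately have "regular_solution (\<lambda>x. v x - of_real (q x) * u x) U U'"
    unfolding regular_solution_def using U(2,3) source_L2[OF u v] by blast
  then show thesis using U(1) by (rule that)
qed

lemma regular_solutionD:
  assumes "regular_solution f U U'"
  shows "f \<in> L2_fun M" "U \<in> L2_fun M"
    "\<And>x. x \<in> {-1<..<1} \<Longrightarrow> (U has_vector_derivative U' x) (at x)" "continuous_on {-1<..<1} U'"
    "continuous_on {-1<..<1} U"
    "C1c k k' \<Longrightarrow> (LINT x|M. k x * cnj (f x)) = - (LINT x|lborel. k' x * (of_real (p x) * cnj (U' x)))"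
proof -
  show *: "(U has_vector_derivative U' x) (at x)" if "x \<in> {-1<..<1}" for x
    using assms that by (simp add: regular_solution_def)
  show "continuous_on {-1<..<1} U"
    by (intro continuous_at_imp_continuous_on ballI has_vector_derivative_continuous) (erule *)
qed (use assms in \<open>auto simp: regular_solution_def\<close>)

section \<open>Green's identity and energy estimates for one fixed cutoff\<close>

context
  fixes n :: real
  assumes n: "n > 0"
begin

lemma cutoff_cont: "continuous_on A (cutoff n)" "continuous_on A (cutoff_deriv n)"
proof -
  have "continuous_on A (\<lambda>x. Re (of_real (cutoff n x)))" "continuous_on A (\<lambda>x. Re (of_real (cutoff_deriv n x)))"
    by (intro continuous_on_Re Cc_continuous C1cD[OF C1c_cutoff[OF n]])+
  then show "continuous_on A (cutoff n)" "continuous_on A (cutoff_deriv n)" by simp_all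
qed

lemma Cc_cutoff_square_mult:
  assumes "continuous_on {-1<..<1} h"
  shows "Cc (\<lambda>x. of_real ((cutoff n x)\<^sup>2 * p x) * h x)"
proof -
  have "Cc (\<lambda>x. of_real (cutoff n x) * (of_real (cutoff n x) * of_real (p x) * h x))"
    by (intro Cc_mult C1cD(2)[OF C1c_cutoff[OF n]] continuous_intros cutoff_cont p_cont assms)
  then show ?thesis by (simp add: power2_eq_square mult_ac)
qed

lemma Cc_cutoff_deriv_mult:
  assumes "continuous_on {-1<..<1} h"
  shows "Cc (\<lambda>x. of_real (2 * cutoff n x * cutoff_deriv n x * p x) * h x)"
proof -
  have "Cc (\<lambda>x. of_real (cutoff n x) * (2 * of_real (cutoff_deriv n x) * of_real (p x) * h x))"
    by (intro Cc_mult C1cD(2)[OF C1c_cutoff[OF n]] continuous_intros cutoff_cont p_cont assms)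
  then show ?thesis by (simp add: mult_ac)
qed

text \<open>The equation of \<open>U1\<close> is tested with the squared cutoff times
  \<open>U2\<close>. Equal solutions give the energy estimate, different ones the symmetry.\<close>

lemma cutoff_green_identity:
  assumes 1: "regular_solution f1 U1 U1'" and 2: "regular_solution f2 U2 U2'"
  shows "(LINT x|M. of_real ((cutoff n x)\<^sup>2) * (U2 x * cnj (f1 x)))
     + (LINT x|lborel. of_real ((cutoff n x)\<^sup>2 * p x) * (U2' x * cnj (U1' x)))
     = - (LINT x|lborel. of_real (2 * cutoff n x * cutoff_deriv n x * p x) * (U2 x * cnj (U1' x)))"
proof -
  let ?c = "\<lambda>x. complex_of_real (cutoff n x)" and ?c' = "\<lambda>x. complex_of_real (cutoff_deriv n x)"
  note R1 = regular_solutionD[OF 1] and R2 = regular_solutionD[OF 2]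
  have c: "C1c ?c ?c'" by (rule C1c_cutoff[OF n])
  from C1c_mult[OF C1c_mult[OF c C1cD(1)[OF c] Cc_continuous[OF C1cD(3)[OF c]]] R2(3,4)]
  have k: "C1c (\<lambda>x. ?c x * ?c x * U2 x) (\<lambda>x. (?c' x * ?c x + ?c x * ?c' x) * U2 x + ?c x * ?c x * U2' x)" .
  have i1: "integrable lborel (\<lambda>x. of_real (2 * cutoff n x * cutoff_deriv n x * p x) * (U2 x * cnj (U1' x)))"
    by (intro Cc_integrable Cc_cutoff_deriv_mult continuous_intros R1 R2)
  have i2: "integrable lborel (\<lambda>x. of_real ((cutoff n x)\<^sup>2 * p x) * (U2' x * cnj (U1' x)))"
    by (intro Cc_integrable Cc_cutoff_square_mult continuous_intros R1 R2)
  have "(LINT x|M. of_real ((cutoff n x)\<^sup>2) * (U2 x * cnj (f1 x))) = (LINT x|M. ?c x * ?c x * U2 x * cnj (f1 x))"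
    by (simp add: power2_eq_square mult_ac)
  also have "\<dots> = - (LINT x|lborel. ((?c' x * ?c x + ?c x * ?c' x) * U2 x + ?c x * ?c x * U2' x)
      * (of_real (p x) * cnj (U1' x)))"
    by (rule R1(6)[OF k])
  also have "(LINT x|lborel. ((?c' x * ?c x + ?c x * ?c' x) * U2 x + ?c x * ?c x * U2' x) * (of_real (p x) * cnj (U1' x)))
     = (LINT x|lborel. of_real (2 * cutoff n x * cutoff_deriv n x * p x) * (U2 x * cnj (U1' x))
         + of_real ((cutoff n x)\<^sup>2 * p x) * (U2' x * cnj (U1' x)))"
    by (simp add: power2_eq_square algebra_simps)
  also have "\<dots> = (LINT x|lborel. of_real (2 * cutoff n x * cutoff_deriv n x * p x) * (U2 x * cnj (U1' x)))
      + (LINT x|lborel. of_real ((cutoff n x)\<^sup>2 * p x) * (U2' x * cnj (U1' x)))"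
    by (rule Bochner_Integration.integral_add[OF i1 i2])
  finally show ?thesis by simp
qed

definition energy :: "(real \<Rightarrow> complex) \<Rightarrow> real" where
  "energy U' = (LINT x|lborel. (cutoff n x)\<^sup>2 * p x * (cmod (U' x))\<^sup>2)"

lemma energy_integrable:
  assumes "continuous_on {-1<..<1} U'"
  shows "integrable lborel (\<lambda>x. (cutoff n x)\<^sup>2 * p x * (cmod (U' x))\<^sup>2)"
proof -
  have "integrable lborel (\<lambda>x. of_real ((cutoff n x)\<^sup>2 * p x) * (complex_of_real (cmod (U' x)))\<^sup>2)"
    by (intro Cc_integrable Cc_cutoff_square_mult continuous_intros assms)
  then have "integrable lborel (\<lambda>x. complex_of_real ((cutoff n x)\<^sup>2 * p x * (cmod (U' x))\<^sup>2))" by simp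
  then show ?thesis by (simp only: complex_of_real_integrable_eq)
qed

text \<open>Young's inequality in the form \<open>2 y z \<le> t y\<^sup>2 + z\<^sup>2 / t\<close>,
  with the cutoff in y and its derivative in z, followed by \<open>cutoff_deriv_p_le\<close>. The
  parameter t is kept free: 1/2 serves to absorb the energy, 1/n to produce decay.\<close>

lemma cross_term_bound:
  assumes x: "x \<in> {-1<..<1}" and t: "t > 0"
  shows "cmod (of_real (2 * cutoff n x * cutoff_deriv n x * p x) * (a * b))
    \<le> t * ((cutoff n x)\<^sup>2 * p x * (cmod b)\<^sup>2) + 16 / (t * n\<^sup>2) * (w x * (cmod a)\<^sup>2)"
proof -
  define y where "y = cutoff n x * cmod b"
  define z where "z = \<bar>cutoff_deriv n x\<bar> * cmod a"
  have "0 \<le> (t * y - z)\<^sup>2" by simp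
  then have "2 * t * (y * z) \<le> t\<^sup>2 * y\<^sup>2 + z\<^sup>2" by (simp add: power2_eq_square algebra_simps)
  then have "2 * (y * z) \<le> t * y\<^sup>2 + z\<^sup>2 / t"
    using t by (simp add: field_simps power2_eq_square)
  then have "2 * (y * z) * p x \<le> (t * y\<^sup>2 + z\<^sup>2 / t) * p x"
    using p_pos[OF x] by (intro mult_right_mono) auto
  also have "\<dots> = t * (y\<^sup>2 * p x) + z\<^sup>2 / t * p x" by (simp add: algebra_simps)
  also have "z\<^sup>2 / t * p x = ((cutoff_deriv n x)\<^sup>2 * p x) * (cmod a)\<^sup>2 / t"
    by (simp add: z_def power_mult_distrib)
  also have "t * (y\<^sup>2 * p x) + \<dots> \<le> t * (y\<^sup>2 * p x) + (16 / n\<^sup>2 * w x) * (cmod a)\<^sup>2 / t"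
    using t by (intro add_left_mono divide_right_mono mult_right_mono cutoff_deriv_p_le n x) auto
  also have "\<dots> = t * ((cutoff n x)\<^sup>2 * p x * (cmod b)\<^sup>2) + 16 / (t * n\<^sup>2) * (w x * (cmod a)\<^sup>2)"
    by (simp add: y_def power_mult_distrib mult_ac)
  finally have "2 * (y * z) * p x
    \<le> t * ((cutoff n x)\<^sup>2 * p x * (cmod b)\<^sup>2) + 16 / (t * n\<^sup>2) * (w x * (cmod a)\<^sup>2)" .
  moreover have "cmod (of_real (2 * cutoff n x * cutoff_deriv n x * p x) * (a * b)) = 2 * (y * z) * p x"
    using p_pos[OF x] cutoff_nonneg[of n x]
    by (simp add: norm_mult y_def z_def abs_mult abs_of_pos mult_ac)
  ultimately show ?thesis by simp
qed

lemma cross_integral_bound: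
  assumes a: "a \<in> L2_fun M" "continuous_on {-1<..<1} a" and b: "continuous_on {-1<..<1} b" and t: "t > 0"
  shows "cmod (LINT x|lborel. of_real (2 * cutoff n x * cutoff_deriv n x * p x) * (a x * cnj (b x)))
    \<le> t * energy b + 16 / (t * n\<^sup>2) * (LINT x|M. (cmod (a x))\<^sup>2)"
proof -
  let ?B = "\<lambda>x. indicator {-1<..<1} x *\<^sub>R (w x *\<^sub>R (cmod (a x))\<^sup>2)"
  note [measurable] = L2_funD(1)[OF a(1)]
  have B: "(LINT x|lborel. ?B x) = (LINT x|M. (cmod (a x))\<^sup>2)" by (rule integral_M[symmetric]) simp
  have iB: "integrable lborel ?B"
    using L2_funD(2)[OF a(1)] by (subst (asm) integrable_M) auto
  have "cmod (LINT x|lborel. of_real (2 * cutoff n x * cutoff_deriv n x * p x) * (a x * cnj (b x)))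
    \<le> (LINT x|lborel. t * ((cutoff n x)\<^sup>2 * p x * (cmod (b x))\<^sup>2) + 16 / (t * n\<^sup>2) * ?B x)"
  proof (rule order_trans[OF integral_norm_bound integral_mono])
    show "integrable lborel (\<lambda>x. cmod (of_real (2 * cutoff n x * cutoff_deriv n x * p x) * (a x * cnj (b x))))"
      by (intro integrable_norm Cc_integrable Cc_cutoff_deriv_mult continuous_intros a b)
    show "integrable lborel (\<lambda>x. t * ((cutoff n x)\<^sup>2 * p x * (cmod (b x))\<^sup>2) + 16 / (t * n\<^sup>2) * ?B x)"
      by (intro Bochner_Integration.integrable_add integrable_mult_right energy_integrable b iB)
    show "cmod (of_real (2 * cutoff n x * cutoff_deriv n x * p x) * (a x * cnj (b x)))
       \<le> t * ((cutoff n x)\<^sup>2 * p x * (cmod (b x))\<^sup>2) + 16 / (t * n\<^sup>2) * ?B x" for x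
    proof (cases "x \<in> {-1<..<1}")
      case True
      then show ?thesis using cross_term_bound[OF True t, of "a x" "cnj (b x)"] by simp
    next
      case False
      then have "cutoff n x = 0" by (auto simp: cutoff_def)
      then show ?thesis using False by simp
    qed
  qed
  also have "\<dots> = t * energy b + 16 / (t * n\<^sup>2) * (LINT x|M. (cmod (a x))\<^sup>2)"
    unfolding energy_def B[symmetric] using energy_integrable[OF b] iB
    by (simp only: Bochner_Integration.integral_add integrable_mult_right integral_mult_right_zero)
  finally show ?thesis .
qed

text \<open>In Green's identity of \<open>U\<close> with itself, t = 1/2 bounds the cross term by
  half the energy plus a multiple of the squared norm of \<open>U\<close>. Moving that half to the
  left doubles the constant 32 to 64 and puts the 2 before the first integral.\<close>

lemma energy_bound:
  assumes R: "regular_solution f U U'"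
  shows "energy U' \<le> 2 * (LINT x|M. cmod (U x) * cmod (f x)) + 64 / n\<^sup>2 * (LINT x|M. (cmod (U x))\<^sup>2)"
proof -
  note R = regular_solutionD[OF R]
  define A where "A = (LINT x|M. cmod (U x) * cmod (f x))"
  define B where "B = (LINT x|M. (cmod (U x))\<^sup>2)"
  note [measurable] = L2_funD(1)[OF R(1)] L2_funD(1)[OF R(2)]
  have "(LINT x|lborel. of_real ((cutoff n x)\<^sup>2 * p x) * (U' x * cnj (U' x)))
      = (LINT x|lborel. complex_of_real ((cutoff n x)\<^sup>2 * p x * (cmod (U' x))\<^sup>2))"
    by (simp only: complex_norm_square[symmetric] of_real_mult)
  also have "\<dots> = of_real (energy U')" by (simp only: energy_def integral_complex_of_real)
  finally have E: "(LINT x|lborel. of_real ((cutoff n x)\<^sup>2 * p x) * (U' x * cnj (U' x))) = of_real (energy U')" .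
  have iA: "integrable M (\<lambda>x. cmod (U x) * cmod (f x))"
    using integrable_norm[OF L2_fun_inner_integrable[OF R(2,1)]] by (simp add: norm_mult)
  have n1: "cmod (LINT x|M. of_real ((cutoff n x)\<^sup>2) * (U x * cnj (f x))) \<le> A"
    unfolding A_def
  proof (rule order_trans[OF integral_norm_bound integral_mono'])
    show "cmod (of_real ((cutoff n x)\<^sup>2) * (U x * cnj (f x))) \<le> cmod (U x) * cmod (f x)" for x
    proof -
      have "(cutoff n x)\<^sup>2 \<le> 1" using cutoff_nonneg cutoff_le_1[OF n] by (intro power_le_one) auto
      then have "(cutoff n x)\<^sup>2 * (cmod (U x) * cmod (f x)) \<le> 1 * (cmod (U x) * cmod (f x))"
        by (intro mult_right_mono) auto
      then show ?thesis by (simp add: norm_mult norm_power)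
    qed
  qed (use iA in auto)
  have n2: "cmod (LINT x|lborel. of_real (2 * cutoff n x * cutoff_deriv n x * p x) * (U x * cnj (U' x)))
    \<le> energy U' / 2 + 32 / n\<^sup>2 * B"
    using cross_integral_bound[OF R(2,5,4), of "1/2"] by (simp add: B_def)
  have "of_real (energy U') = - (LINT x|lborel. of_real (2 * cutoff n x * cutoff_deriv n x * p x) * (U x * cnj (U' x)))
      - (LINT x|M. of_real ((cutoff n x)\<^sup>2) * (U x * cnj (f x)))"
    using cutoff_green_identity[OF assms assms] unfolding E by (simp add: eq_diff_eq add.commute)
  then have "energy U' \<le> cmod (- (LINT x|lborel. of_real (2 * cutoff n x * cutoff_deriv n x * p x) * (U x * cnj (U' x)))
      - (LINT x|M. of_real ((cutoff n x)\<^sup>2) * (U x * cnj (f x))))"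
    by (metis abs_ge_self norm_of_real)
  also have "\<dots> \<le> (energy U' / 2 + 32 / n\<^sup>2 * B) + A"
    by (rule order_trans[OF norm_triangle_ineq4 add_mono]) (use n1 n2 in auto)
  finally show ?thesis by (simp add: A_def B_def field_simps)
qed

end

end

context sturm_liouville
begin

text \<open>The gradient terms of the two Green identities are conjugate to each other and cancel.
  With t = 1/N a cross term is at most the energy over N plus 16/N times a squared norm; as the
  energies are bounded independently of N, both parts are O(1/N).\<close>

lemma regular_solution_symmetric:
  assumes 1: "regular_solution f1 U1 U1'" and 2: "regular_solution f2 U2 U2'"
  shows "(LINT x|M. U2 x * cnj (f1 x)) = (LINT x|M. f2 x * cnj (U1 x))"
proof -
  note R1 = regular_solutionD[OF 1] and R2 = regular_solutionD[OF 2]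
  note [measurable] = L2_funD(1)[OF R1(1)] L2_funD(1)[OF R1(2)] L2_funD(1)[OF R2(1)] L2_funD(1)[OF R2(2)]
  let ?c = "\<lambda>n x. complex_of_real ((cutoff (real (Suc n)) x)\<^sup>2)"
  define D where "D n = (LINT x|M. ?c n x * (U2 x * cnj (f1 x))) - (LINT x|M. ?c n x * (f2 x * cnj (U1 x)))" for n
  define B where "B f = (LINT x|M. (cmod (f x))\<^sup>2)" for f :: "real \<Rightarrow> complex"
  define A where "A U f = (LINT x|M. cmod (U x) * cmod (f x))" for U f :: "real \<Rightarrow> complex"
  define C where "C = (2 * A U1 f1 + 64 * B U1 + 16 * B U2) + (2 * A U2 f2 + 64 * B U2 + 16 * B U1)"
  have B_nonneg: "0 \<le> B f" for f by (simp add: B_def)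
  have D_le: "cmod (D n) \<le> C / real (Suc n)" for n
  proof -
    define N where "N = real (Suc n)"
    have N: "N \<ge> 1" "N > 0" by (auto simp: N_def)
    let ?E = "\<lambda>U U'. (LINT x|lborel. of_real ((cutoff N x)\<^sup>2 * p x) * (U x * cnj (U' x)))"
    let ?X = "\<lambda>U U'. (LINT x|lborel. of_real (2 * cutoff N x * cutoff_deriv N x * p x) * (U x * cnj (U' x)))"
    have cE: "cnj (?E U1' U2') = ?E U2' U1'"
      by (subst Bochner_Integration.integral_cnj[symmetric]) (simp add: mult.commute)
    have cM: "(LINT x|M. ?c n x * (f2 x * cnj (U1 x))) = cnj (LINT x|M. ?c n x * (U1 x * cnj (f2 x)))"
      by (subst Bochner_Integration.integral_cnj[symmetric]) (simp add: mult.commute)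
    \<comment> \<open>The first Green identity minus the conjugate of the second; the gradient terms
      e and \<open>cnj e'\<close> drop out.\<close>
    have alg: "a - cnj b = cnj y - x" if "a + e = - x" "b + e' = - y" "cnj e' = e" for a b e e' x y :: complex
    proof -
      have "a = - x - e" "b = - y - e'" using that by (simp_all add: eq_diff_eq)
      then show ?thesis using that(3) by simp
    qed
    have "D n = cnj (?X U1 U2') - ?X U2 U1'"
      unfolding D_def cM unfolding N_def[symmetric]
      by (rule alg[OF cutoff_green_identity[OF N(2) 1 2] cutoff_green_identity[OF N(2) 2 1] cE])
    then have "cmod (D n) \<le> cmod (cnj (?X U1 U2')) + cmod (?X U2 U1')"
      by (simp only: norm_triangle_ineq4)
    then have "cmod (D n) \<le> cmod (?X U1 U2') + cmod (?X U2 U1')" by (simp only: complex_mod_cnj)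
    moreover have X: "cmod (?X U V') \<le> (2 * A V g + 64 * B V + 16 * B U) / N"
      if U: "U \<in> L2_fun M" "continuous_on {-1<..<1} U" and V: "regular_solution g V V'" for U V V' g
    proof -
      have "64 / N\<^sup>2 * B V \<le> 64 * B V"
        using N B_nonneg by (intro mult_right_mono) (auto simp: divide_le_eq)
      then have E: "energy N V' \<le> 2 * A V g + 64 * B V"
        using energy_bound[OF N(2) V] by (simp add: A_def B_def)
      have "cmod (?X U V') \<le> 1 / N * energy N V' + 16 / (1 / N * N\<^sup>2) * B U"
        unfolding B_def using N by (intro cross_integral_bound U regular_solutionD[OF V]) auto
      also have "16 / (1 / N * N\<^sup>2) * B U = 16 * B U / N" using N by (simp add: power2_eq_square)
      also have "1 / N * energy N V' + 16 * B U / N \<le> 1 / N * (2 * A V g + 64 * B V) + 16 * B U / N"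
        using E N by (intro add_right_mono mult_left_mono) auto
      finally show ?thesis by (simp add: add_divide_distrib)
    qed
    ultimately have "cmod (D n) \<le> (2 * A U2 f2 + 64 * B U2 + 16 * B U1) / N + (2 * A U1 f1 + 64 * B U1 + 16 * B U2) / N"
      using X[OF R1(2,5) 2] X[OF R2(2,5) 1] by linarith
    then show ?thesis by (simp add: C_def N_def add_divide_distrib)
  qed
  have "(\<lambda>n. C / real (Suc n)) \<longlonglongrightarrow> 0" by real_asymp
  then have D0: "D \<longlonglongrightarrow> 0"
    by (rule Lim_null_comparison[rotated]) (use D_le in auto)
  \<comment> \<open>The cutoffs tend to 1 and are at most 1, so the cut-off inner products tend to
    the full ones.\<close>
  have lim: "(\<lambda>n. LINT x|M. ?c n x * h x) \<longlonglongrightarrow> (LINT x|M. h x)" if h: "integrable M h" for h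
  proof (rule integral_dominated_convergence[of _ _ _ "\<lambda>x. cmod (h x)"])
    note [measurable] = borel_measurable_integrable[OF h]
    show "h \<in> borel_measurable M" "integrable M (\<lambda>x. cmod (h x))" using h by auto
    have [measurable]: "?c n \<in> borel_measurable M" for n
      by (intro continuous_measurable_M continuous_intros cutoff_cont) simp
    show "(\<lambda>x. ?c n x * h x) \<in> borel_measurable M" for n by measurable
    show "AE x in M. (\<lambda>n. ?c n x * h x) \<longlonglongrightarrow> h x"
    proof (rule AE_I2)
      fix x assume "x \<in> space M"
      then have "(\<lambda>n. ?c n x * h x) \<longlonglongrightarrow> of_real (1\<^sup>2) * h x"
        by (intro tendsto_intros cutoff_tendsto_1) (simp add: space_M)
      then show "(\<lambda>n. ?c n x * h x) \<longlonglongrightarrow> h x" by simp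
    qed
    have "\<bar>(cutoff (real (Suc n)) x)\<^sup>2\<bar> \<le> 1" for n x
      using cutoff_nonneg[of "real (Suc n)" x] cutoff_le_1[of "real (Suc n)" x] by (simp add: power_le_one)
    then show "AE x in M. norm (?c n x * h x) \<le> cmod (h x)" for n
      unfolding norm_mult norm_of_real by (intro AE_I2 mult_left_le_one_le) auto
  qed
  have "D \<longlonglongrightarrow> (LINT x|M. U2 x * cnj (f1 x)) - (LINT x|M. f2 x * cnj (U1 x))"
    unfolding D_def by (intro tendsto_diff lim L2_fun_inner_integrable R1 R2)
  with D0 show ?thesis using LIMSEQ_unique by fastforce
qed

text \<open>Since q is real, both sides contain the same integral of q u2 \<open>cnj u1\<close>.
  What remains is the identity for the principal parts, with u1 and u2 replaced by their regular
  representatives.\<close>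

theorem weak_solution_symmetric:
  assumes 1: "weak_solution u1 v1" and 2: "weak_solution u2 v2"
  shows "(LINT x|M. u2 x * cnj (v1 x)) = (LINT x|M. v2 x * cnj (u1 x))"
proof -
  have L2: "u1 \<in> L2_fun M" "v1 \<in> L2_fun M" "u2 \<in> L2_fun M" "v2 \<in> L2_fun M"
    using 1 2 by (auto simp: weak_solution_def)
  let ?f1 = "\<lambda>x. v1 x - of_real (q x) * u1 x" and ?f2 = "\<lambda>x. v2 x - of_real (q x) * u2 x"
  obtain U1 U1' where U1: "regular_solution ?f1 U1 U1'" "AE x in M. u1 x = U1 x"
    by (rule weak_solution_regular_solution[OF 1])
  obtain U2 U2' where U2: "regular_solution ?f2 U2 U2'" "AE x in M. u2 x = U2 x"
    by (rule weak_solution_regular_solution[OF 2])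
  note R1 = regular_solutionD[OF U1(1)] and R2 = regular_solutionD[OF U2(1)]
  note [measurable] = L2[THEN L2_funD(1)] L2_funD(1)[OF R1(2)] L2_funD(1)[OF R2(2)] L2_funD(1)[OF R1(1)] L2_funD(1)[OF R2(1)]
  have i: "integrable M (\<lambda>x. u2 x * cnj (of_real (q x) * u1 x))"
    by (intro L2_fun_inner_integrable q_mult_L2_fun L2)
  have "(LINT x|M. u2 x * cnj (v1 x))
      = (LINT x|M. u2 x * cnj (?f1 x) + u2 x * cnj (of_real (q x) * u1 x))"
    by (simp add: algebra_simps)
  also have "\<dots> = (LINT x|M. u2 x * cnj (?f1 x)) + (LINT x|M. u2 x * cnj (of_real (q x) * u1 x))"
    by (intro Bochner_Integration.integral_add i L2_fun_inner_integrable L2 R1)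
  also have "(LINT x|M. u2 x * cnj (?f1 x)) = (LINT x|M. U2 x * cnj (?f1 x))"
  proof (rule integral_cong_AE)
    show "AE x in M. u2 x * cnj (?f1 x) = U2 x * cnj (?f1 x)" using U2(2) by eventually_elim simp
  qed measurable
  also have "\<dots> = (LINT x|M. ?f2 x * cnj (U1 x))"
    by (rule regular_solution_symmetric[OF U1(1) U2(1)])
  also have "\<dots> = (LINT x|M. ?f2 x * cnj (u1 x))"
  proof (rule integral_cong_AE)
    show "AE x in M. ?f2 x * cnj (U1 x) = ?f2 x * cnj (u1 x)" using U1(2) by eventually_elim simp
  qed measurable
  also have "\<dots> + (LINT x|M. u2 x * cnj (of_real (q x) * u1 x))
     = (LINT x|M. ?f2 x * cnj (u1 x) + u2 x * cnj (of_real (q x) * u1 x))"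
    by (intro Bochner_Integration.integral_add[symmetric] i L2_fun_inner_integrable L2 R2)
  also have "\<dots> = (LINT x|M. v2 x * cnj (u1 x))"
    by (simp add: algebra_simps)
  finally show ?thesis .
qed

section \<open>Essential self-adjointness\<close>

lemma AE_M_I:
  assumes "AE x in lborel. x \<in> {-1<..<1} \<longrightarrow> P x"
  shows "AE x in M. P x"
proof -
  have "AE x in restrict_space lborel {-1<..<1}. P x"
    using assms by (subst AE_restrict_space_iff) auto
  then show ?thesis
    unfolding M_def by (subst AE_density) (use w_measurable in auto)
qed

text \<open>Two integrations by parts move \<open>L\<close> from a test function to \<open>f\<close>, one of them with
  the merely integrable function \<open>f''\<close>.\<close>

lemma abs_continuous_weak_solution:
  assumes f: "f \<in> L2_fun M"
    and deriv: "\<And>x. x \<in> {-1<..<1} \<Longrightarrow> (f has_vector_derivative f' x) (at x)"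
    and f'_cont: "continuous_on {-1<..<1} f'"
    and K: "compact K" "K \<subseteq> {-1<..<1}" "\<And>x. x \<in> {-1<..<1} - K \<Longrightarrow> f x = 0"
    and ac: "abs_continuous_on {-1<..<1} f'"
    and deriv2: "AE x in lborel. x \<in> {-1<..<1} \<longrightarrow> (f' has_vector_derivative f'' x) (at x)"
    and Lf: "L f f' f'' \<in> L2_fun M"
  shows "weak_solution f (L f f' f'')"
proof -
  obtain r where r: "0 < r" "r < 1" "\<And>x. x \<in> K \<Longrightarrow> \<bar>x\<bar> < r"
  proof (cases "K = {}")
    case True
    then show thesis using that[of "1/2"] by auto
  next
    case False
    have "compact (abs ` K)" by (intro compact_continuous_image continuous_intros K(1))
    then obtain m where m: "m \<in> abs ` K" "\<And>y. y \<in> abs ` K \<Longrightarrow> y \<le> m"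
      using compact_attains_sup[of "abs ` K"] False by auto
    have "0 \<le> m" "m < 1" using m(1) K(2) by (auto simp: abs_less_iff)
    moreover have "\<bar>x\<bar> < (m + 1) / 2" if "x \<in> K" for x
      using m(2)[of "\<bar>x\<bar>"] that \<open>m < 1\<close> by auto
    ultimately show thesis using that[of "(m + 1) / 2"] by simp
  qed
  have op: "open ({-1<..<1} - K)" using K(1) by (auto intro: open_Diff compact_imp_closed)
  have f'0: "f' x = 0" if "x \<in> {-1<..<1} - K" for x
  proof -
    have "((\<lambda>x. 0) has_vector_derivative 0) (at x)" by simp
    then have "(f has_vector_derivative 0) (at x)"
      by (rule has_vector_derivative_transform_within_open[OF _ op that]) (simp add: K(3))
    then show ?thesis using deriv[of x] that vector_derivative_unique_at by blast
  qed
  have f''0: "f'' x = 0" if "x \<in> {-1<..<1} - K" "(f' has_vector_derivative f'' x) (at x)" for x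
  proof -
    have "((\<lambda>x. 0) has_vector_derivative 0) (at x)" by simp
    then have "(f' has_vector_derivative 0) (at x)"
      by (rule has_vector_derivative_transform_within_open[OF _ op that(1)]) (simp add: f'0)
    then show ?thesis using that(2) vector_derivative_unique_at by blast
  qed
  have notK: "x \<notin> K" if "r \<le> \<bar>x\<bar>" for x using r(3)[of x] that by auto
  \<comment> \<open>Values of f and f' outside the interval are arbitrary; F and h are the
    extensions by zero.\<close>
  define F where "F x = (if x \<in> {-1<..<1} then f x else 0)" for x
  define h where "h x = (if x \<in> {-1<..<1} then f' x else 0)" for x
  have Fh: "C1c F h"
  proof (rule C1cI[OF _ _ r(2)])
    show "(F has_vector_derivative h x) (at x)" if "x \<in> {-1<..<1}" for x
      using deriv[OF that] that
      by (auto intro!: has_vector_derivative_transform_within_open[of f _ x "{-1<..<1}"] simp: F_def h_def)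
    show "continuous_on {-1<..<1} h"
      using f'_cont by (rule continuous_on_eq) (simp add: h_def)
    show "F x = 0" "h x = 0" if "r < \<bar>x\<bar>" for x
      using that notK[of x] K(3)[of x] f'0[of x] by (auto simp: F_def h_def)
  qed
  have CF: "Cc F" and Ch: "Cc h" using C1cD[OF Fh] by auto
  \<comment> \<open>Neither measurability nor integrability of f'' is assumed. Off [-r, r] it
    vanishes almost everywhere in the interval, so g is a version of it; both properties are derived
    below from \<open>L f f' f''\<close>.\<close>
  define g where "g x = indicator {-r..r} x *\<^sub>R f'' x" for x
  have g_AE: "AE x in M. f'' x = g x"
  proof (rule AE_M_I, use deriv2 in eventually_elim, intro impI)
    fix x assume "x \<in> {-1<..<1} \<longrightarrow> (f' has_vector_derivative f'' x) (at x)" "x \<in> {-1<..<1}"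
    then show "f'' x = g x"
      using f''0[of x] notK[of x] by (auto simp: g_def indicator_def abs_if split: if_splits)
  qed
  have diff_L2: "(\<lambda>x. L f f' f'' x - (h x * of_real (p' x / w x) + F x * of_real (q x))) \<in> L2_fun M"
    by (intro L2_fun_diff Lf Cc_L2_fun Cc_add Cc_of_real_mult CF Ch continuous_intros p'_cont w_cont q_cont ballI w_nz)
  have int: "integrable lborel (\<lambda>x. indicator {-1<..<1} x *\<^sub>R (w x *\<^sub>R
      (L f f' f'' x - (h x * of_real (p' x / w x) + F x * of_real (q x)))))"
    using L2_fun_integrable[OF diff_L2] unfolding integrable_M[OF L2_funD(1)[OF diff_L2]] .
  \<comment> \<open>On [-r, r] the expression L is solved for f'', which equals w / p times an L2
    function. The factor 1/p is bounded there, and w times an L2 function is Lebesgue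
    integrable.\<close>
  define ip where "ip x = indicator {-r..r} x *\<^sub>R complex_of_real (1 / p x)" for x
  have sub: "{-r..r} \<subseteq> {-1<..<1}" using r by auto
  have ip_cont: "continuous_on {-r..r} (\<lambda>x. complex_of_real (1 / p x))"
    using sub p_nz by (intro continuous_intros continuous_on_subset[OF p_cont sub]) auto
  have [measurable]: "ip \<in> borel_measurable borel"
    unfolding ip_def[abs_def] by (intro borel_measurable_continuous_on_indicator ip_cont) auto
  have "bounded ((\<lambda>x. complex_of_real (1 / p x)) ` {-r..r})"
    by (intro compact_imp_bounded compact_continuous_image ip_cont) auto
  then obtain C where C: "\<forall>y\<in>(\<lambda>x. complex_of_real (1 / p x)) ` {-r..r}. cmod y \<le> C" "C > 0"
    unfolding bounded_pos by blast
  have ip_le: "cmod (ip x) \<le> C" for x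
    using C by (cases "x \<in> {-r..r}") (auto simp: ip_def)
  have g_eq: "g x = ip x * (indicator {-1<..<1} x *\<^sub>R (w x *\<^sub>R
      (L f f' f'' x - (h x * of_real (p' x / w x) + F x * of_real (q x)))))" for x
  proof (cases "x \<in> {-r..r}")
    case True
    then have x: "x \<in> {-1<..<1}" using sub by auto
    show ?thesis
      using True x p_nz[OF x] w_nz[OF x]
      by (simp add: g_def ip_def L_def h_def F_def scaleR_conv_of_real)
  qed (simp add: g_def ip_def)
  have g_int: "integrable lborel g"
  proof (rule Bochner_Integration.integrable_bound)
    show "integrable lborel (\<lambda>x. C * cmod (indicator {-1<..<1} x *\<^sub>R (w x *\<^sub>R
      (L f f' f'' x - (h x * of_real (p' x / w x) + F x * of_real (q x))))))"
      using int by (intro integrable_mult_right integrable_norm)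
    note [measurable] = borel_measurable_integrable[OF int]
    show "g \<in> borel_measurable lborel" unfolding g_eq[abs_def] by measurable
    show "AE x in lborel. norm (g x) \<le> norm (C * cmod (indicator {-1<..<1} x *\<^sub>R (w x *\<^sub>R
      (L f f' f'' x - (h x * of_real (p' x / w x) + F x * of_real (q x))))))"
      unfolding g_eq norm_mult using C(2) ip_le by (intro AE_I2 mult_mono) auto
  qed
  note [measurable] = borel_measurable_integrable[OF g_int]
  obtain N where N: "negligible N" "\<And>x. x \<in> {-1<..<1} - N \<Longrightarrow> (f' has_vector_derivative f'' x) (at x)"
  proof -
    obtain N where "N \<in> null_sets lborel"
      "{x \<in> space lborel. \<not> (x \<in> {-1<..<1} \<longrightarrow> (f' has_vector_derivative f'' x) (at x))} \<subseteq> N"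
      using deriv2 unfolding eventually_ae_filter by blast
    moreover from this have "negligible N"
      by (simp add: negligible_iff_null_sets null_sets_completionI)
    ultimately show thesis by (intro that[of N]) auto
  qed
  have g_indef: "(LINT x|lborel. indicator {..<t} x * g x) = h t" for t
  proof (cases "t < - r")
    case True
    then have zero: "indicator {..<t} x * g x = 0" for x by (auto simp: g_def indicator_def)
    have "h t = 0" using True notK[of t] f'0[of t] by (auto simp: h_def)
    then show ?thesis unfolding zero by simp
  next
    case False
    \<comment> \<open>g vanishes beyond r, so the integral stops at s, where f' already has the
      value h t.\<close>
    define s where "s = min t r"
    have s: "- r \<le> s" "{-r..s} \<subseteq> {-1<..<1}" using False r by (auto simp: s_def)
    have "(f'' has_integral (f' s - f' (- r))) {-r..s}"
      by (rule abs_continuous_on_has_integral[OF ac s(2,1) N(1)])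
        (rule has_vector_derivative_at_within, rule N(2), use s(2) in blast)
    moreover have "f' (- r) = 0" using f'0[of "- r"] notK[of "-r"] r by auto
    moreover have "f' s = h t"
      using False r f'0[of r] f'0[of t] notK[of r] notK[of t] by (auto simp: s_def h_def min_def)
    ultimately have "((\<lambda>x. if x \<in> {-r..s} then f'' x else 0) has_integral h t) UNIV"
      by (subst has_integral_restrict_UNIV) simp
    then have "((\<lambda>x. indicator {..<t} x * g x) has_integral h t) UNIV"
      by (rule has_integral_spike[of "{t}", rotated 2]) (auto simp: g_def s_def indicator_def)
    moreover have "integrable lborel (\<lambda>x. indicator {..<t} x * g x)"
      by (rule Bochner_Integration.integrable_bound[OF g_int]) (auto simp: indicator_def)
    then have "((\<lambda>x. indicator {..<t} x * g x) has_integral (LINT x|lborel. indicator {..<t} x * g x)) UNIV"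
      by (rule has_integral_integral_lborel)
    ultimately show ?thesis using has_integral_unique by blast
  qed
  have cnj_g_indef: "(LINT x|lborel. indicator {..<t} x * cnj (g x)) = cnj (h t)" for t
  proof -
    have "indicator {..<t} x * cnj (g x) = cnj (indicator {..<t} x * g x)" for x
      by (auto simp: indicator_def)
    then show ?thesis by (simp only: Bochner_Integration.integral_cnj g_indef)
  qed
  have by_parts: "(LINT x|lborel. k x * cnj (g x)) = - (LINT x|lborel. k' x * cnj (h x))"
    if k: "C1c k k'" for k k'
    using C1c_integral_by_parts_indefinite[OF k, of "\<lambda>x. cnj (g x)"] g_int
    by (simp only: cnj_g_indef integrable_cnj)
  have "(LINT x|M. L k k' k'' x * cnj (f x)) = (LINT x|M. k x * cnj (L f f' f'' x))"
    if k2: "C2c k k' k''" for k k' k''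
  proof -
    have k: "C1c k k'" and k': "C1c k' k''" using C2cD[OF k2] .
    note [measurable] = L2_funD(1)[OF f] L2_funD(1)[OF C2c_L_L2_fun[OF k2]] L2_funD(1)[OF Lf]
      borel_imp_measurable_M[OF Cc_measurable[OF C1cD(2)[OF k]]]
      borel_imp_measurable_M[OF Cc_measurable[OF CF]] borel_imp_measurable_M[OF Cc_measurable[OF Ch]]
      continuous_measurable_M[OF w_cont] continuous_measurable_M[OF p_cont]
      continuous_measurable_M[OF p'_cont] continuous_measurable_M[OF q_cont]
      borel_imp_measurable_M[of g]
    let ?Q = "\<lambda>x. k x * of_real (w x * q x) * cnj (F x)"
    have cont: "continuous_on {-1<..<1} (\<lambda>x. cnj (F x))" "continuous_on {-1<..<1} (\<lambda>x. cnj (h x))"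
      by (intro continuous_intros Cc_continuous CF Ch)+
    have iQ: "integrable lborel ?Q"
      by (intro Cc_integrable Cc_mult Cc_of_real_mult C1cD[OF k] continuous_intros w_cont q_cont cont)
    have i1: "integrable lborel (\<lambda>x. (k'' x * of_real (p x) + k' x * of_real (p' x)) * cnj (F x))"
      by (intro Cc_integrable Cc_mult[OF C1cD(3)[OF C1c_mult_p[OF k']]] cont)
    have i2: "integrable lborel (\<lambda>x. (k' x * of_real (p x)) * cnj (h x))"
      by (intro Cc_integrable Cc_mult[OF C1cD(2)[OF C1c_mult_p[OF k']]] cont)
    have i3: "integrable lborel (\<lambda>x. (k x * of_real (p' x)) * cnj (h x))"
      by (intro Cc_integrable Cc_mult Cc_of_real_mult C1cD[OF k] p'_cont cont)
    have i4: "integrable lborel (\<lambda>x. (k x * of_real (p x)) * cnj (g x))"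
    proof -
      have kp: "Cc (\<lambda>x. k x * of_real (p x))" by (rule C1cD(2)[OF C1c_mult_p[OF k]])
      obtain B where B: "B > 0" "\<And>x. cmod (k x * of_real (p x)) \<le> B" using Cc_bounded[OF kp] by metis
      note [measurable] = Cc_measurable[OF kp]
      show ?thesis
      proof (rule Bochner_Integration.integrable_bound)
        show "integrable lborel (\<lambda>x. B * cmod (g x))" using g_int by simp
        show "AE x in lborel. norm (k x * of_real (p x) * cnj (g x)) \<le> norm (B * cmod (g x))"
          unfolding norm_mult[of "k _ * of_real (p _)"] using B by (auto intro!: mult_right_mono)
      qed measurable
    qed
    have "(LINT x|M. L k k' k'' x * cnj (f x))
       = (LINT x|lborel. indicator {-1<..<1} x *\<^sub>R (w x *\<^sub>R (L k k' k'' x * cnj (f x))))"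
      by (rule integral_M) measurable
    also have "\<dots> = (LINT x|lborel. (k'' x * of_real (p x) + k' x * of_real (p' x)) * cnj (F x) + ?Q x)"
    proof (intro Bochner_Integration.integral_cong refl)
      fix x
      show "indicator {-1<..<1} x *\<^sub>R (w x *\<^sub>R (L k k' k'' x * cnj (f x)))
        = (k'' x * of_real (p x) + k' x * of_real (p' x)) * cnj (F x) + ?Q x"
        using w_nz[of x] by (cases "x \<in> {-1<..<1}") (auto simp: L_def F_def scaleR_conv_of_real field_simps)
    qed
    also have "\<dots> = (LINT x|lborel. (k'' x * of_real (p x) + k' x * of_real (p' x)) * cnj (F x))
        + (LINT x|lborel. ?Q x)"
      by (rule Bochner_Integration.integral_add[OF i1 iQ])
    also have "(LINT x|lborel. (k'' x * of_real (p x) + k' x * of_real (p' x)) * cnj (F x))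
        = - (LINT x|lborel. (k' x * of_real (p x)) * cnj (h x))"
      by (intro C1c_integral_by_parts[OF C1c_mult_p[OF k']] has_vector_derivative_cnj C1cD(1)[OF Fh] cont)
    finally have lhs: "(LINT x|M. L k k' k'' x * cnj (f x))
        = - (LINT x|lborel. (k' x * of_real (p x)) * cnj (h x)) + (LINT x|lborel. ?Q x)" .
    let ?G = "\<lambda>x. g x * of_real (p x / w x) + h x * of_real (p' x / w x) + F x * of_real (q x)"
    have "(LINT x|M. k x * cnj (L f f' f'' x)) = (LINT x|M. k x * cnj (?G x))"
    proof (rule integral_cong_AE)
      have "AE x in M. x \<in> {-1<..<1}" by (intro AE_I2) (simp add: space_M)
      with g_AE show "AE x in M. k x * cnj (L f f' f'' x) = k x * cnj (?G x)"
        by eventually_elim (simp add: L_def F_def h_def)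
    qed measurable
    also have "\<dots> = (LINT x|lborel. indicator {-1<..<1} x *\<^sub>R (w x *\<^sub>R (k x * cnj (?G x))))"
      by (rule integral_M) measurable
    also have "\<dots> = (LINT x|lborel. (k x * of_real (p x)) * cnj (g x)
        + (k x * of_real (p' x)) * cnj (h x) + ?Q x)"
    proof (intro Bochner_Integration.integral_cong refl)
      fix x
      show "indicator {-1<..<1} x *\<^sub>R (w x *\<^sub>R (k x * cnj (?G x)))
        = (k x * of_real (p x)) * cnj (g x) + (k x * of_real (p' x)) * cnj (h x) + ?Q x"
        using w_nz[of x] Cc_zero_outside[OF C1cD(2)[OF k], of x]
        by (cases "x \<in> {-1<..<1}") (auto simp: scaleR_conv_of_real field_simps)
    qed
    also have "\<dots> = (LINT x|lborel. (k x * of_real (p x)) * cnj (g x))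
        + (LINT x|lborel. (k x * of_real (p' x)) * cnj (h x)) + (LINT x|lborel. ?Q x)"
      using i3 i4 iQ by (simp only: Bochner_Integration.integral_add Bochner_Integration.integrable_add)
    also have "(LINT x|lborel. (k x * of_real (p x)) * cnj (g x))
        = - (LINT x|lborel. (k' x * of_real (p x) + k x * of_real (p' x)) * cnj (h x))"
      by (rule by_parts[OF C1c_mult_p[OF k]])
    also have "(LINT x|lborel. (k' x * of_real (p x) + k x * of_real (p' x)) * cnj (h x))
        = (LINT x|lborel. (k' x * of_real (p x)) * cnj (h x) + (k x * of_real (p' x)) * cnj (h x))"
      by (simp only: distrib_right)
    also have "\<dots> = (LINT x|lborel. (k' x * of_real (p x)) * cnj (h x))
        + (LINT x|lborel. (k x * of_real (p' x)) * cnj (h x))"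
    proof -
      have "integrable lborel (\<lambda>x. (k' x * of_real (p x)) * cnj (h x))"
        by (intro Cc_integrable Cc_mult Cc_of_real_mult C1cD[OF k] p_cont cont)
      then show ?thesis using i3 by (rule Bochner_Integration.integral_add)
    qed
    finally show ?thesis unfolding lhs by simp
  qed
  then show ?thesis using f Lf by (simp add: weak_solution_def)
qed

text \<open>The domain conditions repeat those of \<open>T_graph\<close>, so that for the Jacobi
  coefficients the two graphs coincide once \<open>T_expr\<close> is identified with
  \<open>L\<close>.\<close>

definition minimal_graph :: "real L2_graph" where
  "minimal_graph = {(L2_class M f, L2_class M (L f f' f'')) | f f' f''.
     f \<in> L2_fun M \<and> (\<forall>x\<in>{-1<..<1}. (f has_vector_derivative f' x) (at x)) \<and>
     continuous_on {-1<..<1} f' \<and>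
     (\<exists>K. compact K \<and> K \<subseteq> {-1<..<1} \<and> (\<forall>x\<in>{-1<..<1} - K. f x = 0)) \<and>
     abs_continuous_on {-1<..<1} f' \<and>
     (AE x in lborel. x \<in> {-1<..<1} \<longrightarrow> (f' has_vector_derivative f'' x) (at x)) \<and>
     L f f' f'' \<in> L2_fun M}"

text \<open>The graph of the restricted operator \<open>T\<^sub>0\<close>.\<close>

definition core :: "real L2_graph" where
  "core = {(L2_class M k, L2_class M (L k k' k'')) | k k' k''. C2c k k' k''}"

lemma core_subset_minimal_graph: "core \<subseteq> minimal_graph"
proof
  fix z assume "z \<in> core"
  then obtain k k' k'' where z: "z = (L2_class M k, L2_class M (L k k' k''))" and k: "C2c k k' k''"
    unfolding core_def by blast
  note k1 = C1cD[OF C2cD(1)[OF k]] and k2 = C1cD[OF C2cD(2)[OF k]]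
  obtain r where "0 < r" "r < 1" "\<And>x. r < \<bar>x\<bar> \<Longrightarrow> k x = 0" using k1(2) by (metis CcE)
  then have "compact {-r..r} \<and> {-r..r} \<subseteq> {-1<..<1} \<and> (\<forall>x\<in>{-1<..<1} - {-r..r}. k x = 0)"
    by (auto simp: abs_if)
  then have "\<exists>K. compact K \<and> K \<subseteq> {-1<..<1} \<and> (\<forall>x\<in>{-1<..<1} - K. k x = 0)" by blast
  moreover have "AE x in lborel. x \<in> {-1<..<1} \<longrightarrow> (k' has_vector_derivative k'' x) (at x)"
    by (intro AE_I2 impI k2(1))
  ultimately have "k \<in> L2_fun M \<and> (\<forall>x\<in>{-1<..<1}. (k has_vector_derivative k' x) (at x)) \<and>
     continuous_on {-1<..<1} k' \<and>
     (\<exists>K. compact K \<and> K \<subseteq> {-1<..<1} \<and> (\<forall>x\<in>{-1<..<1} - K. k x = 0)) \<and>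
     abs_continuous_on {-1<..<1} k' \<and>
     (AE x in lborel. x \<in> {-1<..<1} \<longrightarrow> (k' has_vector_derivative k'' x) (at x)) \<and>
     L k k' k'' \<in> L2_fun M"
    by (intro conjI ballI C2c_L2_fun[OF k] C2c_L_L2_fun[OF k] k1(1) Cc_continuous[OF k1(3)]
        C1c_abs_continuous_on[OF C2cD(2)[OF k]])
  then show "z \<in> minimal_graph" unfolding minimal_graph_def z by blast
qed

lemma weak_solution_adjoint_core:
  assumes "weak_solution u v"
  shows "(L2_class M u, L2_class M v) \<in> adjoint_graph M core"
  using assms unfolding weak_solution_def adjoint_graph_def core_def
  by (auto simp: L2_inner_class C2c_L2_fun C2c_L_L2_fun)

lemma adjoint_core_weak_solution:
  assumes "(F, G) \<in> adjoint_graph M core"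
  obtains u v where "weak_solution u v" "F = L2_class M u" "G = L2_class M v"
proof -
  have "F \<in> L2 M" "G \<in> L2 M" using assms by (auto simp: adjoint_graph_def)
  then obtain u v where uv: "u \<in> L2_fun M" "v \<in> L2_fun M" "F = L2_class M u" "G = L2_class M v"
    by (auto elim!: L2E)
  have "(LINT x|M. L k k' k'' x * cnj (u x)) = (LINT x|M. k x * cnj (v x))" if k: "C2c k k' k''" for k k' k''
  proof -
    have "(L2_class M k, L2_class M (L k k' k'')) \<in> core" using k by (auto simp: core_def)
    then have "L2_inner M (L2_class M (L k k' k'')) F = L2_inner M (L2_class M k) G"
      using assms by (auto simp: adjoint_graph_def)
    then show ?thesis using uv by (simp add: L2_inner_class C2c_L2_fun[OF k] C2c_L_L2_fun[OF k])
  qed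
  with uv show thesis by (intro that[of u v]) (auto simp: weak_solution_def)
qed

lemma densely_defined_core: "densely_defined M core"
  unfolding densely_defined_def
proof (intro ballI allI impI)
  fix F and e :: real assume "F \<in> L2 M" "e > 0"
  then obtain f where f: "f \<in> L2_fun M" "F = L2_class M f" by (auto elim: L2E)
  have "e\<^sup>2 > 0" using \<open>e > 0\<close> by simp
  with C2c_dense[OF f(1)] obtain k k' k'' where k: "C2c k k' k''" "(LINT x|M. (cmod (f x - k x))\<^sup>2) < e\<^sup>2"
    by (rule C2c_approximableE)
  have "sqrt (LINT x|M. (cmod (f x - k x))\<^sup>2) < e"
    using k(2) \<open>e > 0\<close> by (metis real_sqrt_less_iff real_sqrt_abs abs_of_pos)
  then have "L2_dist M F (L2_class M k) < e" by (simp add: f L2_dist_class C2c_L2_fun[OF k(1)])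
  moreover have "L2_class M k \<in> Domain core" using k(1) by (auto simp: core_def)
  ultimately show "\<exists>G\<in>Domain core. L2_dist M F G < e" by blast
qed

theorem minimal_graph_essentially_self_adjoint:
  "\<exists>!A. self_adjoint_operator M A \<and> minimal_graph \<subseteq> A"
proof (rule unique_self_adjoint_extension[OF core_subset_minimal_graph _ densely_defined_core])
  show "minimal_graph \<subseteq> adjoint_graph M core"
  proof
    fix z assume "z \<in> minimal_graph"
    then obtain f f' f'' where z: "z = (L2_class M f, L2_class M (L f f' f''))"
      and f: "f \<in> L2_fun M" "\<forall>x\<in>{-1<..<1}. (f has_vector_derivative f' x) (at x)"
      "continuous_on {-1<..<1} f'"
      "\<exists>K. compact K \<and> K \<subseteq> {-1<..<1} \<and> (\<forall>x\<in>{-1<..<1} - K. f x = 0)"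
      "abs_continuous_on {-1<..<1} f'"
      "AE x in lborel. x \<in> {-1<..<1} \<longrightarrow> (f' has_vector_derivative f'' x) (at x)"
      "L f f' f'' \<in> L2_fun M"
      unfolding minimal_graph_def by blast
    from f(4) obtain K where K: "compact K" "K \<subseteq> {-1<..<1}" "\<forall>x\<in>{-1<..<1} - K. f x = 0" by blast
    have "weak_solution f (L f f' f'')"
      by (rule abs_continuous_weak_solution[OF f(1) bspec[OF f(2)] f(3) K(1,2) bspec[OF K(3)] f(5-7)])
    then show "z \<in> adjoint_graph M core" unfolding z by (rule weak_solution_adjoint_core)
  qed
next
  fix F G F' G' assume FG: "(F, G) \<in> adjoint_graph M core" and FG': "(F', G') \<in> adjoint_graph M core"
  obtain u v where uv: "weak_solution u v" "F = L2_class M u" "G = L2_class M v"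
    by (rule adjoint_core_weak_solution[OF FG])
  obtain u' v' where uv': "weak_solution u' v'" "F' = L2_class M u'" "G' = L2_class M v'"
    by (rule adjoint_core_weak_solution[OF FG'])
  have "u \<in> L2_fun M" "v \<in> L2_fun M" "u' \<in> L2_fun M" "v' \<in> L2_fun M"
    using uv(1) uv'(1) by (auto simp: weak_solution_def)
  then show "L2_inner M G F' = L2_inner M F G'"
    using weak_solution_symmetric[OF uv'(1) uv(1)] by (simp add: uv uv' L2_inner_class)
qed

end

section \<open>The Jacobi operator\<close>

lemma jacobi_weight_pos:
  assumes "\<alpha> > -1" "\<beta> > -1" "x \<in> {-1<..<1}"
  shows "0 < jacobi_weight \<alpha> \<beta> x"
  using assms unfolding jacobi_weight_def
  by (auto intro!: mult_pos_pos divide_pos_pos Gamma_real_pos)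

lemma jacobi_weight_deriv:
  assumes "x \<in> {-1<..<1}"
  shows "(jacobi_weight \<alpha> \<beta> has_real_derivative
    jacobi_weight \<alpha> \<beta> x * (\<beta> / (1 + x) - \<alpha> / (1 - x))) (at x)"
proof -
  have pos: "1 - x > 0" "1 + x > 0" using assms by auto
  have 1: "((\<lambda>x. (1 - x) powr \<alpha>) has_real_derivative (1 - x) powr \<alpha> * - (\<alpha> / (1 - x))) (at x)"
    using pos(1) by (auto intro!: derivative_eq_intros simp: powr_diff)
  have 2: "((\<lambda>x. (1 + x) powr \<beta>) has_real_derivative (1 + x) powr \<beta> * (\<beta> / (1 + x))) (at x)"
    using pos(2) by (auto intro!: derivative_eq_intros simp: powr_diff)
  have alg: "c * (A * - a) * B + (B * b) * (c * A) = c * A * B * (b - a)" for A B a b c :: real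
    by (simp add: algebra_simps)
  let ?c = "2 powr (-\<alpha> - \<beta> - 1) * (Gamma (\<alpha> + \<beta> + 2) / (Gamma (\<alpha> + 1) * Gamma (\<beta> + 1)))"
  show ?thesis
    unfolding jacobi_weight_def[abs_def]
    by (rule DERIV_cong[OF DERIV_mult[OF DERIV_cmult[OF 1, of ?c] 2] alg])
qed

text \<open>The substitution t = (1 + x) / 2 turns the weight into a multiple of the integrand of
  the Beta function with parameters \<beta> + 1 and \<alpha> + 1, which is integrable for positive
  parameters.\<close>

lemma jacobi_weight_integrable:
  assumes "\<alpha> > -1" "\<beta> > -1"
  shows "set_integrable lborel {-1<..<1} (jacobi_weight \<alpha> \<beta>)"
proof -
  let ?f = "\<lambda>t. indicator {0..1} t *\<^sub>R (t powr \<beta> * (1 - t) powr \<alpha>)"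
  have "integrable lborel ?f"
    using integrable_Beta[of "\<beta> + 1" "\<alpha> + 1"] assms by (simp add: set_integrable_def)
  then have "integrable lborel (\<lambda>x. ?f (1 / 2 + 1 / 2 * x))"
    by (rule lborel_integrable_real_affine) simp
  then have "integrable lborel (\<lambda>x. c * ?f (1 / 2 + 1 / 2 * x))" for c by simp
  then have "integrable lborel (\<lambda>x. 2 powr (-\<alpha> - \<beta> - 1) * (Gamma (\<alpha> + \<beta> + 2) / (Gamma (\<alpha> + 1) * Gamma (\<beta> + 1)))
      * 2 powr \<alpha> * 2 powr \<beta> * ?f (1 / 2 + 1 / 2 * x))" .
  then show ?thesis
    unfolding set_integrable_def
  proof (rule Bochner_Integration.integrable_cong[THEN iffD1, OF refl, rotated])
    fix x :: real
    show "2 powr (-\<alpha> - \<beta> - 1) * (Gamma (\<alpha> + \<beta> + 2) / (Gamma (\<alpha> + 1) * Gamma (\<beta> + 1)))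
      * 2 powr \<alpha> * 2 powr \<beta> * ?f (1 / 2 + 1 / 2 * x) = indicator {-1<..<1} x *\<^sub>R jacobi_weight \<alpha> \<beta> x"
    proof (cases "x \<in> {-1<..<1}")
      case True
      have "(1 / 2 + 1 / 2 * x) powr \<beta> = (1 + x) powr \<beta> / 2 powr \<beta>"
        "(1 - (1 / 2 + 1 / 2 * x)) powr \<alpha> = (1 - x) powr \<alpha> / 2 powr \<alpha>"
        using True by (simp_all add: powr_divide[symmetric] field_simps)
      then show ?thesis using True by (simp add: jacobi_weight_def)
    \<comment> \<open>At the end points one factor is \<open>0 powr _\<close>, which is 0, so the
      closed interval of the Beta integral does no harm.\<close>
    qed (auto simp: indicator_def)
  qed
qed

text \<open>The logarithmic derivative of w is \<beta> / (1 + x) - \<alpha> / (1 - x). Together with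
  the contribution -4x of (1 - x^2)^2 it makes p' / w equal to the first-order coefficient of T,
  which puts T into divergence form. The bound \<open>p_le\<close> holds with equality.\<close>

lemma sturm_liouville_jacobi:
  assumes "\<alpha> > -1" "\<beta> > -1"
  shows "sturm_liouville (jacobi_weight \<alpha> \<beta>) (\<lambda>x. (1 - x\<^sup>2)\<^sup>2 * jacobi_weight \<alpha> \<beta> x)
    (\<lambda>x. jacobi_weight \<alpha> \<beta> x * ((1 - x\<^sup>2) * (\<beta> - \<alpha> - (\<alpha> + \<beta> + 4) * x)))
    (\<lambda>x. c * (1 - x\<^sup>2)) \<bar>c\<bar>"
proof
  have cont: "continuous_on {-1<..<1} (jacobi_weight \<alpha> \<beta>)"
    using jacobi_weight_deriv by (intro continuous_at_imp_continuous_on ballI DERIV_isCont)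
  then show "continuous_on {-1<..<1} (jacobi_weight \<alpha> \<beta>)" .
  show "continuous_on {-1<..<1} (\<lambda>x. jacobi_weight \<alpha> \<beta> x * ((1 - x\<^sup>2) * (\<beta> - \<alpha> - (\<alpha> + \<beta> + 4) * x)))"
    by (intro continuous_intros cont)
  show "continuous_on {-1<..<1} (\<lambda>x. c * (1 - x\<^sup>2))" by (intro continuous_intros)
  show "set_integrable lborel {-1<..<1} (jacobi_weight \<alpha> \<beta>)"
    by (rule jacobi_weight_integrable[OF assms])
  fix x :: real assume x: "x \<in> {-1<..<1}"
  have sq: "0 < 1 - x\<^sup>2" by (rule one_minus_square_pos[OF x])
  show "0 < jacobi_weight \<alpha> \<beta> x" by (rule jacobi_weight_pos[OF assms x])
  then show "0 < (1 - x\<^sup>2)\<^sup>2 * jacobi_weight \<alpha> \<beta> x" using sq by simp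
  have nz: "1 + x \<noteq> 0" "1 - x \<noteq> 0" using x by auto
  have "(1 + x) * (1 - x) * (\<beta> / (1 + x) - \<alpha> / (1 - x)) = \<beta> * (1 - x) - \<alpha> * (1 + x)"
  proof -
    have "(1 + x) * (1 - x) * (\<beta> / (1 + x) - \<alpha> / (1 - x))
        = ((1 + x) * (\<beta> / (1 + x))) * (1 - x) - ((1 - x) * (\<alpha> / (1 - x))) * (1 + x)"
      by (simp only: right_diff_distrib mult_ac)
    then show ?thesis using nz by simp
  qed
  moreover have "(1 + x) * (1 - x) = 1 - x\<^sup>2" by (simp add: power2_eq_square algebra_simps)
  ultimately have "(1 - x\<^sup>2) * (\<beta> / (1 + x) - \<alpha> / (1 - x)) = \<beta> * (1 - x) - \<alpha> * (1 + x)" by metis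
  then have eq: "- 4 * x + (1 - x\<^sup>2) * (\<beta> / (1 + x) - \<alpha> / (1 - x)) = \<beta> - \<alpha> - (\<alpha> + \<beta> + 4) * x"
    by (simp only:) (simp add: algebra_simps)
  have alg: "(- 4 * x * s) * W + s\<^sup>2 * (W * E) = W * (s * (- 4 * x + s * E))" for s W E :: real
    by (simp add: power2_eq_square algebra_simps)
  have "((\<lambda>x. (1 - x\<^sup>2)\<^sup>2 * jacobi_weight \<alpha> \<beta> x) has_real_derivative
      (- 4 * x * (1 - x\<^sup>2)) * jacobi_weight \<alpha> \<beta> x
      + (1 - x\<^sup>2)\<^sup>2 * (jacobi_weight \<alpha> \<beta> x * (\<beta> / (1 + x) - \<alpha> / (1 - x)))) (at x)"
    by (auto intro!: derivative_eq_intros jacobi_weight_deriv x)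
  also have "(- 4 * x * (1 - x\<^sup>2)) * jacobi_weight \<alpha> \<beta> x
      + (1 - x\<^sup>2)\<^sup>2 * (jacobi_weight \<alpha> \<beta> x * (\<beta> / (1 + x) - \<alpha> / (1 - x)))
     = jacobi_weight \<alpha> \<beta> x * ((1 - x\<^sup>2) * (- 4 * x + (1 - x\<^sup>2) * (\<beta> / (1 + x) - \<alpha> / (1 - x))))"
    by (rule alg)
  finally show "((\<lambda>x. (1 - x\<^sup>2)\<^sup>2 * jacobi_weight \<alpha> \<beta> x) has_real_derivative
      jacobi_weight \<alpha> \<beta> x * ((1 - x\<^sup>2) * (\<beta> - \<alpha> - (\<alpha> + \<beta> + 4) * x))) (at x)"
    unfolding eq .
  have "1 - x\<^sup>2 \<le> 1" by simp
  then show "\<bar>c * (1 - x\<^sup>2)\<bar> \<le> \<bar>c\<bar>"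
    using sq mult_left_mono[of "1 - x\<^sup>2" 1 "\<bar>c\<bar>"] by (simp add: abs_mult)
qed simp

theorem proposition2p1:
  fixes \<alpha> \<beta> :: real and \<kappa> :: complex
  assumes "\<alpha> > -1" and "\<beta> > -1" and "\<beta> \<ge> \<alpha>"
    and "\<kappa> \<in> {of_real t | t. t \<ge> 0} \<union> {\<i> * of_real t | t. t > 0}"
  shows "\<exists>!A. self_adjoint_operator (jacobi_measure \<alpha> \<beta>) A \<and> T_graph \<alpha> \<beta> \<kappa> \<subseteq> A"
proof -
  have "\<kappa>\<^sup>2 = of_real (Re (\<kappa>\<^sup>2))"
    using assms(4) by (auto simp: power_mult_distrib simp flip: of_real_power)
  \<comment> \<open>The square of \<kappa> is t^2 or -t^2, so the zeroth-order coefficient is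
    real.\<close>
  then obtain k where k: "\<kappa>\<^sup>2 = of_real k" by blast
  define c where "c = 1 / 4 * (k - (\<alpha> + \<beta> + 3)\<^sup>2)"
  interpret sturm_liouville "jacobi_weight \<alpha> \<beta>" "\<lambda>x. (1 - x\<^sup>2)\<^sup>2 * jacobi_weight \<alpha> \<beta> x"
    "\<lambda>x. jacobi_weight \<alpha> \<beta> x * ((1 - x\<^sup>2) * (\<beta> - \<alpha> - (\<alpha> + \<beta> + 4) * x))"
    "\<lambda>x. c * (1 - x\<^sup>2)" "\<bar>c\<bar>"
    by (rule sturm_liouville_jacobi[OF assms(1,2)])
  have M: "jacobi_measure \<alpha> \<beta> = M" by (simp add: M_def jacobi_measure_def)
  \<comment> \<open>The cancellation of w in p / w and p' / w is valid only inside the interval.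
    Agreement on the space of M is enough, as it determines the classes.\<close>
  have L: "T_expr \<alpha> \<beta> \<kappa> f f' f'' x = L f f' f'' x" if "x \<in> space M" for f f' f'' x
  proof -
    have c: "1 / 4 * (\<kappa>\<^sup>2 - of_real ((\<alpha> + \<beta> + 3)\<^sup>2)) = of_real c" by (simp add: c_def k)
    have "L f f' f'' x = f'' x * of_real ((1 - x\<^sup>2)\<^sup>2)
        + f' x * of_real ((1 - x\<^sup>2) * (\<beta> - \<alpha> - (\<alpha> + \<beta> + 4) * x)) + f x * of_real (c * (1 - x\<^sup>2))"
      unfolding L_def using w_nz[of x] that by (simp add: space_M)
    then show ?thesis unfolding T_expr_def c by (simp only: of_real_mult mult_ac)
  qed
  have "T_expr \<alpha> \<beta> \<kappa> f f' f'' \<in> L2_fun M \<longleftrightarrow> L f f' f'' \<in> L2_fun M" for f f' f''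
    unfolding L2_fun_def using L
    by (simp cong: measurable_cong Bochner_Integration.integrable_cong)
  moreover have "L2_class M (T_expr \<alpha> \<beta> \<kappa> f f' f'') = L2_class M (L f f' f'')" for f f' f''
    using L by (intro L2_class_eqI AE_I2)
  ultimately have "T_graph \<alpha> \<beta> \<kappa> = minimal_graph"
    unfolding T_graph_def minimal_graph_def M by simp
  then show ?thesis using minimal_graph_essentially_self_adjoint by (simp add: M)
qed

end
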